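(* Let $n\ge 1$, $s>0$, $1<p<\infty$ and $\lambda>1$. (i) (Local compactness.) Let $\Omega\subset\mathbb R^n$ be a bounded Lipschitz domain and assume that $n=2sp$. Then the restriction to $\Omega$ yields the compact embedding $$\mathcal{L}^{p}_{s+\ln,\lambda}(\mathbb R^n)\hookrightarrow\hookrightarrow C(\overline{\Omega}).$$ Consequently, the embeddings $\mathcal{L}^{p}_{s+\ln,\lambda}(\mathbb R^n)\hookrightarrow\hookrightarrow L^q(\Omega)$ are compact for all $1\le q\le\infty$. (ii) (Global radial compactness.) Assume $n\ge2$ and $n=2sp$. Then the embedding $$\mathcal{L}^{p}_{s+\ln,\lambda,\mathrm{rad}}(\mathbb R^n)\hookrightarrow\hookrightarrow C_0(\mathbb R^n)$$ is compact. Consequently, the embeddings $\mathcal{L}^{p}_{s+\ln,\lambda,\mathrm{rad}}(\mathbb R^n)\hookrightarrow\hookrightarrow L^q(\mathbb R^n)$ are compact for all $p<q\le\infty$.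
   Context: The Fourier transform is $\widehat u(\xi)=\int_{\mathbb{R}^n}u(x)e^{-2\pi i x\cdot\xi}\,dx$, extended to $\mathcal S'(\mathbb R^n)$. For $s>0$, $\lambda>1$, $(\lambda I-\Delta)^{s+\ln}$ is the Fourier multiplier on $\mathcal S'(\mathbb R^n)$ with symbol $(\lambda+4\pi^2|\xi|^2)^s\ln(\lambda+4\pi^2|\xi|^2)$, and $\mathcal L^{p}_{s+\ln,\lambda}(\mathbb R^n)=\{u\in\mathcal S'(\mathbb R^n):(\lambda I-\Delta)^{s+\ln}u\in L^p(\mathbb R^n)\}$ with norm $\|u\|_{\mathcal L^{p}_{s+\ln,\lambda}}=\|(\lambda I-\Delta)^{s+\ln}u\|_{L^p}$. $\mathcal{L}^{p}_{s+\ln,\lambda,\mathrm{rad}}(\mathbb R^n)$ is its closed subspace of radially symmetric functions. $C_0(\mathbb R^n)$ is the space of continuous functions vanishing at infinity with the supremum norm. The symbol $\hookrightarrow\hookrightarrow$ denotes a compact embedding (bounded sequences have images with convergent subsequences in the target norm). *)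

theory Defs
  imports "HOL-Analysis.Analysis" "HOL-Probability.Essential_Supremum"
begin

section \<open>Schwartz functions and tempered distributions\<close>

text \<open>The space $\mathbb{R}^n$ is an arbitrary Euclidean space \<open>'a\<close> with \<open>DIM('a) = n\<close>. All functions
  and distributions are complex-valued.\<close>

primrec partial_derivs :: "'a list \<Rightarrow> ('a::euclidean_space \<Rightarrow> complex) \<Rightarrow> 'a \<Rightarrow> complex" where
  "partial_derivs [] f = f"
| "partial_derivs (b # bs) f = (\<lambda>x. frechet_derivative (partial_derivs bs f) (at x) b)"

definition smooth :: "('a::euclidean_space \<Rightarrow> complex) \<Rightarrow> bool" where
  "smooth f \<longleftrightarrow>
     (\<forall>bs. set bs \<subseteq> Basis \<longrightarrow> (\<forall>x. partial_derivs bs f differentiable (at x)))"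

definition schwartz :: "('a::euclidean_space \<Rightarrow> complex) set" where
  "schwartz = {f. smooth f \<and>
     (\<forall>bs k. set bs \<subseteq> Basis \<longrightarrow>
        bounded (range (\<lambda>x. (1 + norm x) ^ k *\<^sub>R partial_derivs bs f x)))}"

definition schwartz_seminorm :: "nat \<Rightarrow> ('a::euclidean_space \<Rightarrow> complex) \<Rightarrow> real" where
  "schwartz_seminorm N f =
     (SUP (bs, x) \<in> {bs. set bs \<subseteq> Basis \<and> length bs \<le> N} \<times> UNIV.
        (1 + norm x) ^ N * norm (partial_derivs bs f x))"

text \<open>The seminorms above are increasing in \<open>N\<close> and generate the topology of the Schwartz space, so a
  linear functional is continuous iff it is bounded by a multiple of one of them. Functionals are
  \<open>extensional\<close> so that HOL equality is equality of distributions.\<close>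

definition tempered_distributions :: "(('a::euclidean_space \<Rightarrow> complex) \<Rightarrow> complex) set" where
  "tempered_distributions = {T. T \<in> extensional schwartz \<and>
     (\<forall>f\<in>schwartz. \<forall>g\<in>schwartz. T (\<lambda>x. f x + g x) = T f + T g) \<and>
     (\<forall>c. \<forall>f\<in>schwartz. T (\<lambda>x. c * f x) = c * T f) \<and>
     (\<exists>C N. \<forall>f\<in>schwartz. norm (T f) \<le> C * schwartz_seminorm N f)}"

definition regular_dist ::
    "('a::euclidean_space \<Rightarrow> complex) \<Rightarrow> ('a \<Rightarrow> complex) \<Rightarrow> complex" where
  "regular_dist f = (\<lambda>\<phi>\<in>schwartz. LINT x|lborel. f x * \<phi> x)"

section \<open>Fourier transform and Fourier multipliers\<close>

definition fourier :: "('a::euclidean_space \<Rightarrow> complex) \<Rightarrow> 'a \<Rightarrow> complex" where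
  "fourier f = (\<lambda>\<xi>. LINT x|lborel. f x * exp (- 2 * of_real pi * \<i> * of_real (x \<bullet> \<xi>)))"

definition inv_fourier :: "('a::euclidean_space \<Rightarrow> complex) \<Rightarrow> 'a \<Rightarrow> complex" where
  "inv_fourier f = (\<lambda>x. LINT \<xi>|lborel. f \<xi> * exp (2 * of_real pi * \<i> * of_real (x \<bullet> \<xi>)))"

text \<open>The operations on tempered distributions are defined by transposition; \<open>mult_dist m\<close> is meant
  for smooth \<open>m\<close> all of whose derivatives have polynomial growth.\<close>

definition fourier_dist ::
    "(('a::euclidean_space \<Rightarrow> complex) \<Rightarrow> complex) \<Rightarrow> ('a \<Rightarrow> complex) \<Rightarrow> complex" where
  "fourier_dist T = (\<lambda>\<phi>\<in>schwartz. T (fourier \<phi>))"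

definition inv_fourier_dist ::
    "(('a::euclidean_space \<Rightarrow> complex) \<Rightarrow> complex) \<Rightarrow> ('a \<Rightarrow> complex) \<Rightarrow> complex" where
  "inv_fourier_dist T = (\<lambda>\<phi>\<in>schwartz. T (inv_fourier \<phi>))"

definition mult_dist ::
    "('a::euclidean_space \<Rightarrow> complex) \<Rightarrow> (('a \<Rightarrow> complex) \<Rightarrow> complex) \<Rightarrow> ('a \<Rightarrow> complex) \<Rightarrow> complex" where
  "mult_dist m T = (\<lambda>\<phi>\<in>schwartz. T (\<lambda>\<xi>. m \<xi> * \<phi> \<xi>))"

definition fourier_multiplier ::
    "('a::euclidean_space \<Rightarrow> complex) \<Rightarrow> (('a \<Rightarrow> complex) \<Rightarrow> complex) \<Rightarrow> ('a \<Rightarrow> complex) \<Rightarrow> complex" where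
  "fourier_multiplier m T = inv_fourier_dist (mult_dist m (fourier_dist T))"

definition log_bessel_symbol :: "real \<Rightarrow> real \<Rightarrow> 'a::euclidean_space \<Rightarrow> real" where
  "log_bessel_symbol lam s \<xi> =
     (lam + 4 * pi\<^sup>2 * (norm \<xi>)\<^sup>2) powr s * ln (lam + 4 * pi\<^sup>2 * (norm \<xi>)\<^sup>2)"

text \<open>The operator $(\lambda I - \Delta)^{s+\ln}$.\<close>

definition log_bessel_op ::
    "real \<Rightarrow> real \<Rightarrow> (('a::euclidean_space \<Rightarrow> complex) \<Rightarrow> complex) \<Rightarrow> ('a \<Rightarrow> complex) \<Rightarrow> complex" where
  "log_bessel_op lam s = fourier_multiplier (\<lambda>\<xi>. of_real (log_bessel_symbol lam s \<xi>))"

section \<open>Function spaces\<close>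

definition Lq_space :: "ennreal \<Rightarrow> 'a measure \<Rightarrow> ('a \<Rightarrow> complex) set" where
  "Lq_space q M = {f \<in> borel_measurable M.
     if q = \<infinity> then \<exists>C. AE x in M. norm (f x) \<le> C
     else integrable M (\<lambda>x. norm (f x) powr enn2real q)}"

definition Lq_norm :: "ennreal \<Rightarrow> 'a measure \<Rightarrow> ('a \<Rightarrow> complex) \<Rightarrow> real" where
  "Lq_norm q M f =
     (if q = \<infinity> then real_of_ereal (esssup M (\<lambda>x. ereal (norm (f x))))
      else (LINT x|M. norm (f x) powr enn2real q) powr (1 / enn2real q))"

definition log_bessel_space ::
    "real \<Rightarrow> real \<Rightarrow> real \<Rightarrow> (('a::euclidean_space \<Rightarrow> complex) \<Rightarrow> complex) set" where
  "log_bessel_space p lam s = {u \<in> tempered_distributions.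
     \<exists>f \<in> Lq_space (ennreal p) lborel. log_bessel_op lam s u = regular_dist f}"

text \<open>The density \<open>f\<close> is unique up to null sets, so that its norm is unique.\<close>

definition log_bessel_norm ::
    "real \<Rightarrow> real \<Rightarrow> real \<Rightarrow> (('a::euclidean_space \<Rightarrow> complex) \<Rightarrow> complex) \<Rightarrow> real" where
  "log_bessel_norm p lam s u =
     (THE r. \<exists>f \<in> Lq_space (ennreal p) lborel.
        log_bessel_op lam s u = regular_dist f \<and> r = Lq_norm (ennreal p) lborel f)"

definition radial_dist :: "(('a::euclidean_space \<Rightarrow> complex) \<Rightarrow> complex) \<Rightarrow> bool" where
  "radial_dist u \<longleftrightarrow>
     (\<exists>f \<in> borel_measurable lborel.
        (\<forall>\<phi>\<in>schwartz. integrable lborel (\<lambda>x. f x * \<phi> x)) \<and> u = regular_dist f \<and>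
        (\<forall>x y. norm x = norm y \<longrightarrow> f x = f y))"

definition log_bessel_space_rad ::
    "real \<Rightarrow> real \<Rightarrow> real \<Rightarrow> (('a::euclidean_space \<Rightarrow> complex) \<Rightarrow> complex) set" where
  "log_bessel_space_rad p lam s = {u \<in> log_bessel_space p lam s. radial_dist u}"

text \<open>Elements of $C(K)$ are represented by total functions whose values outside \<open>K\<close> are irrelevant.\<close>

definition C_space :: "'a::euclidean_space set \<Rightarrow> ('a \<Rightarrow> complex) set" where
  "C_space K = {g. continuous_on K g}"

definition C0_space :: "('a::euclidean_space \<Rightarrow> complex) set" where
  "C0_space = {g. continuous_on UNIV g \<and> (g \<longlongrightarrow> 0) at_infinity}"

definition sup_norm :: "'a set \<Rightarrow> ('a \<Rightarrow> complex) \<Rightarrow> real" where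
  "sup_norm K g = (SUP x\<in>K. norm (g x))"

section \<open>Lipschitz domains\<close>

text \<open>Near each boundary point, \<open>\<Omega>\<close> is the part above a Lipschitz graph over the hyperplane
  orthogonal to a suitable unit vector \<open>\<nu>\<close>.\<close>

definition bounded_lipschitz_domain :: "'a::euclidean_space set \<Rightarrow> bool" where
  "bounded_lipschitz_domain \<Omega> \<longleftrightarrow>
     open \<Omega> \<and> connected \<Omega> \<and> \<Omega> \<noteq> {} \<and> bounded \<Omega> \<and>
     (\<forall>z \<in> frontier \<Omega>. \<exists>r \<nu> L (\<gamma> :: 'a \<Rightarrow> real). r > 0 \<and> norm \<nu> = 1 \<and>
        L-lipschitz_on {y. y \<bullet> \<nu> = 0} \<gamma> \<and>
        \<Omega> \<inter> ball z r = {x \<in> ball z r. x \<bullet> \<nu> > \<gamma> (x - (x \<bullet> \<nu>) *\<^sub>R \<nu>)})"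

section \<open>Compact embeddings\<close>

text \<open>\<open>restricts_to \<Omega> u g\<close>: the restriction to the open set \<open>\<Omega>\<close> of the distribution \<open>u\<close> is the
  function \<open>g\<close>. The functions \<open>\<phi>\<close> range over $C_c^\infty(\Omega)$.\<close>

definition restricts_to ::
    "'a::euclidean_space set \<Rightarrow> (('a \<Rightarrow> complex) \<Rightarrow> complex) \<Rightarrow> ('a \<Rightarrow> complex) \<Rightarrow> bool" where
  "restricts_to \<Omega> u g \<longleftrightarrow>
     (\<forall>\<phi>\<in>schwartz. compact (closure {x. \<phi> x \<noteq> 0}) \<and> closure {x. \<phi> x \<noteq> 0} \<subseteq> \<Omega> \<longrightarrow>
        u \<phi> = (LINT x:\<Omega>|lborel. g x * \<phi> x))"

definition is_function :: "(('a::euclidean_space \<Rightarrow> complex) \<Rightarrow> complex) \<Rightarrow> ('a \<Rightarrow> complex) \<Rightarrow> bool" where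
  "is_function u g \<longleftrightarrow> u = regular_dist g"

text \<open>Compactness of the map from \<open>X\<close> (with norm \<open>normX\<close>) to \<open>Y\<close> (with norm \<open>normY\<close>) that is
  given by the relation \<open>R\<close>: \<open>R u g\<close> says that the function \<open>g\<close> is a representative of the image of
  \<open>u\<close>. A relation is needed because elements of \<open>Y\<close> are functions up to null sets, resp. up to
  their values outside the set of interest.\<close>

definition compact_embedding ::
    "'u set \<Rightarrow> ('u \<Rightarrow> real) \<Rightarrow> ('u \<Rightarrow> ('a \<Rightarrow> complex) \<Rightarrow> bool) \<Rightarrow>
     ('a \<Rightarrow> complex) set \<Rightarrow> (('a \<Rightarrow> complex) \<Rightarrow> real) \<Rightarrow> bool" where
  "compact_embedding X normX R Y normY \<longleftrightarrow>
     (\<forall>u\<in>X. \<exists>g\<in>Y. R u g) \<and>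
     (\<exists>C. \<forall>u\<in>X. \<forall>g\<in>Y. R u g \<longrightarrow> normY g \<le> C * normX u) \<and>
     (\<forall>u g. (\<forall>k::nat. u k \<in> X \<and> g k \<in> Y \<and> R (u k) (g k)) \<and> bounded (range (\<lambda>k. normX (u k))) \<longrightarrow>
        (\<exists>h\<in>Y. \<exists>r. strict_mono (r :: nat \<Rightarrow> nat) \<and>
           (\<lambda>k. normY (\<lambda>x. g (r k) x - h x)) \<longlonglongrightarrow> 0))"

end

theory Submission
  imports Defs "HOL-Probability.Probability" "HOL-Complex_Analysis.Great_Picard" "HOL-Real_Asymp.Real_Asymp"
begin

text \<open>For \<open>a > 1\<close> the quotient \<open>a powr (- s) / ln a\<close> is the integral of \<open>a powr (- t)\<close> over \<open>t \<ge> s\<close>, and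
  each \<open>a powr (- t)\<close> is a Gamma integral of \<open>exp (- a * r)\<close> over \<open>r > 0\<close>. So the reciprocal of the
  symbol is a superposition of the Gaussians \<open>exp (- 4 * pi\<^sup>2 * r * (norm \<xi>)\<^sup>2)\<close> against a finite
  measure \<open>heat_mixture\<close> on the times \<open>r\<close> (\<open>heat_mixture_laplace\<close>). On the space side this says that a
  distribution which the operator maps to the function \<open>f\<close> is itself the function \<open>potential lam s f\<close>, the same
  superposition of the heat evolutions of \<open>f\<close> at the times \<open>r\<close> (\<open>representation\<close>). Transposing this to test functions
  uses that Schwartz functions are preserved by the Fourier transform and by division by the symbol,
  and Fourier inversion.

  Put \<open>p' = p / (p - 1)\<close> and \<open>n = DIM('a)\<close>. When \<open>n = 2 * s * p\<close>, the \<open>p'\<close>-norm of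
  \<open>r powr (s - 1) * heat r\<close> is a multiple of \<open>1 / r\<close>, which just fails to be integrable at \<open>0\<close>. The
  logarithm in the symbol adds the factor \<open>1 / ln (1 / r)\<close> to the density of the mixture. Its first
  power against \<open>dr / r\<close> still diverges, so the triangle inequality for the norm is too weak, but its
  \<open>p'\<close>-th power converges. Hoelder's inequality on the product of time and space, with a weight in the
  scale invariant quantity \<open>(norm (x - y))\<^sup>2 / r\<close>, needs only that \<open>p'\<close>-th power
  (\<open>small_time_bound\<close>). Hence the times \<open>r < e\<close> contribute a quantity that tends to \<open>0\<close> with \<open>e\<close>
  uniformly on bounded sets of densities, while the times \<open>r \<ge> e\<close> contribute a uniformly Hoelder continuous
  function. Potentials of a bounded set of densities are therefore uniformly bounded and uniformly
  equicontinuous, and the finite mass of the mixture bounds them in \<open>L\<^sup>p\<close>.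

  On the closure of a bounded domain the theorem of Arzela and Ascoli now gives the compactness, first
  for continuous functions and then for all \<open>L\<^sup>q\<close>. For radial distributions the potential is radial. If
  it exceeds \<open>\<epsilon>\<close> at distance \<open>R\<close> from the origin, then equicontinuity makes it exceed \<open>\<epsilon> / 2\<close> on an
  annulus of fixed width and radius \<open>R\<close>, whose volume grows at least like \<open>R\<close> in dimension at least
  two; the \<open>L\<^sup>p\<close> bound excludes this for large \<open>R\<close>. This uniform decay (\<open>rep_decay\<close>) allows the
  theorem of Arzela and Ascoli to be applied to the radial profiles on the half-line compactified to
  \<open>{0..1}\<close>. The \<open>L\<^sup>q\<close> statements for \<open>q > p\<close> follow by interpolation between \<open>L\<^sup>p\<close> and the supremum norm.

  The target spaces consist of functions that represent a distribution. Smooth bump functions increase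
  to indicators of boxes, so that a representing function is unique up to null sets (\<open>AE_eq_on_open\<close>)
  and can always be exchanged for the continuous one, \<open>bessel_rep p lam s u\<close>.\<close>

section \<open>Schwartz functions\<close>

abbreviation pd :: "'a \<Rightarrow> ('a::euclidean_space \<Rightarrow> complex) \<Rightarrow> 'a \<Rightarrow> complex" where
  "pd b f \<equiv> (\<lambda>x. frechet_derivative f (at x) b)"

text \<open>The outermost derivative in \<open>partial_derivs\<close> comes from the head of the list, so the innermost one, which
  is the one needed to pass from a function to its derivative, comes from the last element.\<close>

lemma partial_derivs_snoc: "partial_derivs (bs @ [b]) f = partial_derivs bs (pd b f)"
  by (induction bs) auto

text \<open>Schwartz functions form the largest set of rapidly decreasing differentiable functions that is stable under
  partial derivatives. Membership can thus be shown by exhibiting a stable set, without computing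
  iterated derivatives.\<close>

lemma schwartz_coinduct:
  assumes "f \<in> A"
  assumes deriv: "\<And>f. f \<in> A \<Longrightarrow> \<exists>g. (\<forall>b\<in>Basis. g b \<in> A) \<and>
     (\<forall>x. \<exists>D. (f has_derivative D) (at x) \<and> (\<forall>b\<in>Basis. D b = g b x))"
  assumes decay: "\<And>f k. f \<in> A \<Longrightarrow> \<exists>C. \<forall>x. (1 + norm x) ^ k * norm (f x) \<le> C"
  shows "(f :: 'a::euclidean_space \<Rightarrow> complex) \<in> schwartz"
proof -
  have *: "partial_derivs bs f \<in> A" if "set bs \<subseteq> Basis" for bs
    using that
  proof (induction bs)
    case Nil
    then show ?case using assms(1) by simp
  next
    case (Cons b bs)
    then have "partial_derivs bs f \<in> A" "b \<in> Basis" by auto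
    then obtain g where g: "g b \<in> A"
      "\<forall>x. \<exists>D. (partial_derivs bs f has_derivative D) (at x) \<and> D b = g b x"
      using deriv by meson
    have "frechet_derivative (partial_derivs bs f) (at x) b = g b x" for x
      using g(2) frechet_derivative_at by metis
    then have "partial_derivs (b # bs) f = g b" by auto
    then show ?case using g(1) by simp
  qed
  have "partial_derivs bs f differentiable at x" if "set bs \<subseteq> Basis" for bs x
    using deriv[OF *[OF that]] differentiable_def by blast
  moreover have "bounded (range (\<lambda>x. (1 + norm x) ^ k *\<^sub>R partial_derivs bs f x))"
    if bs: "set bs \<subseteq> Basis" for bs k
  proof -
    obtain C where "\<forall>x. (1 + norm x) ^ k * norm (partial_derivs bs f x) \<le> C"
      using decay[OF *[OF bs]] by blast
    then show ?thesis by (intro boundedI[of _ C]) (auto simp: abs_mult power_abs)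
  qed
  ultimately show ?thesis by (auto simp: schwartz_def smooth_def)
qed

lemma schwartz_has_derivative:
  assumes "f \<in> schwartz"
  shows "(f has_derivative frechet_derivative f (at x)) (at x)"
proof -
  have "partial_derivs [] f differentiable at x"
    using assms unfolding schwartz_def smooth_def by (metis (mono_tags, lifting) empty_set empty_subsetI mem_Collect_eq)
  then show ?thesis using frechet_derivative_works by auto
qed

lemma schwartz_decay:
  assumes "f \<in> schwartz"
  shows "\<exists>C. \<forall>x. (1 + norm x) ^ k * norm (f x) \<le> C"
proof -
  have "bounded (range (\<lambda>x. (1 + norm x) ^ k *\<^sub>R partial_derivs [] f x))"
    using assms unfolding schwartz_def by (elim CollectE conjE allE[of _ "[]"] allE[of _ k] impE) auto
  then obtain C where "\<And>x. norm ((1 + norm x) ^ k *\<^sub>R f x) \<le> C" by (auto simp: bounded_iff)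
  then show ?thesis by (intro exI[of _ C]) (auto simp: power_abs)
qed

text \<open>The form of the decay estimate that is used for domination; the constant is made positive for division.\<close>

lemma schwartz_decayE:
  assumes "f \<in> schwartz"
  obtains C where "C > 0" "\<And>x. norm (f x) \<le> C / (1 + norm x) ^ k"
proof -
  obtain C where C: "\<forall>x. (1 + norm x) ^ k * norm (f x) \<le> C" using schwartz_decay[OF assms] by blast
  have "norm (f x) \<le> max C 1 / (1 + norm x) ^ k" for x
  proof -
    have "0 < (1 + norm x) ^ k" by (simp add: add_pos_nonneg)
    then show ?thesis using C[rule_format, of x] by (simp add: field_simps max.coboundedI1)
  qed
  then show ?thesis by (intro that[of "max C 1"]) auto
qed

lemma schwartz_pd:
  assumes "f \<in> schwartz" "b \<in> Basis"
  shows "pd b f \<in> schwartz"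
proof -
  have "partial_derivs bs (pd b f) differentiable at x" if "set bs \<subseteq> Basis" for bs x
  proof -
    have "set (bs @ [b]) \<subseteq> Basis" using that assms(2) by simp
    then have "partial_derivs (bs @ [b]) f differentiable at x"
      using assms(1) unfolding schwartz_def smooth_def by blast
    then show ?thesis by (simp add: partial_derivs_snoc)
  qed
  moreover have "bounded (range (\<lambda>x. (1 + norm x) ^ k *\<^sub>R partial_derivs bs (pd b f) x))"
    if "set bs \<subseteq> Basis" for bs k
  proof -
    have "set (bs @ [b]) \<subseteq> Basis" using that assms(2) by simp
    then have "bounded (range (\<lambda>x. (1 + norm x) ^ k *\<^sub>R partial_derivs (bs @ [b]) f x))"
      using assms(1) unfolding schwartz_def by blast
    then show ?thesis by (simp add: partial_derivs_snoc)
  qed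
  ultimately show ?thesis unfolding schwartz_def smooth_def by blast
qed

text \<open>Derivatives of a product or quotient are sums of functions of the same shape. Closing a set of generators under sums
  lets the coinduction principle be checked on the generators alone.\<close>

inductive_set fun_span :: "('a \<Rightarrow> complex) set \<Rightarrow> ('a \<Rightarrow> complex) set" for A where
  base: "f \<in> A \<Longrightarrow> f \<in> fun_span A"
| add: "f \<in> fun_span A \<Longrightarrow> g \<in> fun_span A \<Longrightarrow> (\<lambda>x. f x + g x) \<in> fun_span A"

lemma fun_span_sum:
  assumes "(\<lambda>_. 0) \<in> A" "finite J" "\<And>j. j \<in> J \<Longrightarrow> f j \<in> fun_span A"
  shows "(\<lambda>x. \<Sum>j\<in>J. f j x) \<in> fun_span A"
  using assms(2,3)
proof (induction J)
  case empty
  show ?case using fun_span.base[OF assms(1)] by simp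
next
  case (insert j J)
  then show ?case by (simp add: fun_span.add)
qed

lemma schwartz_coinduct_span:
  assumes f: "f \<in> fun_span A"
  assumes deriv: "\<And>f. f \<in> A \<Longrightarrow> \<exists>g. (\<forall>b\<in>Basis. g b \<in> fun_span A) \<and>
     (\<forall>x. \<exists>D. (f has_derivative D) (at x) \<and> (\<forall>b\<in>Basis. D b = g b x))"
  assumes decay: "\<And>f k. f \<in> A \<Longrightarrow> \<exists>C. \<forall>x. (1 + norm x) ^ k * norm (f x) \<le> C"
  shows "(f :: 'a::euclidean_space \<Rightarrow> complex) \<in> schwartz"
proof (rule schwartz_coinduct[OF f], goal_cases)
  case (1 f)
  then show ?case
  proof induction
    case (base f)
    then show ?case by (rule deriv)
  next
    case (add f g)
    then obtain f' where f': "(\<forall>b\<in>Basis. f' b \<in> fun_span A) \<and>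
      (\<forall>x. \<exists>D. (f has_derivative D) (at x) \<and> (\<forall>b\<in>Basis. D b = f' b x))" by (elim exE)
    from add obtain g' where g': "(\<forall>b\<in>Basis. g' b \<in> fun_span A) \<and>
      (\<forall>x. \<exists>D. (g has_derivative D) (at x) \<and> (\<forall>b\<in>Basis. D b = g' b x))" by (elim exE)
    have "\<exists>D. ((\<lambda>x. f x + g x) has_derivative D) (at x) \<and> (\<forall>b\<in>Basis. D b = f' b x + g' b x)" for x
    proof -
      obtain D1 where D1: "(f has_derivative D1) (at x)" "\<forall>b\<in>Basis. D1 b = f' b x"
        using f'[THEN conjunct2, THEN spec, of x] by (elim exE conjE)
      obtain D2 where D2: "(g has_derivative D2) (at x)" "\<forall>b\<in>Basis. D2 b = g' b x"
        using g'[THEN conjunct2, THEN spec, of x] by (elim exE conjE)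
      show ?thesis by (rule exI, rule conjI, rule has_derivative_add[OF D1(1) D2(1)]) (use D1 D2 in auto)
    qed
    then show ?case using f' g'
      by (intro exI[of _ "\<lambda>b x. f' b x + g' b x"] conjI ballI allI fun_span.add) auto
  qed
next
  case (2 f k)
  then show ?case
  proof induction
    case (base f)
    then show ?case by (rule decay)
  next
    case (add f g)
    then obtain C D where "\<forall>x. (1 + norm x) ^ k * norm (f x) \<le> C" "\<forall>x. (1 + norm x) ^ k * norm (g x) \<le> D"
      by blast
    then have "(1 + norm x) ^ k * norm (f x + g x) \<le> C + D" for x
      using norm_triangle_ineq[of "f x" "g x"]
      by (smt (verit) distrib_left mult_left_mono zero_le_power norm_ge_zero)
    then show ?case by auto
  qed
qed

lemma schwartz_deriv_in_span:
  assumes f: "f \<in> schwartz" and A: "schwartz \<subseteq> A"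
  shows "\<exists>g. (\<forall>b\<in>Basis. g b \<in> fun_span A) \<and>
     (\<forall>x. \<exists>D. (f has_derivative D) (at x) \<and> (\<forall>b\<in>Basis. D b = g b x))"
proof (intro exI[of _ "\<lambda>b. pd b f"] conjI ballI allI)
  show "pd b f \<in> fun_span A" if "b \<in> Basis" for b
    using schwartz_pd[OF f that] A by (intro fun_span.base) (rule subsetD)
  show "\<exists>D. (f has_derivative D) (at x) \<and> (\<forall>b\<in>Basis. D b = pd b f x)" for x
    by (rule exI, rule conjI, rule schwartz_has_derivative[OF f]) simp
qed

lemma schwartz_add:
  assumes "f \<in> schwartz" "g \<in> schwartz"
  shows "(\<lambda>x. f x + g x) \<in> schwartz"
  by (rule schwartz_coinduct_span[OF fun_span.add[OF fun_span.base[OF assms(1)] fun_span.base[OF assms(2)]]])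
     (rule schwartz_deriv_in_span, assumption, rule order_refl, rule schwartz_decay)

lemma schwartz_cmult:
  assumes "f \<in> schwartz"
  shows "(\<lambda>x. c * f x) \<in> schwartz"
proof (rule schwartz_coinduct[where A = "{\<lambda>x. c * f x | f. f \<in> schwartz}"], goal_cases)
  case 1
  show ?case by (rule CollectI, rule exI[of _ f]) (use assms in simp)
next
  case (2 h)
  then obtain f where h: "h = (\<lambda>x. c * f x)" "f \<in> schwartz" by auto
  have D: "(h has_derivative (\<lambda>t. c * frechet_derivative f (at x) t)) (at x)" for x
    unfolding h(1) by (intro has_derivative_mult_right schwartz_has_derivative h)
  show ?case
  proof (intro exI[of _ "\<lambda>b x. c * pd b f x"] conjI ballI allI)
    show "\<exists>D. (h has_derivative D) (at x) \<and> (\<forall>b\<in>Basis. D b = c * pd b f x)" for x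
      by (rule exI, rule conjI, rule D) auto
    show "(\<lambda>x. c * pd b f x) \<in> {\<lambda>x. c * f x | f. f \<in> schwartz}" if "b \<in> Basis" for b
      by (rule CollectI, rule exI[of _ "pd b f"]) (use schwartz_pd[OF h(2) that] in simp)
  qed
next
  case (3 h k)
  then obtain f where h: "h = (\<lambda>x. c * f x)" "f \<in> schwartz" by auto
  obtain C where "\<forall>x. (1 + norm x) ^ k * norm (f x) \<le> C"
    using schwartz_decay[OF h(2)] by meson
  then have "(1 + norm x) ^ k * norm (c * f x) \<le> norm c * C" for x
    by (simp add: norm_mult mult.left_commute mult_left_mono)
  then show ?case using h(1) by auto
qed

lemma schwartz_reflect:
  assumes "f \<in> schwartz"
  shows "(\<lambda>x. f (- x)) \<in> schwartz"
proof (rule schwartz_coinduct[where A = "{\<lambda>x. f (- x) | f. f \<in> schwartz}"], goal_cases)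
  case 1
  show ?case by (rule CollectI, rule exI[of _ f]) (use assms in simp)
next
  case (2 h)
  then obtain f where h: "h = (\<lambda>x. f (- x))" "f \<in> schwartz" by auto
  have d: "(h has_derivative (\<lambda>t. frechet_derivative f (at (-x)) (-t))) (at x)" for x
    unfolding h(1)
    by (rule has_derivative_compose[where f=uminus and g=f])
      (auto intro!: derivative_eq_intros schwartz_has_derivative h(2))
  have e: "frechet_derivative f (at (-x)) (-t) = (-1) * frechet_derivative f (at (-x)) t" for x t
    using linear_neg[OF has_derivative_linear[OF schwartz_has_derivative[OF h(2)]]] by simp
  have "(\<lambda>x. (-1) * pd b f (- x)) \<in> {\<lambda>x. f (- x) | f. f \<in> schwartz}" if "b \<in> Basis" for b
    by (rule CollectI, rule exI[of _ "\<lambda>x. (-1) * pd b f x"])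
       (use schwartz_cmult[OF schwartz_pd[OF h(2) that], of "-1"] in simp)
  moreover have "\<exists>D. (h has_derivative D) (at x) \<and> (\<forall>b\<in>Basis. D b = (-1) * pd b f (- x))" for x
    by (rule exI, rule conjI, rule d) (use e in auto)
  ultimately show ?case
    by (intro exI[of _ "\<lambda>b x. (-1) * pd b f (- x)"] conjI ballI allI)
next
  case (3 h k)
  then obtain f where h: "h = (\<lambda>x. f (- x))" "f \<in> schwartz" by auto
  obtain C where "\<forall>x. (1 + norm x) ^ k * norm (f x) \<le> C"
    using schwartz_decay[OF h(2)] by meson
  then show ?case using h(1) by (metis norm_minus_cancel)
qed

text \<open>The derivative of \<open>x \<bullet> c\<close> is constant, so products with this function together with the Schwartz functions
  themselves generate a set that is stable under derivatives.\<close>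

lemma schwartz_coord_mult:
  assumes "f \<in> schwartz"
  shows "(\<lambda>x. of_real (x \<bullet> c) * f x) \<in> schwartz"
proof -
  let ?A = "{\<lambda>x. of_real (x \<bullet> c) * f x | f. f \<in> schwartz} \<union> schwartz"
  have gen: "(\<lambda>x. of_real (x \<bullet> c) * f x) \<in> ?A" if "f \<in> schwartz" for f :: "'a \<Rightarrow> complex"
    by (rule UnI1, rule CollectI, rule exI[of _ f]) (use that in simp)
  show ?thesis
  proof (rule schwartz_coinduct_span[OF fun_span.base[OF gen[OF assms]]], goal_cases)
    case (1 h)
    then show ?case
    proof
      assume "h \<in> {\<lambda>x. of_real (x \<bullet> c) * f x | f. f \<in> schwartz}"
      then obtain f where h: "h = (\<lambda>x. of_real (x \<bullet> c) * f x)" "f \<in> schwartz" by auto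
      have D: "(h has_derivative (\<lambda>t. of_real (x \<bullet> c) * frechet_derivative f (at x) t + of_real (t \<bullet> c) * f x)) (at x)" for x
        unfolding h(1) by (auto intro!: derivative_eq_intros schwartz_has_derivative h)
      show ?thesis
      proof (intro exI[of _ "\<lambda>b x. of_real (x \<bullet> c) * pd b f x + of_real (b \<bullet> c) * f x"] conjI ballI allI)
        show "(\<lambda>x. of_real (x \<bullet> c) * pd b f x + of_real (b \<bullet> c) * f x) \<in> fun_span ?A" if "b \<in> Basis" for b
          by (intro fun_span.add fun_span.base gen schwartz_pd h that UnI2 schwartz_cmult)
        show "\<exists>D. (h has_derivative D) (at x) \<and> (\<forall>b\<in>Basis. D b = of_real (x \<bullet> c) * pd b f x + of_real (b \<bullet> c) * f x)" for x
          by (rule exI, rule conjI, rule D) simp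
      qed
    next
      assume "h \<in> schwartz"
      then show ?thesis by (rule schwartz_deriv_in_span) (rule Un_upper2)
    qed
  next
    case (2 h k)
    then show ?case
    proof
      assume "h \<in> {\<lambda>x. of_real (x \<bullet> c) * f x | f. f \<in> schwartz}"
      then obtain f where h: "h = (\<lambda>x. of_real (x \<bullet> c) * f x)" "f \<in> schwartz" by auto
      obtain C where C: "\<forall>x. (1 + norm x) ^ Suc k * norm (f x) \<le> C" using schwartz_decay[OF h(2)] by meson
      have "(1 + norm x) ^ k * norm (h x) \<le> norm c * C" for x
      proof -
        have "norm (h x) \<le> norm x * norm c * norm (f x)"
          unfolding h(1) by (auto simp: norm_mult Cauchy_Schwarz_ineq2 intro!: mult_right_mono)
        also have "\<dots> \<le> norm c * ((1 + norm x) * norm (f x))" by (simp add: algebra_simps)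
        finally have "(1 + norm x) ^ k * norm (h x) \<le> (1 + norm x) ^ k * (norm c * ((1 + norm x) * norm (f x)))"
          by (rule mult_left_mono) simp
        also have "\<dots> = norm c * ((1 + norm x) ^ Suc k * norm (f x))" by (simp add: algebra_simps)
        also have "\<dots> \<le> norm c * C" using C by (intro mult_left_mono) auto
        finally show ?thesis .
      qed
      then show ?thesis by blast
    next
      assume "h \<in> schwartz"
      then show ?thesis by (rule schwartz_decay)
    qed
  qed
qed

section \<open>Division by the symbol\<close>

context
  fixes lam :: real
  assumes lam: "lam > 1"
begin

abbreviation (input) lap_symbol :: "'a::euclidean_space \<Rightarrow> real" where
  "lap_symbol x \<equiv> lam + 4 * pi\<^sup>2 * (norm x)\<^sup>2"

text \<open>The reciprocal of the symbol is the case \<open>a = s\<close>, \<open>j = 1\<close>. The whole family is needed because differentiation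
  raises \<open>a\<close> and \<open>j\<close>.\<close>

definition log_power :: "real \<Rightarrow> nat \<Rightarrow> 'a::euclidean_space \<Rightarrow> real" where
  "log_power a j x = lap_symbol x powr (- a) * inverse (ln (lap_symbol x)) ^ j"

lemma lap_symbol_bounds: "lap_symbol (x::'a::euclidean_space) \<ge> lam" "lap_symbol x > 1" "ln (lap_symbol x) \<ge> ln lam" "ln (lap_symbol x) > 0"
proof -
  show "lap_symbol x \<ge> lam" by simp
  then show a: "lap_symbol x > 1" "ln (lap_symbol x) \<ge> ln lam" using lam by (smt (verit) ln_mono)+
  then show "ln (lap_symbol x) > 0" by simp
qed

lemma log_power_has_derivative:
  "(log_power a j has_derivative (\<lambda>h. (8 * pi\<^sup>2 * (x \<bullet> h)) *
     (- a * log_power (a + 1) j x - real j * log_power (a + 1) (Suc j) x))) (at (x::'a::euclidean_space))"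
proof -
  define F where "F y = y powr (- a) * inverse (ln y) ^ j" for y :: real
  have F: "(F has_real_derivative (- a * (y powr (- (a + 1)) * inverse (ln y) ^ j) -
      real j * (y powr (- (a + 1)) * inverse (ln y) ^ Suc j))) (at y)" if "y > 1" for y
  proof -
    have "ln y > 0" using that by simp
    have "(F has_real_derivative ((- a * y powr (- a - 1)) * inverse (ln y) ^ j +
       y powr (- a) * (real j * inverse (ln y) ^ (j - 1) * (- (inverse y * inverse (ln y) ^ 2))))) (at y)"
    proof -
      have "((\<lambda>y. inverse (ln y)) has_real_derivative (- (inverse y * inverse (ln y) ^ 2))) (at y)"
        using that \<open>ln y > 0\<close> by (auto intro!: derivative_eq_intros simp: field_simps power2_eq_square)
      then have 1: "((\<lambda>y. inverse (ln y) ^ j) has_real_derivative (real j * inverse (ln y) ^ (j - 1) * (- (inverse y * inverse (ln y) ^ 2)))) (at y)"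
        by (rule DERIV_power[THEN DERIV_cong]) (simp add: mult_ac)
      have 2: "((\<lambda>y. y powr (- a)) has_real_derivative (- a * y powr (- a - 1))) (at y)"
        using that by (auto intro!: derivative_eq_intros simp: powr_diff)
      show ?thesis unfolding F_def
        by (rule DERIV_mult'[OF 2 1, THEN DERIV_cong]) (simp add: algebra_simps)
    qed
    then show ?thesis
    proof (rule DERIV_cong)
      have e: "y powr (- a - 1) = y powr (- a) * inverse y"
        using that by (simp add: powr_diff divide_inverse)
      moreover have "- a - 1 = - 1 - a" "- (a + 1) = - a - 1" by simp_all
      ultimately have "y powr (- 1 - a) = y powr (- a) * inverse y" "y powr (- (a + 1)) = y powr (- a) * inverse y"
        by (simp_all only:)
      with e show "(- a * y powr (- a - 1)) * inverse (ln y) ^ j +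
          y powr (- a) * (real j * inverse (ln y) ^ (j - 1) * (- (inverse y * inverse (ln y) ^ 2))) =
        - a * (y powr (- (a + 1)) * inverse (ln y) ^ j) - real j * (y powr (- (a + 1)) * inverse (ln y) ^ Suc j)"
        by (cases j) (simp_all add: power2_eq_square algebra_simps)
    qed
  qed
  have A: "((\<lambda>x::'a. lap_symbol x) has_derivative (\<lambda>h. 8 * pi\<^sup>2 * (x \<bullet> h))) (at x)"
    unfolding power2_norm_eq_inner
    by (auto intro!: derivative_eq_intros simp: inner_commute)
  have "((\<lambda>x. F (lap_symbol x)) has_derivative (\<lambda>h. (8 * pi\<^sup>2 * (x \<bullet> h)) * (- a * (lap_symbol x powr (- (a + 1)) * inverse (ln (lap_symbol x)) ^ j) -
      real j * (lap_symbol x powr (- (a + 1)) * inverse (ln (lap_symbol x)) ^ Suc j)))) (at x)"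
    by (rule has_derivative_eq_rhs[OF has_derivative_compose[OF A F[OF lap_symbol_bounds(2), unfolded has_field_derivative_def]]])
       (simp add: mult.commute)
  moreover have "log_power a j = (\<lambda>x::'a. F (lap_symbol x))" by (auto simp: log_power_def F_def)
  ultimately show ?thesis by (simp add: log_power_def)
qed

lemma log_power_bound: "a \<ge> 0 \<Longrightarrow> \<bar>log_power a j (x::'a::euclidean_space)\<bar> \<le> inverse (ln lam) ^ j"
proof -
  assume "a \<ge> 0"
  have "lap_symbol x powr (- a) \<le> 1" using lap_symbol_bounds(2)[of x] \<open>a \<ge> 0\<close>
    by (metis ge_one_powr_ge_zero le_imp_inverse_le inverse_1 less_imp_le powr_minus zero_less_one)
  moreover have "inverse (ln (lap_symbol x)) ^ j \<le> inverse (ln lam) ^ j"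
    using lap_symbol_bounds(3,4)[of x] lam by (intro power_mono le_imp_inverse_le) auto
  ultimately have "lap_symbol x powr (- a) * inverse (ln (lap_symbol x)) ^ j \<le> 1 * inverse (ln lam) ^ j"
    using lap_symbol_bounds(4)[of x] by (intro mult_mono) auto
  then show ?thesis using lap_symbol_bounds(4)[of x] by (simp add: log_power_def abs_mult)
qed

text \<open>The factors \<open>log_power a j\<close> are bounded, and their derivatives are again such factors times coordinates. The
  coordinates can be absorbed into the Schwartz function.\<close>

lemma schwartz_mult_log_power:
  assumes "a \<ge> 0" "\<phi> \<in> schwartz"
  shows "(\<lambda>x::'a::euclidean_space. of_real (log_power a j x) * \<phi> x) \<in> schwartz"
proof -
  let ?A = "{\<lambda>x::'a. of_real (log_power a j x) * \<phi> x | a j \<phi>. a \<ge> 0 \<and> \<phi> \<in> schwartz}"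
  have gen: "(\<lambda>x. of_real (log_power a j x) * \<phi> x) \<in> ?A" if "a \<ge> 0" "\<phi> \<in> schwartz" for a j \<phi>
    by (rule CollectI, rule exI[of _ a], rule exI[of _ j], rule exI[of _ \<phi>]) (use that in simp)
  show ?thesis
  proof (rule schwartz_coinduct_span[OF fun_span.base[OF gen[OF assms]]], goal_cases)
    case (1 f)
    then obtain a j \<phi> where f: "f = (\<lambda>x. of_real (log_power a j x) * \<phi> x)" and a: "a \<ge> 0" and \<phi>: "\<phi> \<in> schwartz" by auto
    let ?g = "\<lambda>b x. of_real (log_power (a + 1) j x) * (of_real (- 8 * pi\<^sup>2 * a) * (of_real (x \<bullet> b) * \<phi> x)) +
      of_real (log_power (a + 1) (Suc j) x) * (of_real (- 8 * pi\<^sup>2 * j) * (of_real (x \<bullet> b) * \<phi> x)) +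
      of_real (log_power a j x) * pd b \<phi> x"
    have "?g b \<in> fun_span ?A" if "b \<in> Basis" for b
      by (intro fun_span.add fun_span.base gen schwartz_cmult schwartz_coord_mult schwartz_pd \<phi> that) (use a in auto)
    moreover have "\<exists>D. (f has_derivative D) (at x) \<and> (\<forall>b\<in>Basis. D b = ?g b x)" for x
    proof -
      have W: "((\<lambda>x. complex_of_real (log_power a j x)) has_derivative (\<lambda>h. of_real ((8 * pi\<^sup>2 * (x \<bullet> h)) *
        (- a * log_power (a + 1) j x - real j * log_power (a + 1) (Suc j) x)))) (at x)"
        by (rule has_derivative_of_real[OF log_power_has_derivative])
      show ?thesis unfolding f
        by (rule exI, rule conjI, rule has_derivative_mult[OF W schwartz_has_derivative[OF \<phi>]])
           (auto simp: algebra_simps)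
    qed
    ultimately show ?case by (intro exI[of _ ?g] conjI ballI allI)
  next
    case (2 f k)
    then obtain a j \<phi> where f: "f = (\<lambda>x. of_real (log_power a j x) * \<phi> x)" and a: "a \<ge> 0" and \<phi>: "\<phi> \<in> schwartz" by auto
    obtain C where C: "\<forall>x. (1 + norm x) ^ k * norm (\<phi> x) \<le> C" using schwartz_decay[OF \<phi>] by meson
    have "(1 + norm x) ^ k * norm (f x) \<le> inverse (ln lam) ^ j * C" for x
    proof -
      have "(1 + norm x) ^ k * norm (f x) = \<bar>log_power a j x\<bar> * ((1 + norm x) ^ k * norm (\<phi> x))"
        by (simp add: f norm_mult)
      also have "\<dots> \<le> inverse (ln lam) ^ j * C"
        using C log_power_bound[OF a] lam by (intro mult_mono) auto
      finally show ?thesis .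
    qed
    then show ?case by blast
  qed
qed

end

lemma log_bessel_symbol_pos:
  assumes "lam > 1" shows "log_bessel_symbol lam s x > 0"
  using lap_symbol_bounds[OF assms, of x] unfolding log_bessel_symbol_def by simp

lemma schwartz_divide_symbol:
  assumes "lam > 1" "s > 0" "\<phi> \<in> schwartz"
  shows "(\<lambda>x. of_real (inverse (log_bessel_symbol lam s x)) * \<phi> x) \<in> schwartz"
proof -
  have "log_power lam s 1 x = inverse (log_bessel_symbol lam s x)" for x :: 'a
    using lap_symbol_bounds[OF assms(1), of x] unfolding log_power_def[OF assms(1)] log_bessel_symbol_def
    by (simp add: powr_minus)
  then show ?thesis
    using schwartz_mult_log_power[OF assms(1), of s \<phi> 1] assms by simp
qed

section \<open>Integrability of Schwartz functions\<close>

text \<open>The integrand is dominated by the product of \<open>1 / (1 + (x \<bullet> b)\<^sup>2)\<close> over the coordinates, which factorises; the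
  exponent \<open>2 * DIM('a)\<close> is chosen for this.\<close>

lemma integrable_decay: "integrable lborel (\<lambda>x::'a::euclidean_space. 1 / (1 + norm x) ^ (2 * DIM('a)))"
proof (rule integrableI_bounded)
  have *: "(\<integral>\<^sup>+t. ennreal (inverse (1 + t\<^sup>2)) \<partial>lborel) < \<infinity>"
  proof -
    have "integrable lborel (\<lambda>t::real. inverse (1 + t\<^sup>2))"
      using integrable_inverse_1_plus_square by (simp add: set_integrable_def einterval_def)
    then show ?thesis
      unfolding integrable_iff_bounded by (simp add: add_nonneg_nonneg)
  qed
  have "(\<integral>\<^sup>+x. ennreal (norm (1 / (1 + norm x) ^ (2 * DIM('a)))) \<partial>(lborel::'a measure)) \<le>
        (\<integral>\<^sup>+x. (\<Prod>b\<in>Basis. ennreal (inverse (1 + (x \<bullet> b)\<^sup>2))) \<partial>(lborel::'a measure))"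
  proof (rule nn_integral_mono)
    fix x :: 'a
    have "norm (1 / (1 + norm x) ^ (2 * DIM('a))) = (\<Prod>b\<in>(Basis::'a set). inverse ((1 + norm x)\<^sup>2))"
      by (simp add: power_mult[of _ 2] power_inverse divide_inverse)
    also have "\<dots> \<le> (\<Prod>b\<in>Basis. inverse (1 + (x \<bullet> b)\<^sup>2))"
    proof (intro prod_mono conjI le_imp_inverse_le)
      fix b :: 'a assume "b \<in> Basis"
      then have "\<bar>x \<bullet> b\<bar> \<le> norm x" by (rule Basis_le_norm)
      then have "(x \<bullet> b)\<^sup>2 \<le> (norm x)\<^sup>2" by (metis abs_le_square_iff abs_norm_cancel)
      then show "1 + (x \<bullet> b)\<^sup>2 \<le> (1 + norm x)\<^sup>2" by (simp add: power2_sum add.assoc add_increasing2)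
    qed (auto simp: add_pos_nonneg)
    finally show "ennreal (norm (1 / (1 + norm x) ^ (2 * DIM('a)))) \<le> (\<Prod>b\<in>Basis. ennreal (inverse (1 + (x \<bullet> b)\<^sup>2)))"
      by (subst prod_ennreal) (auto intro!: ennreal_leI)
  qed
  also have "\<dots> = (\<Prod>b\<in>(Basis::'a set). \<integral>\<^sup>+t. ennreal (inverse (1 + t\<^sup>2)) \<partial>lborel)"
    by (rule nn_integral_lborel_prod) auto
  also have "\<dots> < \<infinity>" using * by (simp add: power_less_top_ennreal)
  finally show "(\<integral>\<^sup>+x. ennreal (norm (1 / (1 + norm x) ^ (2 * DIM('a)))) \<partial>(lborel::'a measure)) < \<infinity>" .
qed simp

lemma schwartz_continuous: "f \<in> schwartz \<Longrightarrow> continuous_on A f"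
  by (meson has_derivative_continuous schwartz_has_derivative continuous_at_imp_continuous_on)

lemma schwartz_measurable [measurable_dest]: "f \<in> schwartz \<Longrightarrow> f \<in> borel_measurable borel"
  using schwartz_continuous by (rule borel_measurable_continuous_onI)

lemma schwartz_integrable:
  assumes "f \<in> schwartz" shows "integrable lborel (f :: 'a::euclidean_space \<Rightarrow> complex)"
proof -
  obtain C where C: "C > 0" "\<And>x. norm (f x) \<le> C / (1 + norm x) ^ (2 * DIM('a))"
    using schwartz_decayE[OF assms, of "2 * DIM('a)"] by blast
  have "integrable lborel (\<lambda>x::'a. C * (1 / (1 + norm x) ^ (2 * DIM('a))))"
    by (intro integrable_mult_right integrable_decay)
  then show ?thesis
    by (rule Bochner_Integration.integrable_bound)
       (use C schwartz_measurable[OF assms] in \<open>auto simp: intro!: order_trans[OF _ abs_ge_self]\<close>)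
qed

section \<open>The Fourier transform on Schwartz functions\<close>

text \<open>The character of the Fourier transform, kept as a constant so that its exponential is not rewritten.\<close>

definition echar :: "'a::euclidean_space \<Rightarrow> 'a \<Rightarrow> complex" where
  "echar x y = exp (2 * of_real pi * \<i> * of_real (x \<bullet> y))"

lemma echar_iexp: "echar x y = iexp (2 * pi * (x \<bullet> y))"
  by (simp add: echar_def mult_ac)

lemma norm_echar [simp]: "norm (echar x y) = 1"
  by (simp add: echar_iexp)

lemma echar_add: "echar (x + h) y = echar x y * echar h y"
  by (simp add: echar_def inner_add_left algebra_simps exp_add)

lemma echar_commute: "echar x y = echar y x"
  by (simp add: echar_def inner_commute)

lemma echar_measurable [measurable (raw)]:
  "f \<in> borel_measurable M \<Longrightarrow> g \<in> borel_measurable M \<Longrightarrow> (\<lambda>x. echar (f x) (g x)) \<in> borel_measurable M"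
  unfolding echar_def by simp

lemma inv_fourier_echar: "inv_fourier f x = (LINT y|lborel. f y * echar x y)"
  by (simp add: inv_fourier_def echar_def)

lemma fourier_reflect: "fourier f x = inv_fourier f (- x)"
  by (simp add: inv_fourier_def fourier_def inner_commute)

lemma integrable_times_bounded:
  fixes f g :: "'b \<Rightarrow> complex"
  assumes "integrable M f" "g \<in> borel_measurable M" "\<And>x. norm (g x) \<le> 1"
  shows "integrable M (\<lambda>x. f x * g x)"
proof (rule Bochner_Integration.integrable_bound[OF assms(1)])
  show "(\<lambda>x. f x * g x) \<in> borel_measurable M"
    using assms(1,2) borel_measurable_integrable by measurable
  show "AE x in M. norm (f x * g x) \<le> norm (f x)"
    using assms(3) by (auto simp: norm_mult mult_left_le)
qed

lemma integrable_echar: "integrable lborel f \<Longrightarrow> integrable lborel (\<lambda>y. f y * echar x y)"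
  by (rule integrable_times_bounded) auto

lemma norm_inv_fourier_le: "norm (inv_fourier f x) \<le> (LINT y|lborel. norm (f y))"
  unfolding inv_fourier_echar
  by (rule order_trans[OF integral_norm_bound]) (simp add: norm_mult)

lemma echar_remainder: "norm (echar h y - 1 - 2 * of_real pi * \<i> * of_real (h \<bullet> y)) \<le> 2 * pi\<^sup>2 * (norm h * norm y)\<^sup>2"
proof -
  have "norm (echar h y - 1 - 2 * of_real pi * \<i> * of_real (h \<bullet> y)) \<le> \<bar>2 * pi * (h \<bullet> y)\<bar>\<^sup>2 / 2"
    using iexp_approx1[of "2 * pi * (h \<bullet> y)" 1]
    by (simp add: echar_iexp eval_nat_numeral diff_diff_eq mult_ac)
  also have "\<dots> = 2 * pi\<^sup>2 * \<bar>h \<bullet> y\<bar>\<^sup>2" by (simp add: power_mult_distrib)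
  also have "\<dots> \<le> 2 * pi\<^sup>2 * (norm h * norm y)\<^sup>2"
    by (intro mult_left_mono power_mono Cauchy_Schwarz_ineq2) auto
  finally show ?thesis .
qed

lemma schwartz_norm_mult_integrable:
  assumes "f \<in> schwartz"
  shows "integrable lborel (\<lambda>x::'a::euclidean_space. (norm x)\<^sup>2 * norm (f x))"
proof (rule Bochner_Integration.integrable_bound)
  let ?g = "\<lambda>x. \<Sum>b\<in>Basis. of_real (x \<bullet> b) * (of_real (x \<bullet> b) * f x)"
  show "integrable lborel ?g"
    by (intro Bochner_Integration.integrable_sum schwartz_integrable schwartz_coord_mult assms)
  have "?g x = of_real ((norm x)\<^sup>2) * f x" for x
    unfolding power2_norm_eq_inner mult.assoc[symmetric] sum_distrib_right[symmetric]
    by (subst euclidean_inner) simp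
  then show "AE x in lborel. norm ((norm x)\<^sup>2 * norm (f x)) \<le> norm (?g x)"
    by (simp add: norm_mult norm_power)
  show "(\<lambda>x. (norm x)\<^sup>2 * norm (f x)) \<in> borel_measurable lborel"
    using schwartz_measurable[OF assms] by measurable
qed

text \<open>Valid for an arbitrary measure space, in particular for product measures.\<close>

lemma norm_integral_le_integral:
  fixes f :: "'b \<Rightarrow> 'c::{banach, second_countable_topology}"
  assumes "integrable M f" "integrable M g" "\<And>x. norm (f x) \<le> g x"
  shows "norm (integral\<^sup>L M f) \<le> integral\<^sup>L M g"
  using integral_norm_bound[of M f] assms
  by (intro order_trans[OF integral_norm_bound] integral_mono) auto

text \<open>Differentiation under the integral sign. The Taylor remainder of the character is quadratic in
  \<open>norm h * norm y\<close>, and the second moment of a Schwartz function is finite.\<close>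

lemma inv_fourier_has_derivative:
  assumes f: "f \<in> schwartz"
  shows "(inv_fourier f has_derivative (\<lambda>h. \<Sum>b\<in>Basis. of_real (h \<bullet> b) *
            inv_fourier (\<lambda>y. 2 * of_real pi * \<i> * (of_real (y \<bullet> b) * f y)) x)) (at (x::'a::euclidean_space))"
    (is "(_ has_derivative ?D) _")
proof (rule has_derivativeI_sandwich[where e = 1])
  let ?K = "2 * pi\<^sup>2 * (LINT y|lborel. (norm y)\<^sup>2 * norm (f y))"
  show "bounded_linear ?D"
    by (intro bounded_linear_sum bounded_linear_mult_left[THEN bounded_linear_compose]
        bounded_linear_of_real[THEN bounded_linear_compose] bounded_linear_inner_left)
  show "((\<lambda>y. ?K * norm (y - x)) \<longlongrightarrow> 0) (at x)"
    by (rule tendsto_eq_intros LIM_zero refl tendsto_ident_at | simp)+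
  fix y assume "y \<noteq> x"
  define h where "h = y - x"
  have y: "y = x + h" and h0: "norm h > 0" using \<open>y \<noteq> x\<close> by (auto simp: h_def)
  have i1: "integrable lborel (\<lambda>z. f z * echar u z)" for u
    using integrable_echar schwartz_integrable f by blast
  have i2: "integrable lborel (\<lambda>z. 2 * of_real pi * \<i> * (of_real (z \<bullet> b) * f z) * echar x z)" for b
    by (intro integrable_echar schwartz_integrable schwartz_cmult schwartz_coord_mult f)
  have D: "?D h = (LINT z|lborel. 2 * of_real pi * \<i> * of_real (h \<bullet> z) * f z * echar x z)"
  proof -
    have "?D h = (LINT z|lborel. (\<Sum>b\<in>Basis. of_real (h \<bullet> b) * (2 * of_real pi * \<i> * (of_real (z \<bullet> b) * f z) * echar x z)))"
      unfolding inv_fourier_echar using i2 by (subst Bochner_Integration.integral_sum) auto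
    also have "\<dots> = (LINT z|lborel. 2 * of_real pi * \<i> * of_real (\<Sum>b\<in>Basis. (h \<bullet> b) * (z \<bullet> b)) * f z * echar x z)"
      by (intro Bochner_Integration.integral_cong refl) (simp add: sum_distrib_left sum_distrib_right mult_ac)
    finally show ?thesis by (simp add: euclidean_inner[symmetric])
  qed
  have i3: "integrable lborel (\<lambda>z. 2 * of_real pi * \<i> * of_real (h \<bullet> z) * f z * echar x z)"
  proof -
    have "integrable lborel (\<lambda>z. 2 * of_real pi * \<i> * (of_real (z \<bullet> h) * f z) * echar x z)"
      by (intro integrable_echar schwartz_integrable schwartz_cmult schwartz_coord_mult f)
    then show ?thesis by (simp add: mult.assoc inner_commute)
  qed
  have "inv_fourier f y - inv_fourier f x - ?D (y - x) =
     (LINT z|lborel. f z * echar x z * (echar h z - 1 - 2 * of_real pi * \<i> * of_real (h \<bullet> z)))"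
    unfolding h_def[symmetric] D
    unfolding inv_fourier_echar
    by (subst Bochner_Integration.integral_diff[symmetric], rule i1, rule i1,
        subst Bochner_Integration.integral_diff[symmetric], intro Bochner_Integration.integrable_diff i1, rule i3)
       (simp add: y echar_add algebra_simps)
  also have "norm \<dots> \<le> (LINT z|lborel. (2 * pi\<^sup>2 * (norm h)\<^sup>2) * ((norm z)\<^sup>2 * norm (f z)))"
  proof (rule norm_integral_le_integral)
    show "integrable lborel (\<lambda>z. f z * echar x z * (echar h z - 1 - 2 * of_real pi * \<i> * of_real (h \<bullet> z)))"
    proof -
      have "integrable lborel (\<lambda>z. f z * echar (x + h) z - f z * echar x z - 2 * of_real pi * \<i> * of_real (h \<bullet> z) * f z * echar x z)"
        by (intro Bochner_Integration.integrable_diff i1 i3)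
      then show ?thesis by (simp add: echar_add algebra_simps)
    qed
    show "integrable lborel (\<lambda>z. (2 * pi\<^sup>2 * (norm h)\<^sup>2) * ((norm z)\<^sup>2 * norm (f z)))"
      by (intro integrable_mult_right schwartz_norm_mult_integrable f)
    show "norm (f z * echar x z * (echar h z - 1 - 2 * of_real pi * \<i> * of_real (h \<bullet> z)))
       \<le> (2 * pi\<^sup>2 * (norm h)\<^sup>2) * ((norm z)\<^sup>2 * norm (f z))" for z
      using mult_left_mono[OF echar_remainder[of h z], of "norm (f z)"]
      by (simp add: norm_mult power_mult_distrib mult_ac)
  qed
  also have "\<dots> = ?K * norm h * norm h" by (simp add: power2_eq_square)
  finally have "norm (inv_fourier f y - inv_fourier f x - ?D (y - x)) \<le> ?K * norm h * norm h" .
  then show "norm (inv_fourier f y - inv_fourier f x - ?D (y - x)) / norm (y - x) \<le> ?K * norm (y - x)"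
    using h0 by (simp add: h_def[symmetric] pos_divide_le_eq)
qed simp

lemma lborel_integral_translate:
  fixes f :: "'a::euclidean_space \<Rightarrow> 'b::{banach, second_countable_topology}"
  shows "(LINT x|lborel. f (x + t)) = (LINT x|lborel. f x)"
proof -
  have *: "(LINT x|lborel. f (t + x)) = (LINT x|lborel. f x)" if "f \<in> borel_measurable borel" for f :: "'a \<Rightarrow> 'b" and t
  proof -
    have "(LINT x|lborel. f x) = (LINT x|distr lborel borel ((+) t). f x)"
      by (simp add: lborel_distr_plus)
    also have "\<dots> = (LINT x|lborel. f (t + x))" using that by (subst integral_distr) auto
    finally show ?thesis ..
  qed
  show ?thesis
  proof (cases "f \<in> borel_measurable borel")
    case True then show ?thesis using *[OF True, of t] by (simp add: add.commute)
  next
    case False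
    have "(\<lambda>x. f (x + t)) \<notin> borel_measurable borel"
    proof
      assume "(\<lambda>x. f (x + t)) \<in> borel_measurable borel"
      then have "(\<lambda>x. f (x + t)) \<circ> (\<lambda>x. x - t) \<in> borel_measurable borel"
        by (intro measurable_comp[of _ borel borel]) auto
      then show False using False by (simp add: o_def)
    qed
    then show ?thesis using False borel_measurable_integrable
      by (metis measurable_lborel2 not_integrable_integral_eq)
  qed
qed

lemma lborel_integrable_translate:
  fixes f :: "'a::euclidean_space \<Rightarrow> 'b::{banach, second_countable_topology}"
  assumes "integrable lborel f"
  shows "integrable lborel (\<lambda>x. f (x + t))"
proof -
  have "integrable (distr lborel borel ((+) t)) f"
    using assms by (simp add: lborel_distr_plus)
  then show ?thesis
    using assms by (subst (asm) integrable_distr_eq) (auto simp: add.commute dest: borel_measurable_integrable)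
qed

text \<open>Difference quotients of a Schwartz function are dominated by one integrable function, uniformly for steps of
  length at most one, since \<open>1 + norm x \<le> 2 * (1 + norm (x + t *\<^sub>R b))\<close> for such steps.\<close>

lemma schwartz_shift_bound:
  assumes f: "f \<in> schwartz" and b: "b \<in> Basis"
  obtains C where "C > 0" "\<And>x t. \<bar>t\<bar> \<le> 1 \<Longrightarrow> norm (f (x + t *\<^sub>R b) - f x) \<le> \<bar>t\<bar> * (C / (1 + norm (x::'a::euclidean_space)) ^ k)"
proof -
  obtain C where C: "C > 0" "\<And>x. norm (pd b f x) \<le> C / (1 + norm x) ^ k"
    using schwartz_decayE[OF schwartz_pd[OF f b], of k] by blast
  have "norm (f (x + t *\<^sub>R b) - f x) \<le> \<bar>t\<bar> * ((C * 2 ^ k) / (1 + norm x) ^ k)" if t: "\<bar>t\<bar> \<le> 1" for x t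
  proof -
    have d: "((\<lambda>s. f (x + s *\<^sub>R b)) has_vector_derivative pd b f (x + s *\<^sub>R b)) (at s within S)" for s S
    proof -
      have "((\<lambda>s. f (x + s *\<^sub>R b)) has_derivative (\<lambda>h. frechet_derivative f (at (x + s *\<^sub>R b)) (h *\<^sub>R b))) (at s within S)"
        by (rule has_derivative_compose[where g = f]) (auto intro!: derivative_eq_intros schwartz_has_derivative f)
      moreover have "frechet_derivative f (at (x + s *\<^sub>R b)) (h *\<^sub>R b) = h *\<^sub>R pd b f (x + s *\<^sub>R b)" for h
        using linear_scale[OF has_derivative_linear[OF schwartz_has_derivative[OF f]]] .
      ultimately show ?thesis by (simp add: has_vector_derivative_def)
    qed
    have bd: "norm (pd b f (x + s *\<^sub>R b)) \<le> (C * 2 ^ k) / (1 + norm x) ^ k" if s: "s \<in> {-1..1}" for s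
    proof -
      have "norm x \<le> norm (x + s *\<^sub>R b) + norm (s *\<^sub>R b)"
        using norm_triangle_ineq4[of "x + s *\<^sub>R b" "s *\<^sub>R b"] by simp
      moreover have "norm (s *\<^sub>R b) \<le> 1" using s b by auto
      ultimately have *: "(1 + norm x) \<le> 2 * (1 + norm (x + s *\<^sub>R b))"
        using norm_ge_zero[of "x + s *\<^sub>R b"] unfolding distrib_left by arith
      have "(1 + norm x) ^ k \<le> (2 * (1 + norm (x + s *\<^sub>R b))) ^ k"
        by (rule power_mono[OF *]) simp
      then have "1 / (1 + norm (x + s *\<^sub>R b)) ^ k \<le> 2 ^ k / (1 + norm x) ^ k"
        unfolding power_mult_distrib
        by (subst pos_divide_le_eq, simp add: add_pos_nonneg, subst times_divide_eq_left, subst pos_le_divide_eq)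
           (auto simp: add_pos_nonneg)
      then have "C * (1 / (1 + norm (x + s *\<^sub>R b)) ^ k) \<le> C * (2 ^ k / (1 + norm x) ^ k)"
        using C(1) by (intro mult_left_mono) auto
      then show ?thesis using C(2)[of "x + s *\<^sub>R b"] by simp
    qed
    have "norm (f (x + t *\<^sub>R b) - f (x + 0 *\<^sub>R b)) \<le> ((C * 2 ^ k) / (1 + norm x) ^ k) * norm (t - 0)"
    proof (rule differentiable_bound[where S = "{-1..1}" and f = "\<lambda>s. f (x + s *\<^sub>R b)" and f' = "\<lambda>s h. h *\<^sub>R pd b f (x + s *\<^sub>R b)"])
      show "((\<lambda>s. f (x + s *\<^sub>R b)) has_derivative (\<lambda>h. h *\<^sub>R pd b f (x + s *\<^sub>R b))) (at s within {-1..1})" for s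
        using d by (simp add: has_vector_derivative_def)
      show "onorm (\<lambda>h. h *\<^sub>R pd b f (x + s *\<^sub>R b)) \<le> (C * 2 ^ k) / (1 + norm x) ^ k" if "s \<in> {-1..1}" for s
        using bd[OF that] by (intro onorm_le) (auto simp del: times_divide_eq_left times_divide_eq_right simp: mult.commute[of _ "norm (pd b f _)"] mult_right_mono)
    qed (use t in auto)
    then show ?thesis by (simp add: mult.commute)
  qed
  then show ?thesis using C(1) by (intro that[of "C * 2 ^ k"]) auto
qed

text \<open>Integration by parts. Translating the integration variable multiplies the transform by a character, so the
  difference quotient of \<open>f\<close> in direction \<open>b\<close> has an explicit transform; the step length tends to \<open>0\<close> on both sides.\<close>

lemma inv_fourier_pd:
  assumes f: "f \<in> schwartz" and b: "b \<in> Basis"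
  shows "inv_fourier (pd b f) x = - (2 * of_real pi * \<i> * of_real (x \<bullet> b)) * inv_fourier f (x::'a::euclidean_space)"
proof -
  \<comment> \<open>Step lengths; the bound \<open>1\<close> is required by \<open>schwartz_shift_bound\<close>.\<close>
  define t where "t k = 1 / real (Suc k)" for k
  have t: "t k > 0" "t k \<le> 1" for k by (auto simp: t_def)
  have t0: "t \<longlonglongrightarrow> 0" unfolding t_def using LIMSEQ_inverse_real_of_nat by (simp add: inverse_eq_divide)
  have t0': "filterlim t (at 0) sequentially"
    using t0 t(1) by (auto simp: filterlim_at intro!: always_eventually) (metis less_irrefl)
  obtain C where C: "C > 0" "\<And>y s. \<bar>s\<bar> \<le> 1 \<Longrightarrow> norm (f (y + s *\<^sub>R b) - f y) \<le> \<bar>s\<bar> * (C / (1 + norm y) ^ (2 * DIM('a)))"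
    using schwartz_shift_bound[OF f b, of "2 * DIM('a)"] by blast
  let ?q = "\<lambda>k y. of_real (1 / t k) * (f (y + t k *\<^sub>R b) - f y) * echar x y"
  have int: "integrable lborel (\<lambda>y. f y * echar x y)" for x
    using integrable_echar schwartz_integrable f by blast
  have lim1: "(\<lambda>k. LINT y|lborel. ?q k y) \<longlonglongrightarrow> (LINT y|lborel. pd b f y * echar x y)"
  proof (rule integral_dominated_convergence[where w = "\<lambda>y. C * (1 / (1 + norm y) ^ (2 * DIM('a)))"])
    show "integrable lborel (\<lambda>y::'a. C * (1 / (1 + norm y) ^ (2 * DIM('a))))"
      by (intro integrable_mult_right integrable_decay)
    have [measurable]: "f \<in> borel_measurable borel" "pd b f \<in> borel_measurable borel"
      using f b schwartz_measurable schwartz_pd by auto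
    show "(\<lambda>y. pd b f y * echar x y) \<in> borel_measurable lborel" by measurable
    show "?q k \<in> borel_measurable lborel" for k by measurable
    show "AE y in lborel. norm (?q k y) \<le> C * (1 / (1 + norm y) ^ (2 * DIM('a)))" for k
    proof (rule AE_I2)
      fix y
      have "norm (?q k y) = norm (f (y + t k *\<^sub>R b) - f y) / t k"
        using t(1)[of k] by (simp add: norm_mult norm_divide)
      also have "\<dots> \<le> (t k * (C / (1 + norm y) ^ (2 * DIM('a)))) / t k"
        using C(2)[of "t k" y] t[of k] by (intro divide_right_mono) auto
      finally show "norm (?q k y) \<le> C * (1 / (1 + norm y) ^ (2 * DIM('a)))" using t(1)[of k] by simp
    qed
    show "AE y in lborel. (\<lambda>k. ?q k y) \<longlonglongrightarrow> pd b f y * echar x y"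
    proof (rule AE_I2)
      fix y
      have "((\<lambda>s. f (y + s *\<^sub>R b)) has_derivative (\<lambda>h. frechet_derivative f (at (y + 0 *\<^sub>R b)) (h *\<^sub>R b))) (at 0)"
        by (rule has_derivative_compose[where g = f]) (auto intro!: derivative_eq_intros schwartz_has_derivative f)
      moreover have "frechet_derivative f (at y) (h *\<^sub>R b) = h *\<^sub>R pd b f y" for h
        using linear_scale[OF has_derivative_linear[OF schwartz_has_derivative[OF f]]] .
      ultimately have v: "((\<lambda>s. f (y + s *\<^sub>R b)) has_vector_derivative pd b f y) (at 0)"
        by (simp add: has_vector_derivative_def)
      have lim: "((\<lambda>s. (1 / s) *\<^sub>R (f (y + s *\<^sub>R b) - f y)) \<longlongrightarrow> pd b f y) (at 0)"
      proof -
        from v have "(\<lambda>s. norm (f (y + (0 + s) *\<^sub>R b) - f (y + 0 *\<^sub>R b) - s *\<^sub>R pd b f y) / norm s) \<midarrow>0\<rightarrow> 0"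
          unfolding has_vector_derivative_def has_derivative_at by (rule conjunct2)
        then have "(\<lambda>s. norm ((1 / s) *\<^sub>R (f (y + s *\<^sub>R b) - f y) - pd b f y)) \<midarrow>0\<rightarrow> 0"
        proof (rule Lim_transform_eventually)
          have "norm (f (y + (0 + s) *\<^sub>R b) - f (y + 0 *\<^sub>R b) - s *\<^sub>R pd b f y) / norm s =
              norm ((1 / s) *\<^sub>R (f (y + s *\<^sub>R b) - f y) - pd b f y)" if "s \<noteq> 0" for s
          proof -
            have "(1 / s) *\<^sub>R (f (y + s *\<^sub>R b) - f y) - pd b f y = (1 / s) *\<^sub>R (f (y + s *\<^sub>R b) - f y - s *\<^sub>R pd b f y)"
              using that by (simp add: scaleR_diff_right)
            then show ?thesis by simp
          qed
          then show "\<forall>\<^sub>F s in at 0. norm (f (y + (0 + s) *\<^sub>R b) - f (y + 0 *\<^sub>R b) - s *\<^sub>R pd b f y) / norm s =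
              norm ((1 / s) *\<^sub>R (f (y + s *\<^sub>R b) - f y) - pd b f y)"
            by (auto simp: eventually_at_filter)
        qed
        then show ?thesis by (rule LIM_zero_cancel[OF tendsto_norm_zero_cancel])
      qed
      have "(\<lambda>k. (1 / t k) *\<^sub>R (f (y + t k *\<^sub>R b) - f y)) \<longlonglongrightarrow> pd b f y"
        by (rule filterlim_compose[OF lim t0'])
      then show "(\<lambda>k. ?q k y) \<longlonglongrightarrow> pd b f y * echar x y"
        by (intro tendsto_mult) (auto simp: scaleR_conv_of_real)
    qed
  qed
  have eq: "(LINT y|lborel. ?q k y) = ((iexp (- 2 * pi * (x \<bullet> b) * t k) - 1) / of_real (t k)) * inv_fourier f x" for k
  proof -
    have e: "f (y + t k *\<^sub>R b) * echar x y = (\<lambda>y. f y * echar x y) (y + t k *\<^sub>R b) * iexp (- 2 * pi * (x \<bullet> b) * t k)" for y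
      by (simp add: echar_def inner_add_right algebra_simps exp_add[symmetric])
    have "(LINT y|lborel. f (y + t k *\<^sub>R b) * echar x y) = inv_fourier f x * iexp (- 2 * pi * (x \<bullet> b) * t k)"
      unfolding e inv_fourier_echar by (subst integral_mult_left_zero, subst lborel_integral_translate) simp
    moreover have "integrable lborel (\<lambda>y. f (y + t k *\<^sub>R b) * echar x y)"
      by (intro integrable_echar lborel_integrable_translate schwartz_integrable f)
    ultimately have "(LINT y|lborel. f (y + t k *\<^sub>R b) * echar x y - f y * echar x y) =
        (iexp (- 2 * pi * (x \<bullet> b) * t k) - 1) * inv_fourier f x"
      by (subst Bochner_Integration.integral_diff) (auto simp: int inv_fourier_echar algebra_simps)
    then have "(LINT y|lborel. of_real (1 / t k) * (f (y + t k *\<^sub>R b) * echar x y - f y * echar x y)) =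
        of_real (1 / t k) * ((iexp (- 2 * pi * (x \<bullet> b) * t k) - 1) * inv_fourier f x)"
      by (subst integral_mult_right_zero) simp
    moreover have "?q k y = of_real (1 / t k) * (f (y + t k *\<^sub>R b) * echar x y - f y * echar x y)" for y
      by (simp add: algebra_simps)
    ultimately show ?thesis by (simp only:) (simp add: divide_inverse mult_ac)
  qed
  have lim2: "(\<lambda>k. ((iexp (- 2 * pi * (x \<bullet> b) * t k) - 1) / of_real (t k)) * inv_fourier f x) \<longlonglongrightarrow>
      - (2 * of_real pi * \<i> * of_real (x \<bullet> b)) * inv_fourier f x"
  proof (intro tendsto_mult tendsto_const)
    let ?c = "- (2 * of_real pi * \<i> * of_real (x \<bullet> b))"
    have "((\<lambda>z. exp (?c * z)) has_field_derivative ?c) (at 0)"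
      by (auto intro!: derivative_eq_intros)
    then have "((\<lambda>z. (exp (?c * z) - 1) / z) \<longlongrightarrow> ?c) (at 0)"
      by (simp add: has_field_derivative_iff)
    moreover have "filterlim (\<lambda>k. complex_of_real (t k)) (at 0) sequentially"
      using t(1) tendsto_of_real[OF t0] by (auto simp: filterlim_at intro!: always_eventually) (metis less_irrefl)
    ultimately have "(\<lambda>k. (exp (?c * of_real (t k)) - 1) / of_real (t k)) \<longlonglongrightarrow> ?c"
      by (rule filterlim_compose)
    then show "(\<lambda>k. (iexp (- 2 * pi * (x \<bullet> b) * t k) - 1) / of_real (t k)) \<longlonglongrightarrow> ?c"
      by (simp add: mult_ac)
  qed
  show ?thesis
    unfolding inv_fourier_echar[of "pd b f"]
    using LIMSEQ_unique[OF lim1] lim2 unfolding eq by blast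
qed

text \<open>Each factor \<open>1 + norm x\<close> is at most \<open>1\<close> plus the sum of the absolute values of the coordinates, and a coordinate is
  turned into a derivative of \<open>f\<close> by \<open>inv_fourier_pd\<close>.\<close>

lemma inv_fourier_decay:
  "f \<in> schwartz \<Longrightarrow> \<exists>C. \<forall>x. (1 + norm x) ^ k * norm (inv_fourier f (x::'a::euclidean_space)) \<le> C"
proof (induction k arbitrary: f)
  case 0
  show ?case using norm_inv_fourier_le[of f] by auto
next
  case (Suc k)
  obtain C where C: "\<forall>x. (1 + norm x) ^ k * norm (inv_fourier f x) \<le> C" using Suc by blast
  have "\<forall>b\<in>Basis. \<exists>D. \<forall>x. (1 + norm x) ^ k * norm (inv_fourier (pd b f) x) \<le> D"
    using Suc schwartz_pd by blast
  then obtain D where D: "\<And>b x. b \<in> Basis \<Longrightarrow> (1 + norm x) ^ k * norm (inv_fourier (pd b f) x) \<le> D b"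
    by metis
  have "(1 + norm x) ^ Suc k * norm (inv_fourier f x) \<le> C + (\<Sum>b\<in>Basis. D b)" for x
  proof -
    have "(1 + norm x) * norm (inv_fourier f x) \<le> (1 + (\<Sum>b\<in>Basis. \<bar>x \<bullet> b\<bar>)) * norm (inv_fourier f x)"
      using norm_le_l1[of x] by (intro mult_right_mono) auto
    also have "\<dots> = norm (inv_fourier f x) + (\<Sum>b\<in>Basis. \<bar>x \<bullet> b\<bar> * norm (inv_fourier f x))"
      by (simp add: distrib_right sum_distrib_right)
    also have "\<dots> \<le> norm (inv_fourier f x) + (\<Sum>b\<in>Basis. norm (inv_fourier (pd b f) x))"
    proof (intro add_left_mono sum_mono)
      fix b :: 'a assume b: "b \<in> Basis"
      have "\<bar>x \<bullet> b\<bar> * norm (inv_fourier f x) \<le> (2 * pi) * (\<bar>x \<bullet> b\<bar> * norm (inv_fourier f x))"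
        using pi_ge_two mult_right_mono[of 1 "2 * pi" "\<bar>x \<bullet> b\<bar> * norm (inv_fourier f x)"] by simp
      then show "\<bar>x \<bullet> b\<bar> * norm (inv_fourier f x) \<le> norm (inv_fourier (pd b f) x)"
        by (simp add: inv_fourier_pd[OF Suc.prems b] norm_mult)
    qed
    finally have "(1 + norm x) ^ k * ((1 + norm x) * norm (inv_fourier f x)) \<le>
      (1 + norm x) ^ k * (norm (inv_fourier f x) + (\<Sum>b\<in>Basis. norm (inv_fourier (pd b f) x)))"
      by (rule mult_left_mono) simp
    also have "\<dots> = (1 + norm x) ^ k * norm (inv_fourier f x) + (\<Sum>b\<in>Basis. (1 + norm x) ^ k * norm (inv_fourier (pd b f) x))"
      by (simp add: distrib_left sum_distrib_left)
    also have "\<dots> \<le> C + (\<Sum>b\<in>Basis. D b)" using C D by (intro add_mono sum_mono) auto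
    finally show ?thesis by (simp add: mult_ac)
  qed
  then show ?case by blast
qed

lemma inv_fourier_schwartz:
  assumes "f \<in> schwartz"
  shows "inv_fourier f \<in> schwartz"
proof (rule schwartz_coinduct[where A = "inv_fourier ` schwartz"], goal_cases)
  case 1
  show ?case using assms by simp
next
  case (2 h)
  then obtain f where h: "h = inv_fourier f" "f \<in> schwartz" by auto
  show ?case
  proof (intro exI[of _ "\<lambda>b. inv_fourier (\<lambda>y. 2 * of_real pi * \<i> * (of_real (y \<bullet> b) * f y))"] conjI ballI allI)
    show "inv_fourier (\<lambda>y. 2 * of_real pi * \<i> * (of_real (y \<bullet> b) * f y)) \<in> inv_fourier ` schwartz" for b
      by (intro imageI schwartz_cmult schwartz_coord_mult h)
    show "\<exists>D. (h has_derivative D) (at x) \<and> (\<forall>b\<in>Basis. D b = inv_fourier (\<lambda>y. 2 * of_real pi * \<i> * (of_real (y \<bullet> b) * f y)) x)" for x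
      unfolding h(1)
      by (rule exI, rule conjI, rule inv_fourier_has_derivative[OF h(2)])
         (simp add: inner_Basis if_distrib[of of_real] if_distrib[of "\<lambda>x. x * _"] sum.delta cong: if_cong)
  qed
next
  case (3 h k)
  then show ?case using inv_fourier_decay by auto
qed

lemma fourier_schwartz:
  assumes "f \<in> schwartz" shows "fourier f \<in> schwartz"
  using schwartz_reflect[OF inv_fourier_schwartz[OF assms]] by (simp add: fourier_reflect[abs_def])

section \<open>Gaussians and Fourier inversion\<close>

text \<open>The heat kernel at time \<open>r\<close>.\<close>

definition heat :: "real \<Rightarrow> 'a::euclidean_space \<Rightarrow> real" where
  "heat r x = (4 * pi * r) powr (- (real DIM('a) / 2)) * exp (- (norm x)\<^sup>2 / (4 * r))"

lemma lborel_prod_integral: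
  fixes f :: "'a::euclidean_space \<Rightarrow> real \<Rightarrow> complex"
  assumes "\<And>b. b \<in> Basis \<Longrightarrow> integrable lborel (f b)"
  shows "integrable lborel (\<lambda>x::'a. \<Prod>b\<in>Basis. f b (x \<bullet> b))"
    and "(LINT x|lborel. (\<Prod>b\<in>Basis. f b (x \<bullet> b))) = (\<Prod>b\<in>(Basis::'a set). (LINT t|lborel. f b t))"
proof -
  interpret product_sigma_finite "\<lambda>_::'a. lborel :: real measure" ..
  have m: "(\<lambda>x::'a. \<Prod>b\<in>Basis. f b (x \<bullet> b)) \<in> borel_measurable borel"
  proof (rule borel_measurable_prod)
    fix b :: 'a assume "b \<in> Basis"
    then have [measurable]: "f b \<in> borel_measurable borel" using assms[of b] borel_measurable_integrable by fastforce
    show "(\<lambda>x. f b (x \<bullet> b)) \<in> borel_measurable borel" by measurable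
  qed
  have d: "(\<lambda>g. \<Sum>b\<in>(Basis::'a set). g b *\<^sub>R b) \<in> measurable (\<Pi>\<^sub>M b\<in>Basis. lborel) borel"
    by measurable
  have e: "(\<Prod>c\<in>Basis. f c ((\<Sum>b\<in>(Basis::'a set). g b *\<^sub>R b) \<bullet> c)) = (\<Prod>c\<in>Basis. f c (g c))" for g
    by (intro prod.cong refl) simp
  show "integrable lborel (\<lambda>x::'a. \<Prod>b\<in>Basis. f b (x \<bullet> b))"
    using product_integrable_prod[OF finite_Basis assms] unfolding lborel_eq[where 'a = 'a]
    by (subst integrable_distr_eq[OF d m]) (simp add: e)
  show "(LINT x|lborel. (\<Prod>b\<in>Basis. f b (x \<bullet> b))) = (\<Prod>b\<in>(Basis::'a set). (LINT t|lborel. f b t))"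
    using product_integral_prod[OF finite_Basis assms] unfolding lborel_eq[where 'a = 'a]
    by (subst integral_distr[OF d m]) (simp add: e)
qed

text \<open>Rescaling of the characteristic function of the standard normal distribution.\<close>

lemma gauss_fourier_1d:
  assumes a: "a > (0::real)"
  shows "integrable lborel (\<lambda>t. of_real (exp (- a * t\<^sup>2)) * iexp (\<tau> * t))"
    and "(LINT t|lborel. of_real (exp (- a * t\<^sup>2)) * iexp (\<tau> * t)) = of_real (sqrt (pi / a) * exp (- \<tau>\<^sup>2 / (4 * a)))"
proof -
  define c where "c = sqrt (2 * a)"
  have c: "c > 0" "c\<^sup>2 = 2 * a" using a by (auto simp: c_def)
  define F where "F x = std_normal_density x *\<^sub>R iexp (\<tau> / c * x)" for x
  have "integrable lborel std_normal_density" by simp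
  then have iF: "integrable lborel F" unfolding F_def
    by (rule Bochner_Integration.integrable_bound) auto
  have "char std_normal_distribution (\<tau> / c) = (LINT x|lborel. F x)"
    unfolding char_def F_def by (subst integral_density) auto
  then have F: "(LINT x|lborel. F x) = of_real (exp (- ((\<tau> / c)\<^sup>2) / 2))"
    by (simp add: char_std_normal_distribution)
  have eq: "of_real (exp (- a * t\<^sup>2)) * iexp (\<tau> * t) = of_real (sqrt (2 * pi)) * F (0 + c * t)" for t
    using c a unfolding F_def normal_density_def
    by (simp add: scaleR_conv_of_real power_mult_distrib field_simps real_sqrt_mult)
  show "integrable lborel (\<lambda>t. of_real (exp (- a * t\<^sup>2)) * iexp (\<tau> * t))"
    unfolding eq using iF c by (intro integrable_mult_right lborel_integrable_real_affine) auto
  have "of_real (exp (- ((\<tau> / c)\<^sup>2) / 2)) = c *\<^sub>R (LINT t|lborel. F (0 + c * t))"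
    using lborel_integral_real_affine[of c F 0] c unfolding F by simp
  then have G: "(LINT t|lborel. F (0 + c * t)) = of_real (exp (- ((\<tau> / c)\<^sup>2) / 2) / c)"
    using c(1) by (simp add: scaleR_conv_of_real field_simps)
  have "sqrt (2 * pi) / c = sqrt (pi / a)"
    using a by (simp add: c_def real_sqrt_divide[symmetric])
  then have 1: "sqrt (2 * pi) * (exp (- ((\<tau> / c)\<^sup>2) / 2) / c) = sqrt (pi / a) * exp (- ((\<tau> / c)\<^sup>2) / 2)"
    by (metis times_divide_eq_left times_divide_eq_right)
  have 2: "- ((\<tau> / c)\<^sup>2) / 2 = - \<tau>\<^sup>2 / (4 * a)" using c by (simp add: power_divide)
  show "(LINT t|lborel. of_real (exp (- a * t\<^sup>2)) * iexp (\<tau> * t)) = of_real (sqrt (pi / a) * exp (- \<tau>\<^sup>2 / (4 * a)))"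
    unfolding eq integral_mult_right_zero G of_real_mult[symmetric] 1 unfolding 2 ..
qed

lemma norm_sq_sum: "(norm (x::'a::euclidean_space))\<^sup>2 = (\<Sum>b\<in>Basis. (x \<bullet> b)\<^sup>2)"
  unfolding power2_norm_eq_inner by (subst euclidean_inner) (simp add: power2_eq_square)

lemma gauss_fourier:
  fixes x :: "'a::euclidean_space"
  assumes a: "a > 0"
  shows "integrable lborel (\<lambda>y. of_real (exp (- a * (norm y)\<^sup>2)) * echar x y)"
    and "(LINT y|lborel. of_real (exp (- a * (norm y)\<^sup>2)) * echar x y) = of_real ((pi / a) powr (real DIM('a) / 2) * exp (- pi\<^sup>2 * (norm x)\<^sup>2 / a))"
proof -
  define f where "f b t = of_real (exp (- a * t\<^sup>2)) * iexp (2 * pi * (x \<bullet> b) * t)" for b and t :: real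
  have eq: "of_real (exp (- a * (norm y)\<^sup>2)) * echar x y = (\<Prod>b\<in>Basis. f b (y \<bullet> b))" for y :: 'a
  proof -
    have 1: "exp (- a * (norm y)\<^sup>2) = (\<Prod>b\<in>Basis. exp (- a * (y \<bullet> b)\<^sup>2))"
      unfolding norm_sq_sum by (simp add: exp_sum[symmetric] sum_distrib_left sum_negf)
    have 2: "echar x y = (\<Prod>b\<in>Basis. iexp (2 * pi * (x \<bullet> b) * (y \<bullet> b)))"
      unfolding echar_iexp euclidean_inner[of x y]
      by (simp add: exp_sum[symmetric] sum_distrib_left mult.assoc)
    show ?thesis unfolding 1 2 f_def by (simp add: prod.distrib)
  qed
  have i: "integrable lborel (f b)" for b unfolding f_def by (rule gauss_fourier_1d[OF a])
  show "integrable lborel (\<lambda>y. of_real (exp (- a * (norm y)\<^sup>2)) * echar x y)"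
    unfolding eq by (rule lborel_prod_integral(1)[OF i])
  have "(LINT y|lborel. of_real (exp (- a * (norm y)\<^sup>2)) * echar x y) = (\<Prod>b\<in>(Basis::'a set). (LINT t|lborel. f b t))"
    unfolding eq by (rule lborel_prod_integral(2)[OF i])
  also have "\<dots> = (\<Prod>b\<in>(Basis::'a set). of_real (sqrt (pi / a) * exp (- (2 * pi * (x \<bullet> b))\<^sup>2 / (4 * a))))"
    unfolding f_def by (simp only: gauss_fourier_1d(2)[OF a])
  also have "\<dots> = of_real (sqrt (pi / a) ^ DIM('a) * exp (\<Sum>b\<in>(Basis::'a set). - (2 * pi * (x \<bullet> b))\<^sup>2 / (4 * a)))"
    by (simp add: prod.distrib exp_sum)
  also have "sqrt (pi / a) ^ DIM('a) = (pi / a) powr (real DIM('a) / 2)"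
    using a by (simp add: powr_half_sqrt[symmetric] powr_realpow[symmetric] powr_powr)
  also have "(\<Sum>b\<in>(Basis::'a set). - (2 * pi * (x \<bullet> b))\<^sup>2 / (4 * a)) = - pi\<^sup>2 * (norm x)\<^sup>2 / a"
    unfolding norm_sq_sum by (simp add: power_mult_distrib sum_distrib_left sum_divide_distrib sum_negf)
  finally show "(LINT y|lborel. of_real (exp (- a * (norm y)\<^sup>2)) * echar x y) = of_real ((pi / a) powr (real DIM('a) / 2) * exp (- pi\<^sup>2 * (norm x)\<^sup>2 / a))" .
qed

lemma heat_nonneg [simp]: "heat r x \<ge> 0"
  by (simp add: heat_def)

lemma heat_measurable [measurable (raw)]:
  "f \<in> borel_measurable M \<Longrightarrow> g \<in> borel_measurable M \<Longrightarrow> (\<lambda>x. heat (f x) (g x)) \<in> borel_measurable M"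
  unfolding heat_def by simp

lemma heat_minus [simp]: "heat r (- x) = heat r x"
  by (simp add: heat_def)

lemma heat_minus_commute: "heat r (x - y) = heat r (y - x)"
  by (metis heat_minus minus_diff_eq)

lemma heat_integral:
  fixes x :: "'a::euclidean_space"
  assumes r: "r > 0"
  shows "integrable lborel (heat r :: 'a \<Rightarrow> real)" "(LINT x|lborel. heat r (x :: 'a)) = 1"
    "(\<integral>\<^sup>+x. ennreal (heat r (x::'a)) \<partial>lborel) = 1"
proof -
  have a: "1 / (4 * r) > 0" using r by simp
  have "(\<lambda>y::'a. of_real (exp (- (1 / (4 * r)) * (norm y)\<^sup>2)) * echar 0 y) = (\<lambda>y. complex_of_real (exp (- (norm y)\<^sup>2 / (4 * r))))"
    by (auto simp: echar_def)
  then have 1: "integrable lborel (\<lambda>y::'a. complex_of_real (exp (- (norm y)\<^sup>2 / (4 * r))))"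
    and 2: "(LINT y|lborel. complex_of_real (exp (- (norm (y::'a))\<^sup>2 / (4 * r)))) = of_real ((4 * pi * r) powr (real DIM('a) / 2))"
    using gauss_fourier[OF a, of "0::'a"] by (simp_all add: mult_ac)
  have 1: "integrable lborel (\<lambda>y::'a. exp (- (norm y)\<^sup>2 / (4 * r)))"
    using 1 by (simp only: complex_of_real_integrable_eq)
  then show i: "integrable lborel (heat r :: 'a \<Rightarrow> real)" unfolding heat_def[abs_def] by (rule integrable_mult_right)
  have "(LINT y|lborel. exp (- (norm (y::'a))\<^sup>2 / (4 * r))) = (4 * pi * r) powr (real DIM('a) / 2)"
    using 2 unfolding integral_complex_of_real of_real_eq_iff .
  then show 3: "(LINT x|lborel. heat r (x :: 'a)) = 1"
    unfolding heat_def using r by (simp add: powr_minus)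
  show "(\<integral>\<^sup>+x. ennreal (heat r (x::'a)) \<partial>lborel) = 1"
    using nn_integral_eq_integral[OF i] 3 by simp
qed

lemma heat_fourier:
  assumes r: "r > 0"
  shows "(LINT y|lborel. of_real (exp (- (4 * pi\<^sup>2 * r) * (norm y)\<^sup>2)) * echar x y) = of_real (heat r (x::'a::euclidean_space))"
proof -
  have a: "4 * pi\<^sup>2 * r > 0" using r by simp
  have w1: "pi / (4 * pi\<^sup>2 * r) = inverse (4 * pi * r)"
    using r by (simp add: power2_eq_square field_simps)
  have w2: "- pi\<^sup>2 * (norm x)\<^sup>2 / (4 * pi\<^sup>2 * r) = - (norm x)\<^sup>2 / (4 * r)" by simp
  have "inverse (4 * pi * r) powr (real DIM('a) / 2) = (4 * pi * r) powr (- (real DIM('a) / 2))"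
    using r by (simp only: powr_def ln_inverse) auto
  then have "(pi / (4 * pi\<^sup>2 * r)) powr (real DIM('a) / 2) * exp (- pi\<^sup>2 * (norm x)\<^sup>2 / (4 * pi\<^sup>2 * r)) = heat r x"
    unfolding w1 w2 heat_def by simp
  then show ?thesis by (simp only: gauss_fourier(2)[OF a, of x])
qed

lemma integrable_product_kernel:
  fixes f :: "'b \<Rightarrow> complex" and g :: "'c \<Rightarrow> complex"
  assumes "sigma_finite_measure M" "sigma_finite_measure N" "integrable M f" "integrable N g"
    "case_prod k \<in> borel_measurable (M \<Otimes>\<^sub>M N)" "\<And>x y. norm (k x y) \<le> 1"
  shows "integrable (M \<Otimes>\<^sub>M N) (\<lambda>(x, y). f x * g y * k x y)"
proof -
  interpret M: sigma_finite_measure M by fact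
  interpret N: sigma_finite_measure N by fact
  interpret pair_sigma_finite M N ..
  have [measurable]: "f \<in> borel_measurable M" "g \<in> borel_measurable N" using assms by auto
  have "integrable (M \<Otimes>\<^sub>M N) (\<lambda>z. f (fst z) * g (snd z))"
  proof (rule Fubini_integrable)
    show "integrable M (\<lambda>x. LINT y|N. norm (f (fst (x, y)) * g (snd (x, y))))"
      using assms(3) by (simp add: norm_mult)
    show "AE x in M. integrable N (\<lambda>y. f (fst (x, y)) * g (snd (x, y)))"
      using assms(4) by simp
  qed measurable
  from integrable_times_bounded[OF this assms(5)] assms(6) show ?thesis
    by (simp add: case_prod_unfold)
qed

text \<open>Damping the transform by a Gaussian makes the double integral absolutely convergent, and by Fubini it
  becomes a convolution with the heat kernel.\<close>

lemma fourier_heat_conv: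
  assumes f: "f \<in> schwartz" and r: "r > 0"
  shows "fourier (\<lambda>y. of_real (exp (- (4 * pi\<^sup>2 * r) * (norm y)\<^sup>2)) * inv_fourier f y) z =
    (LINT x|lborel. f x * of_real (heat r (x - (z::'a::euclidean_space))))"
proof -
  let ?E = "\<lambda>y::'a. complex_of_real (exp (- (4 * pi\<^sup>2 * r) * (norm y)\<^sup>2))"
  have "integrable lborel (\<lambda>y. ?E y * echar 0 y)" using r by (intro gauss_fourier) auto
  then have iE: "integrable lborel ?E" by (simp add: echar_def)
  have [measurable]: "f \<in> borel_measurable borel" using schwartz_measurable[OF f] .
  have int: "integrable (lborel \<Otimes>\<^sub>M lborel) (\<lambda>(x, y). f x * ?E y * (echar y x * echar (- z) y))"
    by (rule integrable_product_kernel) (use iE schwartz_integrable f sigma_finite_lborel in \<open>simp_all add: norm_mult\<close>)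
  have "fourier (\<lambda>y. ?E y * inv_fourier f y) z = (LINT y|lborel. LINT x|lborel. f x * ?E y * (echar y x * echar (- z) y))"
    unfolding fourier_reflect inv_fourier_echar
    by (simp add: integral_mult_left_zero[symmetric] integral_mult_right_zero[symmetric] mult_ac)
  also have "\<dots> = (LINT x|lborel. LINT y|lborel. f x * ?E y * (echar y x * echar (- z) y))"
    by (rule lborel_pair.Fubini_integral[OF int])
  also have "\<dots> = (LINT x|lborel. f x * (LINT y|lborel. ?E y * echar (x - z) y))"
    unfolding integral_mult_right_zero[symmetric] diff_conv_add_uminus echar_add
    by (simp add: mult_ac echar_commute)
  finally show ?thesis unfolding heat_fourier[OF r] .
qed

lemma lborel_integral_scale:
  fixes f :: "'a::euclidean_space \<Rightarrow> 'b::{banach, second_countable_topology}"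
  assumes [measurable]: "f \<in> borel_measurable borel" and c: "c > 0"
  shows "(LINT x|lborel. f x) = c ^ DIM('a) *\<^sub>R (LINT x|lborel. f (c *\<^sub>R x))"
  using c by (subst lborel_affine[of c 0]) (auto simp: integral_density integral_distr)

text \<open>As \<open>r\<close> tends to \<open>0\<close>, the damped transform converges to the undamped one by dominated convergence,
  and the heat kernel acts as an approximate identity on the continuous bounded function \<open>f\<close>.\<close>

lemma fourier_inv_fourier:
  assumes f: "f \<in> schwartz"
  shows "fourier (inv_fourier f) z = f (z::'a::euclidean_space)"
proof -
  define t where "t k = 1 / real (Suc k)" for k
  have t: "t k > 0" for k by (auto simp: t_def)
  have t0: "t \<longlonglongrightarrow> 0" unfolding t_def using LIMSEQ_inverse_real_of_nat by (simp add: inverse_eq_divide)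
  have [measurable]: "f \<in> borel_measurable borel" "inv_fourier f \<in> borel_measurable borel"
    using schwartz_measurable f inv_fourier_schwartz by auto
  have 1: "(\<lambda>k. fourier (\<lambda>y. of_real (exp (- (4 * pi\<^sup>2 * t k) * (norm y)\<^sup>2)) * inv_fourier f y) z) \<longlonglongrightarrow> fourier (inv_fourier f) z"
    unfolding fourier_reflect inv_fourier_echar[of _ "- z"]
  proof (rule integral_dominated_convergence[where w = "\<lambda>y. norm (inv_fourier f y)"])
    show "integrable lborel (\<lambda>y. norm (inv_fourier f y))"
      by (intro integrable_norm schwartz_integrable inv_fourier_schwartz f)
    show "AE y in lborel. (\<lambda>k. of_real (exp (- (4 * pi\<^sup>2 * t k) * (norm y)\<^sup>2)) * inv_fourier f y * echar (- z) y)
       \<longlonglongrightarrow> inv_fourier f y * echar (- z) y"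
    proof (rule AE_I2)
      fix y :: 'a
      have "(\<lambda>k. complex_of_real (exp (- (4 * pi\<^sup>2 * t k) * (norm y)\<^sup>2))) \<longlonglongrightarrow> of_real (exp (- (4 * pi\<^sup>2 * 0) * (norm y)\<^sup>2))"
        by (intro tendsto_intros t0)
      from tendsto_mult_right[OF this, of "inv_fourier f y * echar (- z) y"]
      show "(\<lambda>k. of_real (exp (- (4 * pi\<^sup>2 * t k) * (norm y)\<^sup>2)) * inv_fourier f y * echar (- z) y)
       \<longlonglongrightarrow> inv_fourier f y * echar (- z) y" by (simp add: mult.assoc)
    qed
    show "AE y in lborel. norm (of_real (exp (- (4 * pi\<^sup>2 * t k) * (norm y)\<^sup>2)) * inv_fourier f y * echar (- z) y) \<le> norm (inv_fourier f y)" for k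
      using t[of k] by (intro AE_I2) (simp add: norm_mult mult_left_le_one_le)
  qed measurable
  obtain C where C: "C > 0" "\<And>x. norm (f x) \<le> C / (1 + norm x) ^ 0" using schwartz_decayE[OF f, of 0] by blast
  have 2: "(\<lambda>k. LINT x|lborel. f (z + sqrt (t k) *\<^sub>R x) * of_real (heat 1 x)) \<longlonglongrightarrow> (LINT x|lborel. f z * of_real (heat 1 (x::'a)))"
  proof (rule integral_dominated_convergence[where w = "\<lambda>x. C * heat 1 (x::'a)"])
    show "integrable lborel (\<lambda>x::'a. C * heat 1 x)" by (intro integrable_mult_right heat_integral) simp
    show "AE x in lborel. (\<lambda>k. f (z + sqrt (t k) *\<^sub>R x) * of_real (heat 1 x)) \<longlonglongrightarrow> f z * of_real (heat 1 x)"
    proof (rule AE_I2)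
      fix x :: 'a
      have "(\<lambda>k. z + sqrt (t k) *\<^sub>R x) \<longlonglongrightarrow> z + sqrt 0 *\<^sub>R x" by (intro tendsto_intros t0)
      then have "(\<lambda>k. f (z + sqrt (t k) *\<^sub>R x)) \<longlonglongrightarrow> f z"
        using schwartz_continuous[OF f, of UNIV]
        by (intro continuous_on_tendsto_compose[of UNIV f]) auto
      then show "(\<lambda>k. f (z + sqrt (t k) *\<^sub>R x) * of_real (heat 1 x)) \<longlonglongrightarrow> f z * of_real (heat 1 x)"
        by (rule tendsto_mult_right)
    qed
    show "AE x in lborel. norm (f (z + sqrt (t k) *\<^sub>R x) * of_real (heat 1 x)) \<le> C * heat 1 x" for k
      using C by (auto simp: norm_mult intro!: mult_right_mono)
  qed measurable
  have "fourier (\<lambda>y. of_real (exp (- (4 * pi\<^sup>2 * t k) * (norm y)\<^sup>2)) * inv_fourier f y) z =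
      (LINT x|lborel. f (z + sqrt (t k) *\<^sub>R x) * of_real (heat 1 x))" for k
  proof -
    have h: "(sqrt (t k)) ^ DIM('a) * heat (t k) (sqrt (t k) *\<^sub>R x) = heat 1 x" for x :: 'a
    proof -
      have "(sqrt (t k)) ^ DIM('a) = (t k) powr (real DIM('a) / 2)"
        using t[of k] by (simp add: powr_half_sqrt[symmetric] powr_realpow[symmetric] powr_powr)
      moreover have "(norm (sqrt (t k) *\<^sub>R x))\<^sup>2 / (4 * t k) = (norm x)\<^sup>2 / 4"
        using t[of k] by (simp add: power_mult_distrib)
      ultimately show ?thesis
        unfolding heat_def using t[of k] by (simp add: powr_minus powr_mult field_simps)
    qed
    have "fourier (\<lambda>y. of_real (exp (- (4 * pi\<^sup>2 * t k) * (norm y)\<^sup>2)) * inv_fourier f y) z =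
      (LINT x|lborel. f (x + z) * of_real (heat (t k) x))"
      using lborel_integral_translate[of "\<lambda>x. f x * of_real (heat (t k) (x - z))" z]
      unfolding fourier_heat_conv[OF f t] by simp
    also have "\<dots> = (sqrt (t k)) ^ DIM('a) *\<^sub>R (LINT x|lborel. f (sqrt (t k) *\<^sub>R x + z) * of_real (heat (t k) (sqrt (t k) *\<^sub>R x)))"
      using t[of k] by (intro lborel_integral_scale) auto
    also have "\<dots> = (LINT x|lborel. f (z + sqrt (t k) *\<^sub>R x) * of_real (heat 1 x))"
      unfolding integral_scaleR_right[symmetric] h[symmetric]
      by (intro Bochner_Integration.integral_cong refl) (simp add: scaleR_conv_of_real add.commute)
    finally show ?thesis .
  qed
  then have "fourier (inv_fourier f) z = (LINT x|lborel. f z * of_real (heat 1 (x::'a)))"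
    using LIMSEQ_unique[OF 1] 2 by simp
  also have "\<dots> = f z"
    by (simp add: heat_integral)
  finally show ?thesis .
qed

lemma lborel_integral_reflect:
  fixes f :: "'a::euclidean_space \<Rightarrow> 'b::{banach, second_countable_topology}"
  assumes [measurable]: "f \<in> borel_measurable borel"
  shows "(LINT x|lborel. f (- x)) = (LINT x|lborel. f x)"
  by (subst (2) lborel_affine[of "-1" 0]) (auto simp: density_1 integral_distr)

text \<open>The two transforms differ by a reflection, so this is \<open>fourier_inv_fourier\<close> after a reflection of the
  integration variable.\<close>

lemma inv_fourier_fourier:
  assumes f: "f \<in> schwartz"
  shows "inv_fourier (fourier f) z = f (z::'a::euclidean_space)"
proof -
  have [measurable]: "inv_fourier f \<in> borel_measurable borel"
    using schwartz_measurable f inv_fourier_schwartz by auto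
  have "inv_fourier (fourier f) z = (LINT y|lborel. (\<lambda>y. inv_fourier f y * echar (- z) y) (- y))"
    unfolding inv_fourier_echar[of "fourier f"] fourier_reflect by (simp add: echar_def)
  also have "\<dots> = fourier (inv_fourier f) z"
    unfolding fourier_reflect inv_fourier_echar[of _ "- z"] by (subst lborel_integral_reflect) auto
  finally show ?thesis using fourier_inv_fourier[OF f] by simp
qed

section \<open>The inequality of Hoelder\<close>

text \<open>Young's inequality for the normalised functions.\<close>

lemma holder_nn_pos:
  fixes u w :: "'b \<Rightarrow> real"
  assumes pq: "p > 1" "q > 1" "1 / p + 1 / q = 1"
    and [measurable]: "u \<in> borel_measurable M" "w \<in> borel_measurable M"
    and nn: "\<And>x. u x \<ge> 0" "\<And>x. w x \<ge> 0"
    and u: "(\<integral>\<^sup>+x. ennreal (u x powr p) \<partial>M) \<le> ennreal A" "A > 0"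
    and w: "(\<integral>\<^sup>+x. ennreal (w x powr q) \<partial>M) \<le> ennreal B" "B > 0"
  shows "(\<integral>\<^sup>+x. ennreal (u x * w x) \<partial>M) \<le> ennreal (A powr (1 / p) * B powr (1 / q))"
proof -
  let ?c = "A powr (1 / p) * B powr (1 / q)"
  have c: "?c > 0" using u w by simp
  have young: "u x * w x \<le> ?c * (inverse (p * A) * u x powr p + inverse (q * B) * w x powr q)" for x
  proof -
    have "(u x / A powr (1 / p)) * (w x / B powr (1 / q)) \<le> (u x / A powr (1 / p)) powr p / p + (w x / B powr (1 / q)) powr q / q"
      using pq nn by (intro Youngs_inequality) auto
    also have "\<dots> = inverse (p * A) * u x powr p + inverse (q * B) * w x powr q"
      using pq nn u w by (simp add: powr_divide powr_powr field_simps)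
    finally have "?c * ((u x / A powr (1 / p)) * (w x / B powr (1 / q))) \<le> ?c * (inverse (p * A) * u x powr p + inverse (q * B) * w x powr q)"
      using c by (intro mult_left_mono) auto
    moreover have "?c * ((u x / A powr (1 / p)) * (w x / B powr (1 / q))) = u x * w x" using u w by simp
    ultimately show ?thesis by simp
  qed
  have "(\<integral>\<^sup>+x. ennreal (u x * w x) \<partial>M) \<le> (\<integral>\<^sup>+x. ennreal ?c * (ennreal (inverse (p * A)) * ennreal (u x powr p) + ennreal (inverse (q * B)) * ennreal (w x powr q)) \<partial>M)"
  proof (rule nn_integral_mono)
    fix x
    have "ennreal (u x * w x) \<le> ennreal (?c * (inverse (p * A) * u x powr p + inverse (q * B) * w x powr q))"
      using young by (rule ennreal_leI)
    also have "\<dots> = ennreal ?c * (ennreal (inverse (p * A)) * ennreal (u x powr p) + ennreal (inverse (q * B)) * ennreal (w x powr q))"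
      using pq u w by (simp add: ennreal_mult[symmetric] ennreal_plus[symmetric] del: ennreal_plus)
    finally show "ennreal (u x * w x) \<le> ennreal ?c * (ennreal (inverse (p * A)) * ennreal (u x powr p) + ennreal (inverse (q * B)) * ennreal (w x powr q))" .
  qed
  also have "\<dots> = ennreal ?c * (ennreal (inverse (p * A)) * (\<integral>\<^sup>+x. ennreal (u x powr p) \<partial>M) + ennreal (inverse (q * B)) * (\<integral>\<^sup>+x. ennreal (w x powr q) \<partial>M))"
    by (simp add: nn_integral_cmult nn_integral_add)
  also have "\<dots> \<le> ennreal ?c * (ennreal (inverse (p * A)) * ennreal A + ennreal (inverse (q * B)) * ennreal B)"
    using u w by (intro mult_left_mono add_mono) auto
  also have "\<dots> = ennreal (?c * (inverse (p * A) * A + inverse (q * B) * B))"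
    using pq u w by (simp add: ennreal_mult[symmetric] ennreal_plus[symmetric] del: ennreal_plus)
  also have "inverse (p * A) * A + inverse (q * B) * B = 1"
    using pq u w by (simp add: field_simps)
  finally show ?thesis by simp
qed

text \<open>Integrability is part of the conclusion: everything is stated with nonnegative integrals and explicit bounds. A
  vanishing bound forces one factor to vanish almost everywhere.\<close>

lemma holder_nn:
  fixes u w :: "'b \<Rightarrow> real"
  assumes pq: "p > 1" "q > 1" "1 / p + 1 / q = 1"
    and [measurable]: "u \<in> borel_measurable M" "w \<in> borel_measurable M"
    and nn: "\<And>x. u x \<ge> 0" "\<And>x. w x \<ge> 0"
    and u: "(\<integral>\<^sup>+x. ennreal (u x powr p) \<partial>M) \<le> ennreal A" "A \<ge> 0"
    and w: "(\<integral>\<^sup>+x. ennreal (w x powr q) \<partial>M) \<le> ennreal B" "B \<ge> 0"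
  shows "(\<integral>\<^sup>+x. ennreal (u x * w x) \<partial>M) \<le> ennreal (A powr (1 / p) * B powr (1 / q))"
proof (cases "A = 0 \<or> B = 0")
  case True
  then have "AE x in M. u x = 0 \<or> w x = 0"
  proof
    assume "A = 0"
    then have "(\<integral>\<^sup>+x. ennreal (u x powr p) \<partial>M) = 0" using u by simp
    then have "AE x in M. ennreal (u x powr p) = 0" by (subst (asm) nn_integral_0_iff_AE) auto
    then show ?thesis by eventually_elim (use nn in \<open>auto simp: ennreal_eq_0_iff\<close>)
  next
    assume "B = 0"
    then have "(\<integral>\<^sup>+x. ennreal (w x powr q) \<partial>M) = 0" using w by simp
    then have "AE x in M. ennreal (w x powr q) = 0" by (subst (asm) nn_integral_0_iff_AE) auto
    then show ?thesis by eventually_elim (use nn in \<open>auto simp: ennreal_eq_0_iff\<close>)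
  qed
  then have "(\<integral>\<^sup>+x. ennreal (u x * w x) \<partial>M) = (\<integral>\<^sup>+x. 0 \<partial>M)"
    by (intro nn_integral_cong_AE) auto
  then show ?thesis by simp
next
  case False
  then show ?thesis using u w by (intro holder_nn_pos[OF pq] nn u w) auto
qed

section \<open>The reciprocal of the symbol as a mixture of Gaussians\<close>

lemma nn_integral_power_exp:
  assumes t: "t > 0" and a: "a > (0::real)"
  shows "(\<integral>\<^sup>+r. ennreal (indicator {0<..} r * (r powr (t - 1) * exp (- a * r))) \<partial>lborel) = ennreal (Gamma t * a powr (- t))"
proof -
  have "ennreal (Gamma t) = (\<integral>\<^sup>+r. ennreal (indicator {0..} r * r powr (t - 1) / exp r) \<partial>lborel)"
    by (rule Gamma_conv_nn_integral_real[OF t])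
  also have "\<dots> = ennreal \<bar>a\<bar> * (\<integral>\<^sup>+r. ennreal (indicator {0..} (0 + a * r) * (0 + a * r) powr (t - 1) / exp (0 + a * r)) \<partial>lborel)"
    using a by (intro nn_integral_real_affine) auto
  also have "\<dots> = (\<integral>\<^sup>+r. ennreal (a powr t) * ennreal (indicator {0<..} r * (r powr (t - 1) * exp (- a * r))) \<partial>lborel)"
  proof (subst nn_integral_cmult[symmetric], simp, intro nn_integral_cong)
    fix r :: real
    show "ennreal \<bar>a\<bar> * ennreal (indicator {0..} (0 + a * r) * (0 + a * r) powr (t - 1) / exp (0 + a * r)) =
      ennreal (a powr t) * ennreal (indicator {0<..} r * (r powr (t - 1) * exp (- a * r)))"
    proof (cases "r > 0")
      case True
      have "a * a powr (t - 1) = a powr t" using a by (simp add: powr_diff)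
      then show ?thesis using True a
        by (simp add: ennreal_mult[symmetric] powr_mult exp_minus divide_inverse mult.assoc[symmetric])
    next
      case False
      then show ?thesis using a by (cases "r = 0") (auto simp: indicator_def zero_le_mult_iff)
    qed
  qed
  also have "\<dots> = ennreal (a powr t) * (\<integral>\<^sup>+r. ennreal (indicator {0<..} r * (r powr (t - 1) * exp (- a * r))) \<partial>lborel)"
    by (intro nn_integral_cmult) simp
  finally have "ennreal (a powr (- t)) * ennreal (Gamma t) = ennreal (a powr (- t)) * (ennreal (a powr t) * (\<integral>\<^sup>+r. ennreal (indicator {0<..} r * (r powr (t - 1) * exp (- a * r))) \<partial>lborel))"
    by simp
  also have "\<dots> = (\<integral>\<^sup>+r. ennreal (indicator {0<..} r * (r powr (t - 1) * exp (- a * r))) \<partial>lborel)"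
    using a by (simp add: mult.assoc[symmetric] ennreal_mult[symmetric] powr_add[symmetric])
  finally show ?thesis using a t Gamma_real_pos[OF t] by (simp add: ennreal_mult' mult.commute)
qed

lemma nn_integral_powr_exponent:
  assumes a: "a > (1::real)"
  shows "(\<integral>\<^sup>+t. ennreal (a powr (- t)) * indicator {s..} t \<partial>lborel) = ennreal (a powr (- s) / ln a)"
proof -
  have l: "ln a > 0" using a by simp
  have "(\<integral>\<^sup>+t. ennreal (a powr (- t)) * indicator {s..} t \<partial>lborel) = ennreal (0 - (- (a powr (- s) / ln a)))"
  proof (rule nn_integral_FTC_atLeast)
    show "((\<lambda>t. - (a powr (- t) / ln a)) has_real_derivative a powr (- x)) (at x)" for x
      using a l by (auto intro!: derivative_eq_intros simp: powr_def)
    have "((\<lambda>t. - (exp (- (t * ln a)) / ln a)) \<longlongrightarrow> - (0 / ln a)) at_top"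
    proof (intro tendsto_minus tendsto_divide tendsto_const)
      have "filterlim (\<lambda>t. t * ln a) at_top at_top"
        using l by (intro filterlim_at_top_mult_tendsto_pos[OF tendsto_const _ filterlim_ident])
      then show "((\<lambda>t. exp (- (t * ln a))) \<longlongrightarrow> 0) at_top"
        by (intro filterlim_compose[OF exp_at_bot] filterlim_compose[OF filterlim_uminus_at_bot_at_top])
    qed (use l in simp)
    then show "((\<lambda>t. - (a powr (- t) / ln a)) \<longlongrightarrow> 0) at_top" using a by (simp add: powr_def)
  qed auto
  then show ?thesis by simp
qed

text \<open>For \<open>t \<ge> 1\<close> the Gamma integral over \<open>{1..2}\<close> is at least \<open>exp (- 2)\<close>, and for \<open>t < 1\<close> the integral over
  \<open>{0<..1}\<close> is at least \<open>exp (- 1)\<close>, because the power of the integration variable is at least \<open>1\<close> there.\<close>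

lemma rGamma_bounds: "t > 0 \<Longrightarrow> rGamma t \<ge> 0" "t > 0 \<Longrightarrow> rGamma t \<le> exp (2::real)"
proof -
  assume t: "t > 0"
  have G: "Gamma t > 0" using t by (rule Gamma_real_pos)
  show "rGamma t \<ge> 0" using G by (simp add: rGamma_inverse_Gamma)
  have "ennreal (exp (- 2)) \<le> ennreal (Gamma t)"
  proof (cases "t \<ge> 1")
    case True
    have "ennreal (exp (- 2)) = (\<integral>\<^sup>+r. ennreal (exp (- 2)) * indicator {1..2::real} r \<partial>lborel)"
      by (simp add: nn_integral_cmult)
    also have "\<dots> \<le> (\<integral>\<^sup>+r. ennreal (indicator {0<..} r * (r powr (t - 1) * exp (- 1 * r))) \<partial>lborel)"
    proof (rule nn_integral_mono)
      fix r :: real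
      have "exp (- 2) \<le> r powr (t - 1) * exp (- 1 * r)" if "r \<in> {1..2}"
      proof -
        have "1 * exp (- 2) \<le> r powr (t - 1) * exp (- 1 * r)"
          using that True by (intro mult_mono ge_one_powr_ge_zero) auto
        then show ?thesis by simp
      qed
      then show "ennreal (exp (- 2)) * indicator {1..2::real} r \<le> ennreal (indicator {0<..} r * (r powr (t - 1) * exp (- 1 * r)))"
        by (auto simp: indicator_def intro!: ennreal_leI)
    qed
    also have "\<dots> = ennreal (Gamma t)" using nn_integral_power_exp[OF t, of 1] by simp
    finally show ?thesis .
  next
    case False
    have "ennreal (exp (- 2)) \<le> ennreal (exp (- 1))" by (simp add: ennreal_leI)
    also have "ennreal (exp (- 1)) = (\<integral>\<^sup>+r. ennreal (exp (- 1)) * indicator {0<..1::real} r \<partial>lborel)"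
      by (simp add: nn_integral_cmult)
    also have "\<dots> \<le> (\<integral>\<^sup>+r. ennreal (indicator {0<..} r * (r powr (t - 1) * exp (- 1 * r))) \<partial>lborel)"
    proof (rule nn_integral_mono)
      fix r :: real
      have "exp (- 1) \<le> r powr (t - 1) * exp (- 1 * r)" if "r \<in> {0<..1}"
      proof -
        have "r powr 0 \<le> r powr (t - 1)" using that False by (intro powr_mono') auto
        then have "1 * exp (- 1) \<le> r powr (t - 1) * exp (- 1 * r)"
          using that False by (intro mult_mono) auto
        then show ?thesis by simp
      qed
      then show "ennreal (exp (- 1)) * indicator {0<..1::real} r \<le> ennreal (indicator {0<..} r * (r powr (t - 1) * exp (- 1 * r)))"
        by (auto simp: indicator_def intro!: ennreal_leI)
    qed
    also have "\<dots> = ennreal (Gamma t)" using nn_integral_power_exp[OF t, of 1] by simp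
    finally show ?thesis .
  qed
  then have "exp (- 2) \<le> Gamma t" using G by (simp add: ennreal_le_iff)
  then have "inverse (Gamma t) \<le> inverse (exp (- 2))" by (intro le_imp_inverse_le) auto
  then show "rGamma t \<le> exp 2" by (simp add: rGamma_inverse_Gamma exp_minus)
qed

lemma rGamma_measurable [measurable]: "(rGamma :: real \<Rightarrow> real) \<in> borel_measurable borel"
  by (intro borel_measurable_continuous_onI continuous_on_rGamma)

text \<open>Integrating \<open>r powr (t - 1) / Gamma t\<close> over \<open>t \<ge> s\<close> produces the density whose Laplace transform is
  \<open>a powr (- s) / ln a\<close>. The reciprocal Gamma function is used because it is continuous on the whole line.\<close>

definition mixture_density :: "real \<Rightarrow> real \<Rightarrow> ennreal" where
  "mixture_density s r = (\<integral>\<^sup>+t. ennreal (rGamma t * r powr (t - 1)) * indicator {s..} t \<partial>lborel)"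

text \<open>The factor \<open>exp (- lam * r)\<close> shifts the argument of the Laplace transform by \<open>lam\<close> and makes the measure finite.\<close>

definition heat_mixture :: "real \<Rightarrow> real \<Rightarrow> real measure" where
  "heat_mixture lam s = density lborel (\<lambda>r. ennreal (indicator {0<..} r * exp (- lam * r)) * mixture_density s r)"

lemma mixture_density_measurable [measurable]: "mixture_density s \<in> borel_measurable borel"
  unfolding mixture_density_def[abs_def] by measurable

lemma sets_heat_mixture [measurable_cong, simp]: "sets (heat_mixture lam s) = sets borel"
  by (simp add: heat_mixture_def)

lemma space_heat_mixture [simp]: "space (heat_mixture lam s) = UNIV"
  by (simp add: heat_mixture_def)

text \<open>By Tonelli, the Gamma integral in \<open>r\<close> turns the density into \<open>(lam + q) powr (- t)\<close>, and the integral in \<open>t\<close>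
  produces the logarithm.\<close>

lemma heat_mixture_laplace:
  assumes lam: "lam > 1" and s: "s > 0" and q: "q \<ge> 0"
  shows "(\<integral>\<^sup>+r. ennreal (exp (- (q * r))) \<partial>heat_mixture lam s) = ennreal (inverse ((lam + q) powr s * ln (lam + q)))"
proof -
  let ?a = "lam + q"
  have a: "?a > 1" using lam q by simp
  have "(\<integral>\<^sup>+r. ennreal (exp (- (q * r))) \<partial>heat_mixture lam s) =
    (\<integral>\<^sup>+r. ennreal (indicator {0<..} r * exp (- lam * r)) * mixture_density s r * ennreal (exp (- (q * r))) \<partial>lborel)"
    unfolding heat_mixture_def by (subst nn_integral_density) auto
  also have "\<dots> = (\<integral>\<^sup>+r. \<integral>\<^sup>+t. ennreal (indicator {0<..} r * (r powr (t - 1) * exp (- ?a * r))) * (ennreal (rGamma t) * indicator {s..} t) \<partial>lborel \<partial>lborel)"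
  proof (intro nn_integral_cong)
    fix r :: real
    have "ennreal (indicator {0<..} r * exp (- lam * r)) * mixture_density s r * ennreal (exp (- (q * r))) =
      ennreal (indicator {0<..} r * exp (- ?a * r)) * mixture_density s r"
    proof -
      have e: "exp (- lam * r) * exp (- (q * r)) = exp (- ?a * r)"
        unfolding exp_add[symmetric] by (simp add: algebra_simps)
      have "ennreal (indicator {0<..} r * exp (- lam * r)) * ennreal (exp (- (q * r))) = ennreal (indicator {0<..} r * exp (- ?a * r))"
        by (subst ennreal_mult[symmetric]) (auto simp only: e mult.assoc, auto)
      then show ?thesis by (metis mult.commute mult.assoc)
    qed
    also have "\<dots> = (\<integral>\<^sup>+t. ennreal (indicator {0<..} r * exp (- ?a * r)) * (ennreal (rGamma t * r powr (t - 1)) * indicator {s..} t) \<partial>lborel)"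
      unfolding mixture_density_def by (intro nn_integral_cmult[symmetric]) simp
    also have "\<dots> = (\<integral>\<^sup>+t. ennreal (indicator {0<..} r * (r powr (t - 1) * exp (- ?a * r))) * (ennreal (rGamma t) * indicator {s..} t) \<partial>lborel)"
      using s rGamma_bounds(1)
      by (intro nn_integral_cong) (auto simp: indicator_def ennreal_mult[symmetric] mult_ac)
    finally show "ennreal (indicator {0<..} r * exp (- lam * r)) * mixture_density s r * ennreal (exp (- (q * r))) = \<dots>" .
  qed
  also have "\<dots> = (\<integral>\<^sup>+t. \<integral>\<^sup>+r. ennreal (indicator {0<..} r * (r powr (t - 1) * exp (- ?a * r))) * (ennreal (rGamma t) * indicator {s..} t) \<partial>lborel \<partial>lborel)"
    by (rule lborel_pair.Fubini') measurable
  also have "\<dots> = (\<integral>\<^sup>+t. ennreal (?a powr (- t)) * indicator {s..} t \<partial>lborel)"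
  proof (intro nn_integral_cong)
    fix t :: real
    show "(\<integral>\<^sup>+r. ennreal (indicator {0<..} r * (r powr (t - 1) * exp (- ?a * r))) * (ennreal (rGamma t) * indicator {s..} t) \<partial>lborel) = ennreal (?a powr (- t)) * indicator {s..} t"
    proof (cases "t \<ge> s")
      case True
      then have t: "t > 0" using s by simp
      have "(\<integral>\<^sup>+r. ennreal (indicator {0<..} r * (r powr (t - 1) * exp (- ?a * r))) * ennreal (rGamma t) \<partial>lborel) = ennreal (Gamma t * ?a powr (- t)) * ennreal (rGamma t)"
        using a by (subst nn_integral_multc, simp, subst nn_integral_power_exp[OF t]) auto
      also have "\<dots> = ennreal (?a powr (- t))"
        using Gamma_real_pos[OF t] by (simp add: ennreal_mult[symmetric] rGamma_inverse_Gamma)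
      finally show ?thesis using True by simp
    qed simp
  qed
  also have "\<dots> = ennreal (?a powr (- s) / ln ?a)" by (rule nn_integral_powr_exponent[OF a])
  also have "?a powr (- s) / ln ?a = inverse (?a powr s * ln ?a)" by (simp add: powr_minus divide_inverse)
  finally show ?thesis .
qed

lemma finite_measure_heat_mixture:
  assumes "lam > 1" "s > 0" shows "finite_measure (heat_mixture lam s)"
proof
  show "emeasure (heat_mixture lam s) (space (heat_mixture lam s)) \<noteq> \<infinity>"
    using heat_mixture_laplace[OF assms, of 0] by (simp add: nn_integral_const)
qed

lemma AE_heat_mixture_pos: "AE r in heat_mixture lam s. r > 0"
  unfolding heat_mixture_def by (subst AE_density) (auto simp: indicator_def)

text \<open>Near \<open>0\<close> the integral over \<open>t\<close> is a geometric one, since \<open>1 / Gamma t\<close> is bounded. The gain of the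
  logarithm over the pure power \<open>r powr (s - 1)\<close> is what makes the critical embedding hold.\<close>

lemma mixture_density_small:
  assumes s: "s > 0" and r: "0 < r" "r < 1"
  shows "mixture_density s r \<le> ennreal (exp 2 * (r powr (s - 1) / ln (1 / r)))"
proof -
  have "mixture_density s r \<le> (\<integral>\<^sup>+t. ennreal (exp 2 / r) * (ennreal ((1 / r) powr (- t)) * indicator {s..} t) \<partial>lborel)"
    unfolding mixture_density_def
  proof (rule nn_integral_mono)
    fix t :: real
    have "rGamma t * r powr (t - 1) \<le> exp 2 / r * (1 / r) powr (- t)" if "t \<ge> s"
    proof -
      have "(1 / r) powr (- t) = r powr t" using r by (simp add: powr_def ln_div)
      then have "exp 2 / r * (1 / r) powr (- t) = exp 2 * r powr (t - 1)" using r by (simp add: powr_diff)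
      then show ?thesis using rGamma_bounds[of t] that s by (simp add: mult_right_mono)
    qed
    then show "ennreal (rGamma t * r powr (t - 1)) * indicator {s..} t \<le> ennreal (exp 2 / r) * (ennreal ((1 / r) powr (- t)) * indicator {s..} t)"
      using r by (auto simp: indicator_def ennreal_mult[symmetric] intro!: ennreal_leI)
  qed
  also have "\<dots> = ennreal (exp 2 / r) * ennreal ((1 / r) powr (- s) / ln (1 / r))"
    using r by (subst nn_integral_cmult, simp, subst nn_integral_powr_exponent) auto
  also have "\<dots> = ennreal (exp 2 * (r powr (s - 1) / ln (1 / r)))"
  proof -
    have "(1 / r) powr (- s) = r powr s" using r by (simp add: powr_def ln_div)
    then show ?thesis using r by (simp add: ennreal_mult[symmetric] powr_diff)
  qed
  finally show ?thesis .
qed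

section \<open>Estimates of the heat kernel and of the weights\<close>

lemma exp_sq_lipschitz: "\<bar>exp (- a\<^sup>2) - exp (- b\<^sup>2)\<bar> \<le> \<bar>a - b :: real\<bar>"
proof -
  have "norm (exp (- a\<^sup>2) - exp (- b\<^sup>2)) \<le> 1 * norm (a - b)"
  proof (rule field_differentiable_bound[where S = UNIV and f' = "\<lambda>x. - 2 * x * exp (- x\<^sup>2)"])
    show "((\<lambda>x. exp (- x\<^sup>2)) has_real_derivative - 2 * x * exp (- x\<^sup>2)) (at x within UNIV)" for x :: real
      by (auto intro!: derivative_eq_intros)
    show "norm (- 2 * x * exp (- x\<^sup>2)) \<le> 1" for x :: real
    proof -
      have "2 * \<bar>x\<bar> \<le> 1 + x\<^sup>2" using sum_squares_bound[of "\<bar>x\<bar>" 1] by simp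
      also have "\<dots> \<le> exp (x\<^sup>2)" by (rule exp_ge_add_one_self)
      finally have "2 * \<bar>x\<bar> * exp (- x\<^sup>2) \<le> exp (x\<^sup>2) * exp (- x\<^sup>2)" by (intro mult_right_mono) auto
      then show ?thesis by (simp add: abs_mult exp_minus)
    qed
  qed auto
  then show ?thesis by simp
qed

lemma heat_le:
  assumes "0 < e" "e \<le> r"
  shows "heat r (z::'a::euclidean_space) \<le> (4 * pi * e) powr (- (real DIM('a) / 2))"
proof -
  have "(4 * pi * r) powr (- (real DIM('a) / 2)) \<le> (4 * pi * e) powr (- (real DIM('a) / 2))"
    using assms by (intro powr_mono2') auto
  moreover have "exp (- (norm z)\<^sup>2 / (4 * r)) \<le> 1" using assms by simp
  ultimately have "heat r z \<le> (4 * pi * e) powr (- (real DIM('a) / 2)) * 1"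
    unfolding heat_def by (intro mult_mono) auto
  then show ?thesis by simp
qed

text \<open>The function \<open>exp (- t\<^sup>2)\<close> is 1-Lipschitz, and the heat kernel is its rescaling by \<open>2 * sqrt r\<close>.\<close>

lemma heat_lipschitz:
  assumes "0 < e" "e \<le> r"
  shows "\<bar>heat r z - heat r z'\<bar> \<le> (4 * pi * e) powr (- (real DIM('a) / 2)) / sqrt e * norm (z - (z'::'a::euclidean_space))"
proof -
  have r: "r > 0" using assms by simp
  have eq: "- (norm w)\<^sup>2 / (4 * r) = - (norm w / (2 * sqrt r))\<^sup>2" for w :: 'a
    using r by (simp add: power_divide power_mult_distrib)
  have "\<bar>exp (- (norm z)\<^sup>2 / (4 * r)) - exp (- (norm z')\<^sup>2 / (4 * r))\<bar> \<le> \<bar>norm z / (2 * sqrt r) - norm z' / (2 * sqrt r)\<bar>"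
    unfolding eq by (rule exp_sq_lipschitz)
  also have "\<dots> = \<bar>norm z - norm z'\<bar> / (2 * sqrt r)"
    using r by (simp add: diff_divide_distrib[symmetric])
  also have "\<dots> \<le> norm (z - z') / sqrt e"
  proof (rule frac_le)
    have "sqrt e \<le> sqrt r" using assms by simp
    then show "sqrt e \<le> 2 * sqrt r" using real_sqrt_ge_zero[of r] r by linarith
  qed (use assms norm_triangle_ineq3 in auto)
  finally have 1: "\<bar>exp (- (norm z)\<^sup>2 / (4 * r)) - exp (- (norm z')\<^sup>2 / (4 * r))\<bar> \<le> norm (z - z') / sqrt e" .
  have "\<bar>heat r z - heat r z'\<bar> = (4 * pi * r) powr (- (real DIM('a) / 2)) * \<bar>exp (- (norm z)\<^sup>2 / (4 * r)) - exp (- (norm z')\<^sup>2 / (4 * r))\<bar>"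
    unfolding heat_def right_diff_distrib[symmetric] abs_mult by simp
  also have "\<dots> \<le> (4 * pi * e) powr (- (real DIM('a) / 2)) * (norm (z - z') / sqrt e)"
    using assms by (intro mult_mono 1 powr_mono2') auto
  finally show ?thesis by simp
qed

lemma nn_integral_lborel_scale:
  fixes f :: "'a::euclidean_space \<Rightarrow> ennreal"
  assumes [measurable]: "f \<in> borel_measurable borel" and c: "c > 0"
  shows "(\<integral>\<^sup>+x. f x \<partial>lborel) = ennreal (c ^ DIM('a)) * (\<integral>\<^sup>+x. f (c *\<^sub>R x) \<partial>lborel)"
  using c by (subst lborel_affine[of c 0]) (auto simp: nn_integral_density nn_integral_distr nn_integral_cmult)

lemma nn_integral_lborel_reflect:
  fixes f :: "'a::euclidean_space \<Rightarrow> ennreal"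
  assumes [measurable]: "f \<in> borel_measurable borel"
  shows "(\<integral>\<^sup>+y. f (x - y) \<partial>lborel) = (\<integral>\<^sup>+y. f y \<partial>lborel)"
  by (subst (2) lborel_affine[of "-1" x]) (auto simp: density_1 nn_integral_distr)

text \<open>The value at \<open>0\<close> is set to infinity so that the function dominates the weight below also on the hyperplane
  where the coordinate vanishes.\<close>

lemma space_weight_1d_finite:
  "(\<integral>\<^sup>+t. (if t = 0 then top else ennreal (\<bar>t\<bar> powr (- 1 / 2) * exp (- t\<^sup>2 / 4))) \<partial>lborel) < (top::ennreal)"
proof -
  let ?g = "\<lambda>t. ennreal (indicator {0<..} t * (t powr (1 / 2 - 1) * exp (- (1 / 4) * t)))"
  have "(\<integral>\<^sup>+t. (if t = 0 then top else ennreal (\<bar>t\<bar> powr (- 1 / 2) * exp (- t\<^sup>2 / 4))) \<partial>lborel) \<le>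
     (\<integral>\<^sup>+t. ennreal (exp (1 / 16)) * (?g t + ?g (0 + (- 1) * t)) \<partial>lborel)"
  proof (rule nn_integral_mono_AE)
    have "AE t in lborel. t \<noteq> (0::real)" by (rule AE_lborel_singleton)
    then show "AE t in lborel. (if t = 0 then top else ennreal (\<bar>t\<bar> powr (- 1 / 2) * exp (- t\<^sup>2 / 4))) \<le> ennreal (exp (1 / 16)) * (?g t + ?g (0 + (- 1) * t))"
    proof eventually_elim
      fix t :: real assume t: "t \<noteq> 0"
      have "0 \<le> (\<bar>t\<bar> - 1 / 2)\<^sup>2" by simp
      also have "\<dots> = t\<^sup>2 - \<bar>t\<bar> + 1 / 4" by (simp add: power2_diff field_simps power2_eq_square)
      finally have "exp (- t\<^sup>2 / 4) \<le> exp (1 / 16 + - (1 / 4) * \<bar>t\<bar>)" by simp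
      then have "exp (- t\<^sup>2 / 4) \<le> exp (1 / 16) * exp (- (1 / 4) * \<bar>t\<bar>)" by (simp only: exp_add)
      then have "\<bar>t\<bar> powr (- 1 / 2) * exp (- t\<^sup>2 / 4) \<le> exp (1 / 16) * (\<bar>t\<bar> powr (- 1 / 2) * exp (- (1 / 4) * \<bar>t\<bar>))"
        by (subst mult.left_commute) (rule mult_left_mono, auto)
      then have "ennreal (\<bar>t\<bar> powr (- 1 / 2) * exp (- t\<^sup>2 / 4)) \<le> ennreal (exp (1 / 16)) * ennreal (\<bar>t\<bar> powr (- 1 / 2) * exp (- (1 / 4) * \<bar>t\<bar>))"
        by (subst ennreal_mult[symmetric]) (auto intro!: ennreal_leI)
      also have "ennreal (\<bar>t\<bar> powr (- 1 / 2) * exp (- (1 / 4) * \<bar>t\<bar>)) = ?g t + ?g (0 + (- 1) * t)"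
        using t by (auto simp: indicator_def abs_if)
      finally show "(if t = 0 then top else ennreal (\<bar>t\<bar> powr (- 1 / 2) * exp (- t\<^sup>2 / 4))) \<le> ennreal (exp (1 / 16)) * (?g t + ?g (0 + (- 1) * t))"
        using t by simp
    qed
  qed
  also have "\<dots> = ennreal (exp (1 / 16)) * ((\<integral>\<^sup>+t. ?g t \<partial>lborel) + (\<integral>\<^sup>+t. ?g (0 + (- 1) * t) \<partial>lborel))"
    by (subst nn_integral_cmult, simp, subst nn_integral_add) auto
  also have "(\<integral>\<^sup>+t. ?g (0 + (- 1) * t) \<partial>lborel) = (\<integral>\<^sup>+t. ?g t \<partial>lborel)"
    using nn_integral_real_affine[of ?g "-1" 0] by simp
  also have "(\<integral>\<^sup>+t. ?g t \<partial>lborel) = ennreal (Gamma (1 / 2) * (1 / 4) powr (- (1 / 2)))"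
    by (rule nn_integral_power_exp) auto
  finally show ?thesis by (auto intro: le_less_trans simp: ennreal_mult_less_top)
qed

text \<open>Without polar coordinates: \<open>norm z\<close> is at least one coordinate, so the singularity can be moved to that coordinate
  and the integral factorises. The exponent \<open>1 / 2\<close> keeps the one-dimensional singularity integrable.\<close>

lemma space_weight_finite:
  "(\<integral>\<^sup>+z. ennreal (norm z powr (- 1 / 2) * exp (- (norm z)\<^sup>2 / 4)) \<partial>(lborel::'a::euclidean_space measure)) < top"
proof -
  obtain b0 :: 'a where b0: "b0 \<in> Basis" using nonempty_Basis by blast
  define h where "h t = (if t = 0 then top else ennreal (\<bar>t\<bar> powr (- 1 / 2) * exp (- t\<^sup>2 / 4)))" for t :: real
  define f where "f c = (if c = b0 then h else (\<lambda>t. ennreal (exp (- t\<^sup>2 / 4))))" for c :: 'a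
  have [measurable]: "h \<in> borel_measurable borel" unfolding h_def by measurable
  have "(\<integral>\<^sup>+z. ennreal (norm z powr (- 1 / 2) * exp (- (norm z)\<^sup>2 / 4)) \<partial>(lborel::'a measure)) \<le> (\<integral>\<^sup>+z. (\<Prod>c\<in>Basis. f c (z \<bullet> c)) \<partial>(lborel::'a measure))"
  proof (rule nn_integral_mono)
    fix z :: 'a
    have "(\<Prod>c\<in>Basis. f c (z \<bullet> c)) = h (z \<bullet> b0) * (\<Prod>c\<in>Basis - {b0}. ennreal (exp (- (z \<bullet> c)\<^sup>2 / 4)))"
      using b0 by (subst prod.remove[of _ b0]) (auto simp: f_def intro!: prod.cong)
    also have "(\<Prod>c\<in>Basis - {b0}. ennreal (exp (- (z \<bullet> c)\<^sup>2 / 4))) = ennreal (exp (\<Sum>c\<in>Basis - {b0}. - (z \<bullet> c)\<^sup>2 / 4))"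
      by (subst prod_ennreal) (auto simp: exp_sum)
    finally have p: "(\<Prod>c\<in>Basis. f c (z \<bullet> c)) = h (z \<bullet> b0) * ennreal (exp (\<Sum>c\<in>Basis - {b0}. - (z \<bullet> c)\<^sup>2 / 4))" .
    show "ennreal (norm z powr (- 1 / 2) * exp (- (norm z)\<^sup>2 / 4)) \<le> (\<Prod>c\<in>Basis. f c (z \<bullet> c))"
    proof (cases "z \<bullet> b0 = 0")
      case True
      then show ?thesis unfolding p by (simp add: h_def ennreal_top_mult ennreal_eq_0_iff)
    next
      case False
      have "- (norm z)\<^sup>2 / 4 = - (z \<bullet> b0)\<^sup>2 / 4 + (\<Sum>c\<in>Basis - {b0}. - (z \<bullet> c)\<^sup>2 / 4)"
        unfolding norm_sq_sum using b0 by (subst sum.remove[of _ b0]) (auto simp: sum_negf sum_divide_distrib[symmetric] add_divide_distrib)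
      then have e: "exp (- (norm z)\<^sup>2 / 4) = exp (- (z \<bullet> b0)\<^sup>2 / 4) * exp (\<Sum>c\<in>Basis - {b0}. - (z \<bullet> c)\<^sup>2 / 4)"
        by (simp only: exp_add)
      have "norm z powr (- 1 / 2) \<le> \<bar>z \<bullet> b0\<bar> powr (- 1 / 2)"
        using False Basis_le_norm[OF b0, of z] by (intro powr_mono2') auto
      then have "norm z powr (- 1 / 2) * exp (- (norm z)\<^sup>2 / 4) \<le> (\<bar>z \<bullet> b0\<bar> powr (- 1 / 2) * exp (- (z \<bullet> b0)\<^sup>2 / 4)) * exp (\<Sum>c\<in>Basis - {b0}. - (z \<bullet> c)\<^sup>2 / 4)"
        unfolding e mult.assoc by (rule mult_right_mono) auto
      then show ?thesis unfolding p using False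
        by (simp add: h_def ennreal_mult[symmetric] ennreal_leI)
    qed
  qed
  also have "\<dots> = (\<Prod>c\<in>(Basis::'a set). \<integral>\<^sup>+t. f c t \<partial>lborel)"
    by (rule nn_integral_lborel_prod) (auto simp: f_def)
  also have "\<dots> < top"
  proof -
    have "(\<integral>\<^sup>+t. ennreal (exp (- t\<^sup>2 / 4)) \<partial>lborel) < top"
    proof -
      have "integrable lborel (\<lambda>t. of_real (exp (- (1/4) * t\<^sup>2)) * iexp (0 * t))" by (rule gauss_fourier_1d) simp
      then have "integrable lborel (\<lambda>t. complex_of_real (exp (- t\<^sup>2 / 4)))" by (simp add: mult.commute)
      then have "integrable lborel (\<lambda>t::real. exp (- t\<^sup>2 / 4))" by (simp only: complex_of_real_integrable_eq)
      then show ?thesis by (simp add: integrable_iff_bounded)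
    qed
    then have "(\<integral>\<^sup>+t. f c t \<partial>lborel) < top" for c using space_weight_1d_finite by (simp add: f_def h_def[abs_def])
    then show ?thesis by (simp add: ennreal_prod_eq_top less_top[symmetric])
  qed
  finally show ?thesis .
qed

text \<open>Scaling by \<open>sqrt r\<close>.\<close>

lemma space_weight:
  obtains C where "C > 0" "\<And>r. r > 0 \<Longrightarrow>
    (\<integral>\<^sup>+z. ennreal (norm z powr (- 1 / 2) * exp (- (norm z)\<^sup>2 / (4 * r))) \<partial>(lborel::'a::euclidean_space measure)) \<le> ennreal (C * r powr (real DIM('a) / 2 - 1 / 4))"
proof -
  let ?I = "(\<integral>\<^sup>+z. ennreal (norm z powr (- 1 / 2) * exp (- (norm z)\<^sup>2 / 4)) \<partial>(lborel::'a measure))"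
  have I: "?I = ennreal (enn2real ?I)" using space_weight_finite[where 'a = 'a] by simp
  define C where "C = enn2real ?I + 1"
  show ?thesis
  proof (rule that[of C])
    show "C > 0" unfolding C_def by (simp add: add_nonneg_pos)
    fix r :: real assume r: "r > 0"
    have sq: "sqrt r ^ DIM('a) = r powr (real DIM('a) / 2)"
      using r by (simp add: powr_half_sqrt[symmetric] powr_realpow[symmetric] powr_powr)
    have "(\<integral>\<^sup>+z. ennreal (norm z powr (- 1 / 2) * exp (- (norm z)\<^sup>2 / (4 * r))) \<partial>(lborel::'a measure)) =
      ennreal (sqrt r ^ DIM('a)) * (\<integral>\<^sup>+z. ennreal (norm (sqrt r *\<^sub>R z) powr (- 1 / 2) * exp (- (norm (sqrt r *\<^sub>R z))\<^sup>2 / (4 * r))) \<partial>(lborel::'a measure))"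
      using r by (intro nn_integral_lborel_scale) auto
    also have "(\<integral>\<^sup>+z. ennreal (norm (sqrt r *\<^sub>R z) powr (- 1 / 2) * exp (- (norm (sqrt r *\<^sub>R z))\<^sup>2 / (4 * r))) \<partial>(lborel::'a measure)) =
      (\<integral>\<^sup>+z. ennreal (r powr (- 1 / 4)) * ennreal (norm z powr (- 1 / 2) * exp (- (norm z)\<^sup>2 / 4)) \<partial>(lborel::'a measure))"
    proof (intro nn_integral_cong)
      fix z :: 'a
      have "(norm (sqrt r *\<^sub>R z)) powr (- 1 / 2) = r powr (- 1 / 4) * norm z powr (- 1 / 2)"
        using r by (simp add: powr_mult powr_half_sqrt[symmetric] powr_powr)
      moreover have "- (norm (sqrt r *\<^sub>R z))\<^sup>2 / (4 * r) = - (norm z)\<^sup>2 / 4"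
        using r by (simp add: power_mult_distrib)
      ultimately show "ennreal (norm (sqrt r *\<^sub>R z) powr (- 1 / 2) * exp (- (norm (sqrt r *\<^sub>R z))\<^sup>2 / (4 * r))) = ennreal (r powr (- 1 / 4)) * ennreal (norm z powr (- 1 / 2) * exp (- (norm z)\<^sup>2 / 4))"
        by (simp only: ennreal_mult[symmetric] powr_ge_zero exp_ge_zero mult_nonneg_nonneg mult.assoc)
    qed
    also have "\<dots> = ennreal (r powr (- 1 / 4)) * ?I" by (rule nn_integral_cmult) simp
    also have "ennreal (sqrt r ^ DIM('a)) * (ennreal (r powr (- 1 / 4)) * ?I) = ennreal (r powr (real DIM('a) / 2 - 1 / 4) * enn2real ?I)"
    proof -
      have "r powr (real DIM('a) / 2 - 1 / 4) = r powr (real DIM('a) / 2) * r powr (- 1 / 4)"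
        unfolding powr_add[symmetric] by simp
      then show ?thesis unfolding sq by (subst I) (simp add: ennreal_mult[symmetric] mult.assoc)
    qed
    also have "\<dots> \<le> ennreal (C * r powr (real DIM('a) / 2 - 1 / 4))"
      by (intro ennreal_leI) (simp add: C_def algebra_simps)
    finally show "(\<integral>\<^sup>+z. ennreal (norm z powr (- 1 / 2) * exp (- (norm z)\<^sup>2 / (4 * r))) \<partial>(lborel::'a measure)) \<le> ennreal (C * r powr (real DIM('a) / 2 - 1 / 4))" .
  qed
qed

text \<open>For \<open>r \<le> R\<close> the exponential is at most a multiple of \<open>(r / R) powr (d + 1)\<close>, for \<open>r \<ge> R\<close> it is at most \<open>1\<close>; both
  pieces integrate to a multiple of \<open>R powr (- d)\<close>.\<close>

lemma time_weight:
  assumes d: "d > (0::real)"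
  obtains C where "C > 0" "\<And>R. R > 0 \<Longrightarrow>
    (\<integral>\<^sup>+r. ennreal (r powr (- d - 1) * exp (- R / (4 * r))) * indicator {0<..} r \<partial>lborel) \<le> ennreal (C * R powr (- d))"
proof -
  define D where "D = (4 * (d + 1)) powr (d + 1)"
  have D: "D > 0" using d by (simp add: D_def)
  show ?thesis
  proof (rule that[of "D + 1 / d"])
    show "D + 1 / d > 0" using D d by (simp add: add_pos_pos)
    fix R :: real assume R: "R > 0"
    have pt: "ennreal (r powr (- d - 1) * exp (- R / (4 * r))) * indicator {0<..} r \<le>
      ennreal (D * R powr (- (d + 1))) * indicator {0..R} r + ennreal (r powr (- d - 1)) * indicator {R..} r" for r
    proof (cases "r > 0")
      case r: True
      have A: "r powr (- d - 1) * exp (- R / (4 * r)) \<le> D * R powr (- (d + 1))"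
      proof -
        define u where "u = R / r"
        have u: "u > 0" using R r by (simp add: u_def)
        have "u / (4 * (d + 1)) \<le> exp (u / (4 * (d + 1)))" using exp_ge_add_one_self[of "u / (4 * (d + 1))"] by linarith
        then have "(u / (4 * (d + 1))) powr (d + 1) \<le> exp (u / (4 * (d + 1))) powr (d + 1)"
          using u d by (intro powr_mono2) auto
        also have "\<dots> = exp (u / 4)"
        proof -
          have "(d + 1) * (u / (4 * (d + 1))) = u / 4" using d by (simp add: field_simps)
          then show ?thesis by (simp only: powr_def) simp
        qed
        finally have "u powr (d + 1) \<le> D * exp (u / 4)"
          using u d by (simp add: D_def powr_divide pos_divide_le_eq mult.commute)
        then have "u powr (d + 1) * exp (- u / 4) \<le> D * exp (u / 4) * exp (- u / 4)" by (intro mult_right_mono) auto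
        then have "u powr (d + 1) * exp (- u / 4) \<le> D" by (simp add: mult.assoc exp_add[symmetric])
        then have "u powr (d + 1) * exp (- u / 4) * R powr (- (d + 1)) \<le> D * R powr (- (d + 1))" by (intro mult_right_mono) auto
        moreover have "u powr (d + 1) * R powr (- (d + 1)) = r powr (- d - 1)"
        proof -
          have "u powr (d + 1) * R powr (- (d + 1)) = exp ((d + 1) * ln u - (d + 1) * ln R)"
            using u R by (simp add: powr_def exp_add[symmetric] algebra_simps)
          also have "(d + 1) * ln u - (d + 1) * ln R = (- d - 1) * ln r"
            using R r by (simp add: u_def ln_div algebra_simps)
          finally show ?thesis using r by (simp add: powr_def)
        qed
        moreover have "- u / 4 = - R / (4 * r)" by (simp add: u_def)
        ultimately show ?thesis by (metis mult.commute mult.assoc)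
      qed
      have B: "r powr (- d - 1) * exp (- R / (4 * r)) \<le> r powr (- d - 1)"
        using R r by (intro mult_left_le) auto
      show ?thesis
      proof (cases "r \<le> R")
        case True
        then have "ennreal (r powr (- d - 1) * exp (- R / (4 * r))) * indicator {0<..} r \<le> ennreal (D * R powr (- (d + 1))) * indicator {0..R} r"
          using A r by (simp add: ennreal_leI)
        then show ?thesis by (rule order_trans) simp
      next
        case False
        then have "ennreal (r powr (- d - 1) * exp (- R / (4 * r))) * indicator {0<..} r \<le> ennreal (r powr (- d - 1)) * indicator {R..} r"
          using B r by (simp add: ennreal_leI)
        then show ?thesis by (rule order_trans) simp
      qed
    qed simp
    have "(\<integral>\<^sup>+r. ennreal (r powr (- d - 1) * exp (- R / (4 * r))) * indicator {0<..} r \<partial>lborel) \<le>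
      (\<integral>\<^sup>+r. ennreal (D * R powr (- (d + 1))) * indicator {0..R} r + ennreal (r powr (- d - 1)) * indicator {R..} r \<partial>lborel)"
      by (intro nn_integral_mono pt)
    also have "\<dots> = ennreal (D * R powr (- (d + 1))) * ennreal R + (\<integral>\<^sup>+r. ennreal (r powr (- d - 1)) * indicator {R..} r \<partial>lborel)"
      using R by (subst nn_integral_add, simp, simp, subst nn_integral_cmult, simp) simp
    also have "(\<integral>\<^sup>+r. ennreal (r powr (- d - 1)) * indicator {R..} r \<partial>lborel) = ennreal (0 - (- (R powr (- d) / d)))"
    proof (rule nn_integral_FTC_atLeast)
      show "((\<lambda>r. - (r powr (- d) / d)) has_real_derivative r powr (- d - 1)) (at r)" if "R \<le> r" for r
        using R that d by (auto intro!: derivative_eq_intros)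
      have "((\<lambda>r. - (r powr (- d) / d)) \<longlongrightarrow> - (0 / d)) at_top"
        using d by (intro tendsto_intros tendsto_neg_powr filterlim_ident) auto
      then show "((\<lambda>r. - (r powr (- d) / d)) \<longlongrightarrow> 0) at_top" by simp
    qed auto
    also have "ennreal (D * R powr (- (d + 1))) * ennreal R + ennreal (0 - (- (R powr (- d) / d))) = ennreal ((D + 1 / d) * R powr (- d))"
    proof -
      have "R powr (- (d + 1)) * R = R powr (- d)"
      proof -
        have "R powr (- (d + 1)) * R powr 1 = R powr (- d)" unfolding powr_add[symmetric] by simp
        then show ?thesis using R by simp
      qed
      then show ?thesis using D R d
        by (simp add: ennreal_mult[symmetric] ennreal_plus[symmetric] mult.assoc distrib_right del: ennreal_plus)
    qed
    finally show "(\<integral>\<^sup>+r. ennreal (r powr (- d - 1) * exp (- R / (4 * r))) * indicator {0<..} r \<partial>lborel) \<le> ennreal ((D + 1 / d) * R powr (- d))" .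
  qed
qed

text \<open>The primitive \<open>ln (1 / r) powr (1 - q) / (q - 1)\<close> vanishes at \<open>0\<close> because \<open>q > 1\<close>.\<close>

lemma log_weight:
  assumes e: "0 < e" "e < (1::real)" and q: "q > 1"
  shows "(\<integral>\<^sup>+r. ennreal (ln (1 / r) powr (- q) / r) * indicator {0<..<e} r \<partial>lborel) = ennreal (ln (1 / e) powr (1 - q) / (q - 1))"
proof -
  let ?F = "\<lambda>r. ln (1 / r) powr (1 - q) / (q - 1)"
  let ?f = "\<lambda>r. ln (1 / r) powr (- q) / r"
  have deriv: "(?F has_real_derivative ?f r) (at r)" if "0 < r" "r < e" for r
  proof -
    have l: "ln (1 / r) > 0" using that e by simp
    have "((\<lambda>r. ln (1 / r)) has_real_derivative - (1 / r)) (at r)"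
      using that by (auto intro!: derivative_eq_intros simp: field_simps power2_eq_square)
    then have "((\<lambda>r. ln (1 / r) powr (1 - q)) has_real_derivative ((1 - q) * ln (1 / r) powr (1 - q - 1) * (- (1 / r)))) (at r)"
      by (rule DERIV_chain2[where f = "\<lambda>y. y powr (1 - q)" and g = "\<lambda>r. ln (1 / r)", OF has_real_derivative_powr[OF l]])
    then have "(?F has_real_derivative ((1 - q) * ln (1 / r) powr (1 - q - 1) * (- (1 / r))) / (q - 1)) (at r)"
      by (rule DERIV_cdivide)
    moreover have "((1 - q) * ln (1 / r) powr (1 - q - 1) * (- (1 / r))) / (q - 1) = ?f r"
    proof -
      have "(1 - q) * X * (- (1 / r)) = (q - 1) * (X / r)" for X
        by (simp add: algebra_simps diff_divide_distrib)
      moreover have "(q - 1) * (X / r) / (q - 1) = X / r" for X using q by simp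
      moreover have "1 - q - 1 = - q" by simp
      ultimately show ?thesis by (simp only:)
    qed
    ultimately show ?thesis by (simp only:)
  qed
  have A: "((?F \<circ> real_of_ereal) \<longlongrightarrow> 0) (at_right (ereal 0))"
  proof -
    have "(?F \<longlongrightarrow> 0) (at_right 0)"
    proof -
      have "filterlim (\<lambda>r::real. ln (1 / r)) at_top (at_right 0)" by real_asymp
      then have "((\<lambda>r. ln (1 / r) powr (- (q - 1)) / (q - 1)) \<longlongrightarrow> 0 / (q - 1)) (at_right 0)"
        using q by (intro tendsto_intros tendsto_neg_powr) auto
      then show ?thesis by simp
    qed
    then show ?thesis by (simp only: ereal_tendsto_simps)
  qed
  have B: "((?F \<circ> real_of_ereal) \<longlongrightarrow> ?F e) (at_left (ereal e))"
  proof -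
    have "isCont ?F e" using e q by (intro continuous_intros) auto
    then have "(?F \<longlongrightarrow> ?F e) (at_left e)" by (simp add: isCont_def filterlim_at_split)
    then show ?thesis by (simp only: ereal_tendsto_simps)
  qed
  have nn: "?f r \<ge> 0" if "0 < r" for r using that by simp
  have cont: "isCont ?f r" if "0 < r" "r < e" for r
  proof -
    have "ln (1 / r) > 0" using that e by simp
    then show ?thesis using that by (intro continuous_intros) auto
  qed
  have FTC: "set_integrable lborel (einterval (ereal 0) (ereal e)) ?f" "(LBINT r=ereal 0..ereal e. ?f r) = ?F e - 0"
    by (rule interval_integral_FTC_nonneg[of "ereal 0" "ereal e" ?F ?f, OF _ _ _ _ A B]; use e deriv cont nn in auto)+
  have "integrable lborel (\<lambda>r. indicator {0<..<e} r *\<^sub>R ?f r)"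
    using FTC(1) by (simp add: set_integrable_def einterval_def greaterThanLessThan_def greaterThan_def lessThan_def Int_def)
  then have "(\<integral>\<^sup>+r. ennreal (indicator {0<..<e} r *\<^sub>R ?f r) \<partial>lborel) = ennreal (LINT r|lborel. indicator {0<..<e} r *\<^sub>R ?f r)"
    using nn by (intro nn_integral_eq_integral) (auto simp: indicator_def)
  also have "(LINT r|lborel. indicator {0<..<e} r *\<^sub>R ?f r) = ?F e"
    using FTC(2) e by (simp add: interval_lebesgue_integral_def set_lebesgue_integral_def einterval_def greaterThanLessThan_def greaterThan_def lessThan_def Int_def)
  also have "(\<integral>\<^sup>+r. ennreal (indicator {0<..<e} r *\<^sub>R ?f r) \<partial>lborel) = (\<integral>\<^sup>+r. ennreal (?f r) * indicator {0<..<e} r \<partial>lborel)"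
    by (intro nn_integral_cong) (auto simp: indicator_def)
  finally show ?thesis .
qed

section \<open>The contribution of small times\<close>

text \<open>A real bound in place of the norm carries the finiteness of the integral with it, and scales correctly also when
  the norm vanishes.\<close>

definition Lp_bound :: "real \<Rightarrow> ('a::euclidean_space \<Rightarrow> real) \<Rightarrow> real \<Rightarrow> bool" where
  "Lp_bound p F N \<longleftrightarrow> F \<in> borel_measurable borel \<and> (\<forall>y. F y \<ge> 0) \<and> N \<ge> 0 \<and>
     (\<integral>\<^sup>+y. ennreal (F y powr p) \<partial>lborel) \<le> ennreal (N powr p)"

text \<open>The two factors are the integrands of Hoelder's inequality with exponents \<open>q\<close> and \<open>p\<close>, up to the logarithm and the
  density. The relation \<open>DIM('a) = 2 * s * p\<close> makes the powers of \<open>r\<close> match, and the balancing powers of \<open>norm z\<close> and \<open>r\<close>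
  make both factors integrable in the variable that is integrated first.\<close>

lemma heat_split:
  fixes z :: "'a::euclidean_space"
  assumes pq: "p > 1" "q > 1" "1 / p + 1 / q = 1" and n: "real DIM('a) = 2 * s * p"
    and r: "r > 0" and z: "z \<noteq> 0"
  shows "r powr (s - 1) * heat r z = (4 * pi) powr (- (real DIM('a) / 2)) *
     ((r powr (- 1 / q - real DIM('a) / (2 * q) + 1 / (4 * q)) * norm z powr (- 1 / (2 * q)) * exp (- (norm z)\<^sup>2 / (4 * r) / q)) *
      (r powr (- 1 / p - 1 / (4 * q)) * norm z powr (1 / (2 * q)) * exp (- (norm z)\<^sup>2 / (4 * r) / p)))"
proof -
  have e: "exp (- (norm z)\<^sup>2 / (4 * r)) = exp (- (norm z)\<^sup>2 / (4 * r) / q) * exp (- (norm z)\<^sup>2 / (4 * r) / p)"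
  proof -
    have "- (norm z)\<^sup>2 / (4 * r) = (- (norm z)\<^sup>2 / (4 * r)) * (1 / p + 1 / q)" using pq by simp
    also have "\<dots> = - (norm z)\<^sup>2 / (4 * r) / q + - (norm z)\<^sup>2 / (4 * r) / p" by (simp add: distrib_left)
    finally show ?thesis unfolding exp_add[symmetric] by (rule arg_cong)
  qed
  have z1: "norm z powr (- 1 / (2 * q)) * norm z powr (1 / (2 * q)) = 1"
    using z by (simp add: powr_add[symmetric])
  have ex: "(- 1 / q - real DIM('a) / (2 * q) + 1 / (4 * q)) + (- 1 / p - 1 / (4 * q)) = (s - 1) + - (real DIM('a) / 2)"
  proof -
    define D Q where "D = real DIM('a) / 2" and "Q = 1 / q"
    have "s = D * (1 / p)" using n pq by (simp add: D_def)
    moreover have P: "1 / p = 1 - Q" using pq by (simp add: Q_def)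
    ultimately have s: "s = D * (1 - Q)" by simp
    have "real DIM('a) / (2 * q) = D * Q" "- 1 / q = - Q" "1 / (4 * q) = Q / 4" "- 1 / p = - (1 - Q)"
      using P by (simp_all add: D_def Q_def)
    then show ?thesis unfolding s D_def[symmetric] by (simp add: algebra_simps)
  qed
  have r1: "r powr (- 1 / q - real DIM('a) / (2 * q) + 1 / (4 * q)) * r powr (- 1 / p - 1 / (4 * q)) = r powr (s - 1) * r powr (- (real DIM('a) / 2))"
    unfolding powr_add[symmetric] ex ..
  have h: "heat r z = (4 * pi) powr (- (real DIM('a) / 2)) * r powr (- (real DIM('a) / 2)) * exp (- (norm z)\<^sup>2 / (4 * r))"
    unfolding heat_def using r by (simp add: powr_mult)
  have "(r powr (- 1 / q - real DIM('a) / (2 * q) + 1 / (4 * q)) * norm z powr (- 1 / (2 * q)) * exp (- (norm z)\<^sup>2 / (4 * r) / q)) *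
      (r powr (- 1 / p - 1 / (4 * q)) * norm z powr (1 / (2 * q)) * exp (- (norm z)\<^sup>2 / (4 * r) / p)) =
      (r powr (- 1 / q - real DIM('a) / (2 * q) + 1 / (4 * q)) * r powr (- 1 / p - 1 / (4 * q))) *
      (norm z powr (- 1 / (2 * q)) * norm z powr (1 / (2 * q))) *
      (exp (- (norm z)\<^sup>2 / (4 * r) / q) * exp (- (norm z)\<^sup>2 / (4 * r) / p))"
    by (simp only: mult_ac)
  then show ?thesis unfolding z1 r1 e[symmetric] h by (simp only: mult_ac mult_1_left mult_1_right)
qed

lemma exp_powr_real: "exp x powr a = exp (x * (a::real))"
  by (simp add: powr_def mult.commute)

text \<open>Hoelder's inequality on the product of time and space. In the \<open>q\<close>-th power of the first factor the space integral
  is computed first (\<open>space_weight\<close>), which leaves the convergent integral of \<open>ln (1 / r) powr (- q) / r\<close>. In the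
  \<open>p\<close>-th power of the second factor the time integral is computed first (\<open>time_weight\<close>), which leaves
  the \<open>p\<close>-th power of \<open>F\<close>.\<close>

lemma small_time_bound:
  assumes pq: "p > 1" "q > 1" "1 / p + 1 / q = 1" and n: "real DIM('a::euclidean_space) = 2 * s * p" and s: "s > 0"
    and lam: "lam > 1"
  obtains C where "C > 0" "\<And>e F N x. 0 < e \<Longrightarrow> e < 1 \<Longrightarrow> Lp_bound p (F :: 'a \<Rightarrow> real) N \<Longrightarrow>
     (\<integral>\<^sup>+r. indicator {..<e} r * (\<integral>\<^sup>+y. ennreal (heat r (x - y) * F y) \<partial>lborel) \<partial>heat_mixture lam s) \<le>
       ennreal (C * ln (1 / e) powr ((1 - q) / q) * N)"
proof -
  obtain C1 where C1: "C1 > 0" "\<And>r. r > 0 \<Longrightarrow>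
    (\<integral>\<^sup>+z. ennreal (norm z powr (- 1 / 2) * exp (- (norm z)\<^sup>2 / (4 * r))) \<partial>(lborel::'a measure)) \<le> ennreal (C1 * r powr (real DIM('a) / 2 - 1 / 4))"
    using space_weight by blast
  \<comment> \<open>The exponent of the time weight that the split in \<open>heat_split\<close> leaves in the \<open>p\<close>-th power of its second factor.\<close>
  define d where "d = p / (4 * q)"
  have d: "d > 0" using pq by (simp add: d_def)
  obtain C2 where C2: "C2 > 0" "\<And>R. R > 0 \<Longrightarrow>
    (\<integral>\<^sup>+r. ennreal (r powr (- d - 1) * exp (- R / (4 * r))) * indicator {0<..} r \<partial>lborel) \<le> ennreal (C2 * R powr (- d))"
    using time_weight[OF d] by blast
  define c0 where "c0 = exp 2 * (4 * pi) powr (- (real DIM('a) / 2))"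
  have c0: "c0 > 0" by (simp add: c0_def)
  define C where "C = c0 * (C1 / (q - 1)) powr (1 / q) * C2 powr (1 / p)"
  show ?thesis
  proof (rule that[of C])
    show "C > 0" using c0 C1 C2 pq by (simp add: C_def)
    fix e N :: real and F :: "'a \<Rightarrow> real" and x :: 'a
    assume e: "0 < e" "e < 1" and F: "Lp_bound p F N"
    have [measurable]: "F \<in> borel_measurable borel" and Fnn: "\<And>y. F y \<ge> 0" and N: "N \<ge> 0"
      and FN: "(\<integral>\<^sup>+y. ennreal (F y powr p) \<partial>lborel) \<le> ennreal (N powr p)"
      using F by (auto simp: Lp_bound_def)
    define u where "u r y = (if 0 < r \<and> r < e then ln (1 / r) powr (- 1) * (r powr (- 1 / q - real DIM('a) / (2 * q) + 1 / (4 * q)) * norm (x - y) powr (- 1 / (2 * q)) * exp (- (norm (x - y))\<^sup>2 / (4 * r) / q)) else 0)" for r y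
    define w where "w r y = (if 0 < r \<and> r < e then (r powr (- 1 / p - 1 / (4 * q)) * norm (x - y) powr (1 / (2 * q)) * exp (- (norm (x - y))\<^sup>2 / (4 * r) / p)) * F y else 0)" for r y
    have [measurable]: "case_prod u \<in> borel_measurable (borel \<Otimes>\<^sub>M borel)" "case_prod w \<in> borel_measurable (borel \<Otimes>\<^sub>M borel)"
      unfolding u_def w_def case_prod_unfold by measurable
    have unn: "u r y \<ge> 0" and wnn: "w r y \<ge> 0" for r y
      using Fnn by (auto simp: u_def w_def)
    have "(\<integral>\<^sup>+r. indicator {..<e} r * (\<integral>\<^sup>+y. ennreal (heat r (x - y) * F y) \<partial>lborel) \<partial>heat_mixture lam s) =
       (\<integral>\<^sup>+r. (ennreal (indicator {0<..} r * exp (- lam * r)) * mixture_density s r) * (indicator {..<e} r * (\<integral>\<^sup>+y. ennreal (heat r (x - y) * F y) \<partial>lborel)) \<partial>lborel)"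
      unfolding heat_mixture_def by (subst nn_integral_density) auto
    also have "\<dots> \<le> (\<integral>\<^sup>+r. (\<integral>\<^sup>+y. ennreal c0 * ennreal (u r y * w r y) \<partial>lborel) \<partial>lborel)"
    proof (rule nn_integral_mono)
      fix r :: real
      show "(ennreal (indicator {0<..} r * exp (- lam * r)) * mixture_density s r) * (indicator {..<e} r * (\<integral>\<^sup>+y. ennreal (heat r (x - y) * F y) \<partial>lborel)) \<le> (\<integral>\<^sup>+y. ennreal c0 * ennreal (u r y * w r y) \<partial>lborel)"
      proof (cases "0 < r \<and> r < e")
        case True
        then have r: "0 < r" "r < 1" using e by auto
        have l: "ln (1 / r) > 0" using r by simp
        have W: "ennreal (indicator {0<..} r * exp (- lam * r)) * mixture_density s r \<le> ennreal (exp 2 * (r powr (s - 1) * ln (1 / r) powr (- 1)))"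
        proof -
          have "ennreal (indicator {0<..} r * exp (- lam * r)) * mixture_density s r \<le> ennreal 1 * ennreal (exp 2 * (r powr (s - 1) / ln (1 / r)))"
            using r lam by (intro mult_mono mixture_density_small[OF s r] ennreal_leI) auto
          then show ?thesis using l by (simp add: powr_minus divide_inverse)
        qed
        have "(ennreal (indicator {0<..} r * exp (- lam * r)) * mixture_density s r) * (indicator {..<e} r * (\<integral>\<^sup>+y. ennreal (heat r (x - y) * F y) \<partial>lborel)) \<le>
          ennreal (exp 2 * (r powr (s - 1) * ln (1 / r) powr (- 1))) * (\<integral>\<^sup>+y. ennreal (heat r (x - y) * F y) \<partial>lborel)"
          using True by (intro mult_mono W) auto
        also have "\<dots> = (\<integral>\<^sup>+y. ennreal (exp 2 * (r powr (s - 1) * ln (1 / r) powr (- 1))) * ennreal (heat r (x - y) * F y) \<partial>lborel)"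
          by (rule nn_integral_cmult[symmetric]) simp
        also have "\<dots> = (\<integral>\<^sup>+y. ennreal c0 * ennreal (u r y * w r y) \<partial>lborel)"
        proof (rule nn_integral_cong_AE)
          have "AE y in lborel. y \<noteq> x" by (rule AE_lborel_singleton)
          then show "AE y in lborel. ennreal (exp 2 * (r powr (s - 1) * ln (1 / r) powr (- 1))) * ennreal (heat r (x - y) * F y) = ennreal c0 * ennreal (u r y * w r y)"
          proof eventually_elim
            fix y assume "y \<noteq> x"
            then have z: "x - y \<noteq> 0" by simp
            have "(exp 2 * (r powr (s - 1) * ln (1 / r) powr (- 1))) * (heat r (x - y) * F y) = (exp 2 * ln (1 / r) powr (- 1) * F y) * (r powr (s - 1) * heat r (x - y))"
              by (simp only: mult_ac)
            also have "\<dots> = c0 * (u r y * w r y)"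
              unfolding heat_split[OF pq n r(1) z] c0_def u_def w_def if_P[OF True] by (simp only: mult_ac)
            finally show "ennreal (exp 2 * (r powr (s - 1) * ln (1 / r) powr (- 1))) * ennreal (heat r (x - y) * F y) = ennreal c0 * ennreal (u r y * w r y)"
              using Fnn[of y] unn[of r y] wnn[of r y] c0 by (simp add: ennreal_mult[symmetric])
          qed
        qed
        finally show ?thesis .
      qed (auto simp: indicator_def)
    qed
    also have "\<dots> = (\<integral>\<^sup>+r. ennreal c0 * (\<integral>\<^sup>+y. ennreal (u r y * w r y) \<partial>lborel) \<partial>lborel)"
      by (intro nn_integral_cong nn_integral_cmult) measurable
    also have "\<dots> = ennreal c0 * (\<integral>\<^sup>+r. (\<integral>\<^sup>+y. ennreal (u r y * w r y) \<partial>lborel) \<partial>lborel)"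
      by (rule nn_integral_cmult) measurable
    also have "(\<integral>\<^sup>+r. (\<integral>\<^sup>+y. ennreal (u r y * w r y) \<partial>lborel) \<partial>lborel) = (\<integral>\<^sup>+z. ennreal (case_prod u z * case_prod w z) \<partial>(lborel \<Otimes>\<^sub>M lborel))"
      by (subst lborel.nn_integral_fst[symmetric]) (auto simp: case_prod_unfold)
    also have "\<dots> \<le> ennreal ((C1 * (ln (1 / e) powr (1 - q) / (q - 1))) powr (1 / q) * (C2 * N powr p) powr (1 / p))"
    proof (rule holder_nn)
      show "q > 1" "p > 1" "1 / q + 1 / p = 1" using pq by auto
      show "(\<integral>\<^sup>+z. ennreal (case_prod u z powr q) \<partial>(lborel \<Otimes>\<^sub>M lborel)) \<le> ennreal (C1 * (ln (1 / e) powr (1 - q) / (q - 1)))"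
      proof -
        have "(\<integral>\<^sup>+z. ennreal (case_prod u z powr q) \<partial>(lborel \<Otimes>\<^sub>M lborel)) = (\<integral>\<^sup>+r. (\<integral>\<^sup>+y. ennreal (u r y powr q) \<partial>lborel) \<partial>lborel)"
          by (subst lborel.nn_integral_fst[symmetric]) (auto simp: case_prod_unfold)
        also have "\<dots> \<le> (\<integral>\<^sup>+r. ennreal C1 * (ennreal (ln (1 / r) powr (- q) / r) * indicator {0<..<e} r) \<partial>lborel)"
        proof (rule nn_integral_mono)
          fix r :: real
          show "(\<integral>\<^sup>+y. ennreal (u r y powr q) \<partial>lborel) \<le> ennreal C1 * (ennreal (ln (1 / r) powr (- q) / r) * indicator {0<..<e} r)"
          proof (cases "0 < r \<and> r < e")
            case True
            then have r: "r > 0" by simp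
            let ?k = "ln (1 / r) powr (- q) * r powr (- 1 - real DIM('a) / 2 + 1 / 4)"
            have "u r y powr q = ?k * (norm (x - y) powr (- 1 / 2) * exp (- (norm (x - y))\<^sup>2 / (4 * r)))" for y
            proof -
              have "(- 1 / q - real DIM('a) / (2 * q) + 1 / (4 * q)) * q = - 1 - real DIM('a) / 2 + 1 / 4"
                "(- 1 / (2 * q)) * q = - 1 / 2" "(- (norm (x - y))\<^sup>2 / (4 * r) / q) * q = - (norm (x - y))\<^sup>2 / (4 * r)"
                "(- 1) * q = - q"
                using pq by (simp_all add: field_simps)
              then show ?thesis
                unfolding u_def if_P[OF True] by (simp only: powr_mult powr_powr exp_powr_real mult.assoc)
            qed
            then have "(\<integral>\<^sup>+y. ennreal (u r y powr q) \<partial>lborel) = (\<integral>\<^sup>+y. ennreal ?k * ennreal (norm (x - y) powr (- 1 / 2) * exp (- (norm (x - y))\<^sup>2 / (4 * r))) \<partial>lborel)"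
              by (simp add: ennreal_mult)
            also have "\<dots> = ennreal ?k * (\<integral>\<^sup>+y. ennreal (norm (x - y) powr (- 1 / 2) * exp (- (norm (x - y))\<^sup>2 / (4 * r))) \<partial>lborel)"
              by (rule nn_integral_cmult) simp
            also have "(\<integral>\<^sup>+y. ennreal (norm (x - y) powr (- 1 / 2) * exp (- (norm (x - y))\<^sup>2 / (4 * r))) \<partial>lborel) =
              (\<integral>\<^sup>+z. ennreal (norm z powr (- 1 / 2) * exp (- (norm z)\<^sup>2 / (4 * r))) \<partial>(lborel :: 'a measure))"
              by (rule nn_integral_lborel_reflect) simp
            also have "ennreal ?k * \<dots> \<le> ennreal ?k * ennreal (C1 * r powr (real DIM('a) / 2 - 1 / 4))"
              by (intro mult_left_mono C1(2) r) simp
            also have "\<dots> = ennreal (C1 * (ln (1 / r) powr (- q) * (r powr (- 1 - real DIM('a) / 2 + 1 / 4) * r powr (real DIM('a) / 2 - 1 / 4))))"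
              using C1(1) by (subst ennreal_mult[symmetric]) (auto simp: mult_ac)
            also have "r powr (- 1 - real DIM('a) / 2 + 1 / 4) * r powr (real DIM('a) / 2 - 1 / 4) = 1 / r"
            proof -
              have "(- 1 - real DIM('a) / 2 + 1 / 4) + (real DIM('a) / 2 - 1 / 4) = - 1" by simp
              then show ?thesis unfolding powr_add[symmetric] using r by (simp only: powr_minus_divide) simp
            qed
            also have "ennreal (C1 * (ln (1 / r) powr (- q) * (1 / r))) = ennreal C1 * (ennreal (ln (1 / r) powr (- q) / r) * indicator {0<..<e} r)"
              using True C1(1) by (simp add: ennreal_mult[symmetric])
            finally show ?thesis .
          next
            case False
            then have "u r y = 0" for y by (auto simp: u_def)
            then show ?thesis by simp
          qed
        qed
        also have "\<dots> = ennreal C1 * (\<integral>\<^sup>+r. ennreal (ln (1 / r) powr (- q) / r) * indicator {0<..<e} r \<partial>lborel)"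
          by (rule nn_integral_cmult) measurable
        also have "\<dots> = ennreal (C1 * (ln (1 / e) powr (1 - q) / (q - 1)))"
          unfolding log_weight[OF e pq(2)] using C1(1) pq by (simp add: ennreal_mult[symmetric])
        finally show ?thesis .
      qed
      show "(\<integral>\<^sup>+z. ennreal (case_prod w z powr p) \<partial>(lborel \<Otimes>\<^sub>M lborel)) \<le> ennreal (C2 * N powr p)"
      proof -
        have "(\<integral>\<^sup>+z. ennreal (case_prod w z powr p) \<partial>(lborel \<Otimes>\<^sub>M lborel)) = (\<integral>\<^sup>+r. (\<integral>\<^sup>+y. ennreal (w r y powr p) \<partial>lborel) \<partial>lborel)"
          by (subst lborel.nn_integral_fst[symmetric]) (auto simp: case_prod_unfold)
        also have "\<dots> = (\<integral>\<^sup>+y. (\<integral>\<^sup>+r. ennreal (w r y powr p) \<partial>lborel) \<partial>lborel)"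
          by (rule lborel_pair.Fubini'[symmetric]) measurable
        also have "\<dots> \<le> (\<integral>\<^sup>+y. ennreal C2 * ennreal (F y powr p) \<partial>lborel)"
        proof (rule nn_integral_mono)
          fix y
          let ?k = "norm (x - y) powr (p / (2 * q)) * F y powr p"
          show "(\<integral>\<^sup>+r. ennreal (w r y powr p) \<partial>lborel) \<le> ennreal C2 * ennreal (F y powr p)"
          proof (cases "x = y")
            case True
            then have "w r y powr p = 0" for r by (simp add: w_def)
            then show ?thesis by simp
          next
            case False
            then have z: "norm (x - y) > 0" by simp
            have "(\<integral>\<^sup>+r. ennreal (w r y powr p) \<partial>lborel) \<le> (\<integral>\<^sup>+r. ennreal ?k * (ennreal (r powr (- d - 1) * exp (- (norm (x - y))\<^sup>2 / (4 * r))) * indicator {0<..} r) \<partial>lborel)"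
            proof (rule nn_integral_mono)
              fix r :: real
              show "ennreal (w r y powr p) \<le> ennreal ?k * (ennreal (r powr (- d - 1) * exp (- (norm (x - y))\<^sup>2 / (4 * r))) * indicator {0<..} r)"
              proof (cases "0 < r \<and> r < e")
                case True
                have "(- 1 / p - 1 / (4 * q)) * p = - d - 1" "1 / (2 * q) * p = p / (2 * q)"
                   "(- (norm (x - y))\<^sup>2 / (4 * r) / p) * p = - (norm (x - y))\<^sup>2 / (4 * r)"
                  using pq True by (simp_all add: d_def field_simps)
                then have "w r y powr p = ((r powr (- d - 1) * norm (x - y) powr (p / (2 * q)) * exp (- (norm (x - y))\<^sup>2 / (4 * r))) * F y powr p)"
                  unfolding w_def if_P[OF True] by (simp only: powr_mult powr_powr exp_powr_real mult.assoc)
                also have "\<dots> = ?k * (r powr (- d - 1) * exp (- (norm (x - y))\<^sup>2 / (4 * r)))" by (simp only: mult_ac)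
                finally show ?thesis using True by (simp add: ennreal_mult)
              next
                case False
                then have "w r y = 0" by (auto simp: w_def)
                then show ?thesis by simp
              qed
            qed
            also have "\<dots> = ennreal ?k * (\<integral>\<^sup>+r. ennreal (r powr (- d - 1) * exp (- (norm (x - y))\<^sup>2 / (4 * r))) * indicator {0<..} r \<partial>lborel)"
              by (rule nn_integral_cmult) measurable
            also have "\<dots> \<le> ennreal ?k * ennreal (C2 * ((norm (x - y))\<^sup>2) powr (- d))"
              using z by (intro mult_left_mono C2(2)) auto
            also have "\<dots> = ennreal (C2 * (F y powr p * (norm (x - y) powr (p / (2 * q)) * ((norm (x - y))\<^sup>2) powr (- d))))"
              using C2(1) by (subst ennreal_mult[symmetric]) (auto simp: mult_ac)
            also have "norm (x - y) powr (p / (2 * q)) * ((norm (x - y))\<^sup>2) powr (- d) = 1"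
            proof -
              have "((norm (x - y))\<^sup>2) powr (- d) = norm (x - y) powr (2 * (- d))"
              proof -
                have sq: "(norm (x - y))\<^sup>2 = norm (x - y) powr 2" using z by simp
                show ?thesis unfolding sq powr_powr ..
              qed
              then show ?thesis using z pq by (simp add: powr_add[symmetric] d_def)
            qed
            also have "ennreal (C2 * (F y powr p * 1)) = ennreal C2 * ennreal (F y powr p)" using C2(1) by (simp add: ennreal_mult)
            finally show ?thesis .
          qed
        qed
        also have "\<dots> = ennreal C2 * (\<integral>\<^sup>+y. ennreal (F y powr p) \<partial>lborel)" by (rule nn_integral_cmult) measurable
        also have "\<dots> \<le> ennreal C2 * ennreal (N powr p)" by (intro mult_left_mono FN) simp
        also have "\<dots> = ennreal (C2 * N powr p)" using C2(1) by (simp add: ennreal_mult)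
        finally show ?thesis .
      qed
      show "case_prod u z \<ge> 0" "case_prod w z \<ge> 0" for z using unn wnn by (auto simp: case_prod_unfold)
      show "0 \<le> C1 * (ln (1 / e) powr (1 - q) / (q - 1))" "0 \<le> C2 * N powr p" using C1 C2 pq by auto
    qed measurable
    also have "(C1 * (ln (1 / e) powr (1 - q) / (q - 1))) powr (1 / q) * (C2 * N powr p) powr (1 / p) =
       ((C1 / (q - 1)) powr (1 / q) * C2 powr (1 / p)) * ln (1 / e) powr ((1 - q) / q) * N"
      using C1 C2 pq N by (simp add: powr_mult powr_divide powr_powr field_simps)
    also have "ennreal c0 * ennreal (((C1 / (q - 1)) powr (1 / q) * C2 powr (1 / p)) * ln (1 / e) powr ((1 - q) / q) * N) = ennreal (C * ln (1 / e) powr ((1 - q) / q) * N)"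
      using c0 N by (subst ennreal_mult[symmetric]) (auto simp: C_def mult_ac)
    finally show "(\<integral>\<^sup>+r. indicator {..<e} r * (\<integral>\<^sup>+y. ennreal (heat r (x - y) * F y) \<partial>lborel) \<partial>heat_mixture lam s) \<le>
       ennreal (C * ln (1 / e) powr ((1 - q) / q) * N)"
      by (simp add: mult_left_mono)
  qed
qed

section \<open>Uniform estimates for potentials\<close>

text \<open>A kernel that is bounded by \<open>L\<close> and has mass \<open>I\<close> has \<open>q\<close>-th power of mass at most \<open>L powr (q - 1) * I\<close>.\<close>

lemma holder_sup_kernel:
  fixes D F :: "'a::euclidean_space \<Rightarrow> real"
  assumes pq: "p > 1" "q > 1" "1 / p + 1 / q = 1"
    and [measurable]: "D \<in> borel_measurable borel" and D: "\<And>y. 0 \<le> D y" "\<And>y. D y \<le> L"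
    and I: "(\<integral>\<^sup>+y. ennreal (D y) \<partial>lborel) \<le> ennreal I" "I \<ge> 0"
    and F: "Lp_bound p F N"
  shows "(\<integral>\<^sup>+y. ennreal (D y * F y) \<partial>lborel) \<le> ennreal ((L powr (q - 1) * I) powr (1 / q) * N)"
proof -
  have [measurable]: "F \<in> borel_measurable borel" and Fnn: "\<And>y. F y \<ge> 0" and N: "N \<ge> 0"
      and FN: "(\<integral>\<^sup>+y. ennreal (F y powr p) \<partial>lborel) \<le> ennreal (N powr p)"
    using F by (auto simp: Lp_bound_def)
  have L: "L \<ge> 0" using D order_trans by blast
  have "(\<integral>\<^sup>+y. ennreal (D y powr q) \<partial>lborel) \<le> (\<integral>\<^sup>+y. ennreal (L powr (q - 1)) * ennreal (D y) \<partial>lborel)"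
  proof (rule nn_integral_mono)
    fix y
    have "D y powr q \<le> L powr (q - 1) * D y"
    proof (cases "D y = 0")
      case False
      then have "D y powr q = D y powr (q - 1) * D y" using D(1)[of y] by (simp add: powr_diff)
      also have "\<dots> \<le> L powr (q - 1) * D y" using D[of y] pq by (intro mult_right_mono powr_mono2) auto
      finally show ?thesis .
    qed simp
    then show "ennreal (D y powr q) \<le> ennreal (L powr (q - 1)) * ennreal (D y)"
      using D(1)[of y] by (simp add: ennreal_mult[symmetric] ennreal_leI)
  qed
  also have "\<dots> = ennreal (L powr (q - 1)) * (\<integral>\<^sup>+y. ennreal (D y) \<partial>lborel)" by (rule nn_integral_cmult) simp
  also have "\<dots> \<le> ennreal (L powr (q - 1)) * ennreal I" by (intro mult_left_mono I) simp
  also have "\<dots> = ennreal (L powr (q - 1) * I)" using I by (simp add: ennreal_mult)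
  finally have "(\<integral>\<^sup>+y. ennreal (D y powr q) \<partial>lborel) \<le> ennreal (L powr (q - 1) * I)" .
  then have "(\<integral>\<^sup>+y. ennreal (D y * F y) \<partial>lborel) \<le> ennreal ((L powr (q - 1) * I) powr (1 / q) * (N powr p) powr (1 / p))"
    using pq I D Fnn FN by (intro holder_nn) auto
  then show ?thesis using N pq by (simp add: powr_powr)
qed

lemma nn_integral_heat_translate: "r > 0 \<Longrightarrow> (\<integral>\<^sup>+y. ennreal (heat r (x - y)) \<partial>lborel) = (1::ennreal)"
  for x :: "'a::euclidean_space"
  using nn_integral_lborel_reflect[of "\<lambda>y. ennreal (heat r y)" x] heat_integral(3)[of r, where 'a = 'a] by simp

definition mixture_mass :: "real \<Rightarrow> real \<Rightarrow> real" where
  "mixture_mass lam s = inverse (lam powr s * ln lam)"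

lemma emeasure_heat_mixture: "lam > 1 \<Longrightarrow> s > 0 \<Longrightarrow> emeasure (heat_mixture lam s) UNIV = ennreal (mixture_mass lam s)"
  using heat_mixture_laplace[of lam s 0] by (simp add: mixture_mass_def)

lemma mixture_mass_pos: "lam > 1 \<Longrightarrow> mixture_mass lam s > 0"
  by (simp add: mixture_mass_def)

text \<open>The majorant of the potential of a density whose absolute value is \<open>F\<close>.\<close>

definition abs_potential :: "real \<Rightarrow> real \<Rightarrow> ('a::euclidean_space \<Rightarrow> real) \<Rightarrow> 'a \<Rightarrow> ennreal" where
  "abs_potential lam s F x = (\<integral>\<^sup>+r. (\<integral>\<^sup>+y. ennreal (heat r (x - y) * F y) \<partial>lborel) \<partial>heat_mixture lam s)"

text \<open>Small times are controlled by \<open>small_time_bound\<close>. For times \<open>r \<ge> 1 / 2\<close> the heat kernel is bounded with mass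
  one, and the mixture has finite mass.\<close>

lemma abs_potential_sup_bound:
  assumes p: "p > 1" and n: "real DIM('a::euclidean_space) = 2 * s * p" and s: "s > 0"
    and lam: "lam > 1"
  obtains C where "C > 0" "\<And>F N x. Lp_bound p (F :: 'a \<Rightarrow> real) N \<Longrightarrow> abs_potential lam s F x \<le> ennreal (C * N)"
proof -
  define q where "q = p / (p - 1)"
  have pq: "p > 1" "q > 1" "1 / p + 1 / q = 1" using p by (auto simp: q_def field_simps)
  obtain C1 where C1: "C1 > 0" "\<And>e F N x. 0 < e \<Longrightarrow> e < 1 \<Longrightarrow> Lp_bound p (F :: 'a \<Rightarrow> real) N \<Longrightarrow>
     (\<integral>\<^sup>+r. indicator {..<e} r * (\<integral>\<^sup>+y. ennreal (heat r (x - y) * F y) \<partial>lborel) \<partial>heat_mixture lam s) \<le>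
       ennreal (C1 * ln (1 / e) powr ((1 - q) / q) * N)"
    using small_time_bound[OF pq n s lam] by blast
  define L where "L = (4 * pi * (1 / 2)) powr (- (real DIM('a) / 2))"
  define C2 where "C2 = (L powr (q - 1) * 1) powr (1 / q) * mixture_mass lam s"
  have C2: "C2 \<ge> 0" using mixture_mass_pos[OF lam, of s] by (simp add: C2_def)
  define C where "C = C1 * ln 2 powr ((1 - q) / q) + C2"
  show ?thesis
  proof (rule that[of C])
    show "C > 0" using C1 C2 by (auto simp: C_def intro!: add_pos_nonneg)
    fix F :: "'a \<Rightarrow> real" and N x assume F: "Lp_bound p F N"
    have [measurable]: "F \<in> borel_measurable borel" and N: "N \<ge> 0"
      using F by (auto simp: Lp_bound_def)
    have "abs_potential lam s F x \<le> (\<integral>\<^sup>+r. (indicator {..<1/2} r * (\<integral>\<^sup>+y. ennreal (heat r (x - y) * F y) \<partial>lborel) + ennreal ((L powr (q - 1) * 1) powr (1 / q) * N)) \<partial>heat_mixture lam s)"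
      unfolding abs_potential_def
    proof (rule nn_integral_mono)
      fix r :: real
      show "(\<integral>\<^sup>+y. ennreal (heat r (x - y) * F y) \<partial>lborel) \<le> indicator {..<1/2} r * (\<integral>\<^sup>+y. ennreal (heat r (x - y) * F y) \<partial>lborel) + ennreal ((L powr (q - 1) * 1) powr (1 / q) * N)"
      proof (cases "r < 1/2")
        case False
        then have "heat r (x - y) \<le> L" for y unfolding L_def by (intro heat_le) auto
        then have "(\<integral>\<^sup>+y. ennreal (heat r (x - y) * F y) \<partial>lborel) \<le> ennreal ((L powr (q - 1) * 1) powr (1 / q) * N)"
          using nn_integral_heat_translate[of r x] False
          by (intro holder_sup_kernel[OF pq _ _ _ _ _ F]) auto
        then show ?thesis by (simp add: add_increasing)
      qed simp
    qed
    also have "\<dots> = (\<integral>\<^sup>+r. indicator {..<1/2} r * (\<integral>\<^sup>+y. ennreal (heat r (x - y) * F y) \<partial>lborel) \<partial>heat_mixture lam s) + ennreal ((L powr (q - 1) * 1) powr (1 / q) * N) * ennreal (mixture_mass lam s)"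
      by (subst nn_integral_add) (auto simp: emeasure_heat_mixture[OF lam s])
    also have "\<dots> \<le> ennreal (C1 * ln (1 / (1/2)) powr ((1 - q) / q) * N) + ennreal (C2 * N)"
      using C1(2)[OF _ _ F, of "1/2" x] N mixture_mass_pos[OF lam, of s]
      by (intro add_mono) (auto simp: C2_def ennreal_mult[symmetric] mult_ac)
    also have "\<dots> = ennreal (C * N)"
      using C1 C2 N by (simp add: C_def distrib_right ennreal_plus[symmetric] del: ennreal_plus)
    finally show "abs_potential lam s F x \<le> ennreal (C * N)" .
  qed
qed

text \<open>First \<open>e\<close> is chosen so that the times \<open>r < e\<close> contribute little at both points. For \<open>r \<ge> e\<close> the difference of the
  two kernels has mass at most \<open>2\<close> and a supremum of order \<open>norm (x - x')\<close>, so its \<open>q\<close>-norm is small as well.\<close>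

lemma abs_potential_equicontinuous:
  assumes p: "p > 1" and n: "real DIM('a::euclidean_space) = 2 * s * p" and s: "s > 0"
    and lam: "lam > 1" and eps: "\<epsilon> > 0"
  obtains d where "d > 0" "\<And>F N x x'. Lp_bound p (F :: 'a \<Rightarrow> real) N \<Longrightarrow> norm (x - x') \<le> d \<Longrightarrow>
    (\<integral>\<^sup>+r. (\<integral>\<^sup>+y. ennreal (\<bar>heat r (x - y) - heat r (x' - y)\<bar> * F y) \<partial>lborel) \<partial>heat_mixture lam s) \<le> ennreal (\<epsilon> * N)"
proof -
  define q where "q = p / (p - 1)"
  have pq: "p > 1" "q > 1" "1 / p + 1 / q = 1" using p by (auto simp: q_def field_simps)
  obtain C1 where C1: "C1 > 0" "\<And>e F N x. 0 < e \<Longrightarrow> e < 1 \<Longrightarrow> Lp_bound p (F :: 'a \<Rightarrow> real) N \<Longrightarrow>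
     (\<integral>\<^sup>+r. indicator {..<e} r * (\<integral>\<^sup>+y. ennreal (heat r (x - y) * F y) \<partial>lborel) \<partial>heat_mixture lam s) \<le>
       ennreal (C1 * ln (1 / e) powr ((1 - q) / q) * N)"
    using small_time_bound[OF pq n s lam] by blast
  have "((\<lambda>e. C1 * ln (1 / e) powr (- ((q - 1) / q))) \<longlongrightarrow> C1 * 0) (at_right 0)"
  proof (intro tendsto_mult tendsto_const tendsto_neg_powr)
    show "filterlim (\<lambda>r::real. ln (1 / r)) at_top (at_right 0)" by real_asymp
  qed (use pq in auto)
  then have "\<forall>\<^sub>F e in at_right 0. C1 * ln (1 / e) powr (- ((q - 1) / q)) < \<epsilon> / 4"
    using eps by (intro order_tendstoD(2)) auto
  moreover have "\<forall>\<^sub>F e in at_right 0. 0 < e \<and> e < (1::real)"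
    by (auto simp: eventually_at_right_field intro!: exI[of _ 1])
  ultimately have "\<exists>e. C1 * ln (1 / e) powr (- ((q - 1) / q)) < \<epsilon> / 4 \<and> 0 < e \<and> e < (1::real)"
    using eventually_happens[OF eventually_conj] by fastforce
  then obtain e where e: "C1 * ln (1 / e) powr ((1 - q) / q) < \<epsilon> / 4" "0 < e" "e < 1"
    by (auto simp: minus_divide_left)
  define H where "H = (4 * pi * e) powr (- (real DIM('a) / 2)) / sqrt e"
  have H: "H > 0" using e by (simp add: H_def)
  define M where "M = mixture_mass lam s"
  have M: "M > 0" using mixture_mass_pos[OF lam] by (simp add: M_def)
  have "((\<lambda>d. (H * d) powr ((q - 1) / q) * (2 powr (1 / q) * M)) \<longlongrightarrow> 0 * (2 powr (1 / q) * M)) (at_right 0)"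
  proof (intro tendsto_mult tendsto_const tendsto_zero_powrI)
    have "((\<lambda>d. H * d) \<longlongrightarrow> H * 0) (at_right 0)" by (intro tendsto_intros)
    then show "((\<lambda>d. H * d) \<longlongrightarrow> 0) (at_right 0)" by simp
    show "\<forall>\<^sub>F d in at_right 0. 0 \<le> H * d" using H by (auto simp: eventually_at_filter)
  qed (use pq in auto)
  then have "((\<lambda>d. ((H * d) powr (q - 1) * 2) powr (1 / q) * M) \<longlongrightarrow> 0) (at_right 0)"
    by (simp add: powr_mult powr_powr mult.assoc)
  then have "\<forall>\<^sub>F d in at_right 0. ((H * d) powr (q - 1) * 2) powr (1 / q) * M < \<epsilon> / 2"
    using eps by (intro order_tendstoD(2)) auto
  moreover have "\<forall>\<^sub>F d in at_right 0. 0 < (d::real)" by (rule eventually_at_right_less)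
  ultimately have "\<exists>d. ((H * d) powr (q - 1) * 2) powr (1 / q) * M < \<epsilon> / 2 \<and> 0 < d"
    using eventually_happens[OF eventually_conj] by fastforce
  then obtain d where d: "((H * d) powr (q - 1) * 2) powr (1 / q) * M < \<epsilon> / 2" "0 < d" by blast
  show ?thesis
  proof (rule that[OF d(2)])
    fix F :: "'a \<Rightarrow> real" and N :: real and x x' :: 'a assume F: "Lp_bound p F N" and x: "norm (x - x') \<le> d"
    have [measurable]: "F \<in> borel_measurable borel" and Fnn: "\<And>y. F y \<ge> 0" and N: "N \<ge> 0"
      using F by (auto simp: Lp_bound_def)
    let ?J = "\<lambda>x r. indicator {..<e} r * (\<integral>\<^sup>+y. ennreal (heat r (x - y) * F y) \<partial>lborel)"
    let ?c = "((H * d) powr (q - 1) * 2) powr (1 / q)"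
    have "(\<integral>\<^sup>+r. (\<integral>\<^sup>+y. ennreal (\<bar>heat r (x - y) - heat r (x' - y)\<bar> * F y) \<partial>lborel) \<partial>heat_mixture lam s) \<le>
       (\<integral>\<^sup>+r. ((?J x r + ?J x' r) + ennreal (?c * N)) \<partial>heat_mixture lam s)"
    proof (rule nn_integral_mono)
      fix r :: real
      show "(\<integral>\<^sup>+y. ennreal (\<bar>heat r (x - y) - heat r (x' - y)\<bar> * F y) \<partial>lborel) \<le> (?J x r + ?J x' r) + ennreal (?c * N)"
      proof (cases "r < e")
        case True
        have "(\<integral>\<^sup>+y. ennreal (\<bar>heat r (x - y) - heat r (x' - y)\<bar> * F y) \<partial>lborel) \<le> (\<integral>\<^sup>+y. ennreal (heat r (x - y) * F y) + ennreal (heat r (x' - y) * F y) \<partial>lborel)"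
        proof (rule nn_integral_mono)
          fix y
          have "\<bar>heat r (x - y) - heat r (x' - y)\<bar> \<le> heat r (x - y) + heat r (x' - y)"
            using heat_nonneg[of r "x - y"] heat_nonneg[of r "x' - y"] by linarith
          then have "\<bar>heat r (x - y) - heat r (x' - y)\<bar> * F y \<le> heat r (x - y) * F y + heat r (x' - y) * F y"
            using Fnn[of y] by (metis distrib_right mult_right_mono)
          then show "ennreal (\<bar>heat r (x - y) - heat r (x' - y)\<bar> * F y) \<le> ennreal (heat r (x - y) * F y) + ennreal (heat r (x' - y) * F y)"
            using Fnn[of y] by (simp add: ennreal_plus[symmetric] ennreal_leI del: ennreal_plus)
        qed
        also have "\<dots> = ?J x r + ?J x' r" using True by (subst nn_integral_add) auto
        finally show ?thesis by (rule order_trans) simp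
      next
        case False
        then have r: "0 < e" "e \<le> r" using e by auto
        have I: "(\<integral>\<^sup>+y. ennreal \<bar>heat r (x - y) - heat r (x' - y)\<bar> \<partial>lborel) \<le> ennreal 2"
        proof -
          have "(\<integral>\<^sup>+y. ennreal \<bar>heat r (x - y) - heat r (x' - y)\<bar> \<partial>lborel) \<le> (\<integral>\<^sup>+y. ennreal (heat r (x - y)) + ennreal (heat r (x' - y)) \<partial>lborel)"
          proof (rule nn_integral_mono)
            fix y
            have "\<bar>heat r (x - y) - heat r (x' - y)\<bar> \<le> heat r (x - y) + heat r (x' - y)"
              using heat_nonneg[of r "x - y"] heat_nonneg[of r "x' - y"] by linarith
            then show "ennreal \<bar>heat r (x - y) - heat r (x' - y)\<bar> \<le> ennreal (heat r (x - y)) + ennreal (heat r (x' - y))"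
              by (simp add: ennreal_plus[symmetric] ennreal_leI del: ennreal_plus)
          qed
          also have "\<dots> = 1 + 1" using r by (subst nn_integral_add) (auto simp: nn_integral_heat_translate)
          finally show ?thesis by simp
        qed
        have Lip: "\<bar>heat r (x - y) - heat r (x' - y)\<bar> \<le> H * d" for y
        proof -
          have "\<bar>heat r (x - y) - heat r (x' - y)\<bar> \<le> H * norm ((x - y) - (x' - y))"
            unfolding H_def by (rule heat_lipschitz[OF r])
          also have "\<dots> \<le> H * d" using x H by (intro mult_left_mono) auto
          finally show ?thesis .
        qed
        have "(\<integral>\<^sup>+y. ennreal (\<bar>heat r (x - y) - heat r (x' - y)\<bar> * F y) \<partial>lborel) \<le> ennreal (?c * N)"
          using I Lip by (intro holder_sup_kernel[OF pq _ _ _ _ _ F]) auto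
        then show ?thesis by (simp add: add_increasing)
      qed
    qed
    also have "\<dots> = (\<integral>\<^sup>+r. ?J x r \<partial>heat_mixture lam s) + (\<integral>\<^sup>+r. ?J x' r \<partial>heat_mixture lam s) + ennreal (?c * N) * ennreal M"
      by (subst nn_integral_add, simp, simp, subst nn_integral_add) (auto simp: emeasure_heat_mixture[OF lam s] M_def)
    also have "\<dots> \<le> ennreal (\<epsilon> / 4 * N) + ennreal (\<epsilon> / 4 * N) + ennreal (\<epsilon> / 2 * N)"
    proof (intro add_mono)
      have "C1 * ln (1 / e) powr ((1 - q) / q) * N \<le> \<epsilon> / 4 * N" using e(1) N by (intro mult_right_mono) auto
      then show "(\<integral>\<^sup>+r. ?J x r \<partial>heat_mixture lam s) \<le> ennreal (\<epsilon> / 4 * N)" "(\<integral>\<^sup>+r. ?J x' r \<partial>heat_mixture lam s) \<le> ennreal (\<epsilon> / 4 * N)"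
        using C1(2)[OF e(2,3) F] by (meson ennreal_leI order_trans)+
      have "?c * N * M \<le> \<epsilon> / 2 * N" using mult_right_mono[OF less_imp_le[OF d(1)] N] by (simp add: mult_ac)
      then show "ennreal (?c * N) * ennreal M \<le> ennreal (\<epsilon> / 2 * N)"
        using N M by (simp add: ennreal_mult[symmetric] ennreal_leI)
    qed
    also have "\<dots> = ennreal (\<epsilon> * N)"
      using N eps by (simp add: ennreal_plus[symmetric] del: ennreal_plus)
    finally show "(\<integral>\<^sup>+r. (\<integral>\<^sup>+y. ennreal (\<bar>heat r (x - y) - heat r (x' - y)\<bar> * F y) \<partial>lborel) \<partial>heat_mixture lam s) \<le> ennreal (\<epsilon> * N)" .
  qed
qed

text \<open>Jensen's inequality for the kernel of mass \<open>mixture_mass lam s\<close>, in the form of Hoelder's inequality with the kernel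
  split as \<open>heat powr (1 / q) * heat powr (1 / p)\<close>, followed by Tonelli.\<close>

lemma abs_potential_Lp_bound:
  assumes p: "p > 1" and s: "s > 0" and lam: "lam > 1"
    and F: "Lp_bound p (F :: 'a::euclidean_space \<Rightarrow> real) N"
    and G: "\<And>x. G x \<ge> 0" "\<And>x. ennreal (G x) \<le> abs_potential lam s F x"
  shows "(\<integral>\<^sup>+x. ennreal (G x powr p) \<partial>lborel) \<le> ennreal ((mixture_mass lam s * N) powr p)"
proof -
  define q where "q = p / (p - 1)"
  have pq: "p > 1" "q > 1" "1 / p + 1 / q = 1" using p by (auto simp: q_def field_simps)
  interpret finite_measure "heat_mixture lam s" by (rule finite_measure_heat_mixture) fact+
  interpret pair_sigma_finite "heat_mixture lam s" "lborel :: 'a measure" ..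
  interpret M': pair_sigma_finite "lborel :: 'a measure" "heat_mixture lam s" ..
  have [measurable]: "F \<in> borel_measurable borel" and Fnn: "\<And>y. F y \<ge> 0" and N: "N \<ge> 0"
      and FN: "(\<integral>\<^sup>+y. ennreal (F y powr p) \<partial>lborel) \<le> ennreal (N powr p)"
    using F by (auto simp: Lp_bound_def)
  define M where "M = mixture_mass lam s"
  have M: "M > 0" using mixture_mass_pos[OF lam] by (simp add: M_def)
  define W where "W x = (\<integral>\<^sup>+r. (\<integral>\<^sup>+y. ennreal (heat r (x - y) * F y powr p) \<partial>lborel) \<partial>heat_mixture lam s)" for x
  have one: "(\<integral>\<^sup>+r. (\<integral>\<^sup>+y. ennreal (heat r (x - y)) \<partial>lborel) \<partial>heat_mixture lam s) = ennreal M" for x :: 'a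
  proof -
    have "(\<integral>\<^sup>+r. (\<integral>\<^sup>+y. ennreal (heat r (x - y)) \<partial>lborel) \<partial>heat_mixture lam s) = (\<integral>\<^sup>+r. 1 \<partial>heat_mixture lam s)"
      by (intro nn_integral_cong_AE eventually_mono[OF AE_heat_mixture_pos[of lam s]]) (simp add: nn_integral_heat_translate)
    then show ?thesis by (simp add: emeasure_heat_mixture[OF lam s] M_def)
  qed
  have one': "(\<integral>\<^sup>+r. (\<integral>\<^sup>+x. ennreal (heat r (x - y)) \<partial>lborel) \<partial>heat_mixture lam s) = ennreal M" for y :: 'a
    using one[of y] by (simp add: heat_minus_commute[of _ y])
  have pt: "ennreal (G x powr p) \<le> ennreal (M powr (p / q)) * W x" for x
  proof (cases "W x = top")
    case True
    then show ?thesis using M by (simp add: ennreal_mult_top)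
  next
    case False
    then have W: "W x = ennreal (enn2real (W x))" by (simp add: less_top[symmetric])
    have "abs_potential lam s F x = (\<integral>\<^sup>+z. ennreal (heat (fst z) (x - snd z) powr (1 / q) * (heat (fst z) (x - snd z) powr (1 / p) * F (snd z))) \<partial>(heat_mixture lam s \<Otimes>\<^sub>M lborel))"
    proof -
      have "heat r z powr (1 / q) * (heat r z powr (1 / p) * f) = heat r z * f" for r f and z :: 'a
        using pq by (simp add: mult.assoc[symmetric] powr_add[symmetric] add.commute)
      then have "(\<integral>\<^sup>+z. ennreal (heat (fst z) (x - snd z) powr (1 / q) * (heat (fst z) (x - snd z) powr (1 / p) * F (snd z))) \<partial>(heat_mixture lam s \<Otimes>\<^sub>M lborel)) =
        (\<integral>\<^sup>+z. ennreal (heat (fst z) (x - snd z) * F (snd z)) \<partial>(heat_mixture lam s \<Otimes>\<^sub>M lborel))" by (simp only:)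
      then show ?thesis unfolding abs_potential_def
        by (simp only:) (subst lborel.nn_integral_fst[symmetric], auto)
    qed
    also have "\<dots> \<le> ennreal (M powr (1 / q) * (enn2real (W x)) powr (1 / p))"
    proof (rule holder_nn)
      show "q > 1" "p > 1" "1 / q + 1 / p = 1" using pq by auto
      show "(\<integral>\<^sup>+z. ennreal ((heat (fst z) (x - snd z) powr (1 / q)) powr q) \<partial>(heat_mixture lam s \<Otimes>\<^sub>M lborel)) \<le> ennreal M"
      proof -
        have "(heat r z powr (1 / q)) powr q = heat r z" for r and z :: 'a using pq by (simp add: powr_powr)
        then show ?thesis using one[of x] by (subst lborel.nn_integral_fst[symmetric]) auto
      qed
      show "(\<integral>\<^sup>+z. ennreal ((heat (fst z) (x - snd z) powr (1 / p) * F (snd z)) powr p) \<partial>(heat_mixture lam s \<Otimes>\<^sub>M lborel)) \<le> ennreal (enn2real (W x))"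
      proof -
        have "(heat r z powr (1 / p) * f) powr p = heat r z * f powr p" for r f and z :: 'a using pq by (simp add: powr_mult powr_powr)
        then show ?thesis unfolding W[symmetric] unfolding W_def by (subst lborel.nn_integral_fst[symmetric]) auto
      qed
    qed (use Fnn M in auto)
    finally have "ennreal (G x) \<le> ennreal (M powr (1 / q) * (enn2real (W x)) powr (1 / p))"
      using G(2)[of x] by (rule order_trans[rotated])
    then have "G x \<le> M powr (1 / q) * (enn2real (W x)) powr (1 / p)" by (subst (asm) ennreal_le_iff) auto
    then have "G x powr p \<le> (M powr (1 / q) * (enn2real (W x)) powr (1 / p)) powr p"
      using G(1)[of x] p by (intro powr_mono2) auto
    also have "\<dots> = M powr (p / q) * enn2real (W x)" using p by (simp add: powr_mult powr_powr)
    finally show ?thesis by (subst W) (simp add: ennreal_mult[symmetric] ennreal_leI)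
  qed
  have "(\<integral>\<^sup>+x. ennreal (G x powr p) \<partial>lborel) \<le> (\<integral>\<^sup>+x. ennreal (M powr (p / q)) * W x \<partial>lborel)"
    by (intro nn_integral_mono pt)
  also have "\<dots> = ennreal (M powr (p / q)) * (\<integral>\<^sup>+x. W x \<partial>lborel)"
    unfolding W_def by (rule nn_integral_cmult) measurable
  also have "(\<integral>\<^sup>+x. W x \<partial>lborel) = (\<integral>\<^sup>+r. (\<integral>\<^sup>+x. (\<integral>\<^sup>+y. ennreal (heat r (x - y) * F y powr p) \<partial>lborel) \<partial>lborel) \<partial>heat_mixture lam s)"
    unfolding W_def by (rule Fubini') measurable
  also have "\<dots> = (\<integral>\<^sup>+r. (\<integral>\<^sup>+y. (\<integral>\<^sup>+x. ennreal (heat r (x - y) * F y powr p) \<partial>lborel) \<partial>lborel) \<partial>heat_mixture lam s)"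
    by (intro nn_integral_cong lborel_pair.Fubini') measurable
  also have "\<dots> = (\<integral>\<^sup>+r. (\<integral>\<^sup>+y. ennreal (F y powr p) \<partial>lborel) \<partial>heat_mixture lam s)"
  proof (rule nn_integral_cong_AE)
    show "AE r in heat_mixture lam s. (\<integral>\<^sup>+y. (\<integral>\<^sup>+x. ennreal (heat r (x - y) * F y powr p) \<partial>lborel) \<partial>lborel) = (\<integral>\<^sup>+y. ennreal (F y powr p) \<partial>lborel)"
      using AE_heat_mixture_pos
    proof eventually_elim
      fix r :: real assume r: "0 < r"
      have "(\<integral>\<^sup>+x. ennreal (heat r (x - y) * F y powr p) \<partial>lborel) = ennreal (F y powr p)" for y
      proof -
        have "(\<integral>\<^sup>+x. ennreal (heat r (x - y) * F y powr p) \<partial>lborel) = (\<integral>\<^sup>+x. ennreal (heat r (y - x)) * ennreal (F y powr p) \<partial>lborel)"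
          by (simp add: ennreal_mult heat_minus_commute[of _ y])
        also have "\<dots> = (\<integral>\<^sup>+x. ennreal (heat r (y - x)) \<partial>lborel) * ennreal (F y powr p)" by (rule nn_integral_multc) simp
        finally show ?thesis by (simp add: nn_integral_heat_translate[OF r])
      qed
      then show "(\<integral>\<^sup>+y. (\<integral>\<^sup>+x. ennreal (heat r (x - y) * F y powr p) \<partial>lborel) \<partial>lborel) = (\<integral>\<^sup>+y. ennreal (F y powr p) \<partial>lborel)" by simp
    qed
  qed
  also have "\<dots> = (\<integral>\<^sup>+y. ennreal (F y powr p) \<partial>lborel) * ennreal M" by (simp add: emeasure_heat_mixture[OF lam s] M_def)
  also have "ennreal (M powr (p / q)) * \<dots> \<le> ennreal (M powr (p / q)) * (ennreal (N powr p) * ennreal M)"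
    by (intro mult_left_mono mult_right_mono FN) auto
  also have "\<dots> = ennreal ((M powr (p / q) * M) * N powr p)"
    using M by (simp add: ennreal_mult[symmetric] mult_ac)
  also have "M powr (p / q) * M = M powr p"
  proof -
    have "p / q + 1 = p" using pq by (simp add: q_def)
    then have "M powr p = M powr (p / q) * M powr 1" unfolding powr_add[symmetric] by simp
    then show ?thesis using M by simp
  qed
  also have "M powr p * N powr p = (M * N) powr p" by (simp add: powr_mult)
  finally show ?thesis by (simp add: M_def)
qed

section \<open>Bump functions\<close>

text \<open>The family of the derivatives of \<open>exp (- (c / t))\<close>, extended by zero, is spanned by these functions; all of them are flat at \<open>0\<close>.\<close>

definition flat_exp :: "real \<Rightarrow> nat \<Rightarrow> real \<Rightarrow> real" where
  "flat_exp c k t = (if t > 0 then inverse t ^ k * exp (- (c / t)) else 0)"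

lemma flat_exp_sq_bound:
  assumes c: "c > 0"
  obtains K where "K > 0" "\<And>t. \<bar>flat_exp c k t\<bar> \<le> K * t\<^sup>2"
proof (rule that[of "(real (k + 2) / c) ^ (k + 2)"])
  show "0 < (real (k + 2) / c) ^ (k + 2)" using c by simp
  fix t :: real
  show "\<bar>flat_exp c k t\<bar> \<le> (real (k + 2) / c) ^ (k + 2) * t\<^sup>2"
  proof (cases "t > 0")
    case True
    let ?n = "real (k + 2)"
    have "(c / t / ?n) ^ (k + 2) \<le> (1 + c / t / ?n) ^ (k + 2)" using c True by (intro power_mono) auto
    also have "\<dots> \<le> exp (c / t)"
    proof (rule exp_ge_one_plus_x_over_n_power_n)
      have "0 \<le> c / t" using c True by simp
      then show "- real (k + 2) \<le> c / t" by linarith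
    qed simp
    finally have "exp (- (c / t)) \<le> inverse ((c / t / ?n) ^ (k + 2))"
      unfolding exp_minus using c True by (intro le_imp_inverse_le) auto
    also have "\<dots> = (?n / c) ^ (k + 2) * t ^ (k + 2)"
    proof -
      have i: "inverse (c / t / ?n) = ?n / c * t" by (simp add: divide_inverse mult_ac)
      show ?thesis unfolding power_inverse[symmetric] i power_mult_distrib ..
    qed
    finally have "inverse t ^ k * exp (- (c / t)) \<le> inverse t ^ k * ((?n / c) ^ (k + 2) * t ^ (k + 2))"
      using True by (intro mult_left_mono) auto
    also have "\<dots> = (?n / c) ^ (k + 2) * t\<^sup>2"
    proof -
      have "inverse t ^ k * t ^ (k + 2) = t\<^sup>2"
        unfolding power_add power_inverse using True by simp
      then show ?thesis by (metis mult.left_commute)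
    qed
    finally show ?thesis using True by (simp add: flat_exp_def abs_mult)
  qed (use c in \<open>simp add: flat_exp_def\<close>)
qed

lemma flat_exp_deriv:
  assumes c: "c > 0"
  shows "(flat_exp c k has_real_derivative (- real k * flat_exp c (k + 1) t + c * flat_exp c (k + 2) t)) (at t)"
proof -
  consider "t > 0" | "t < 0" | "t = 0" by linarith
  then show ?thesis
  proof cases
    case 1
    have "((\<lambda>t. inverse t ^ k) has_real_derivative (real k * inverse t ^ (k - 1) * (- (inverse t ^ 2)))) (at t)"
      using 1 by (intro DERIV_power[THEN DERIV_cong] derivative_eq_intros refl) (auto simp: power2_eq_square)
    moreover have "((\<lambda>t. exp (- (c / t))) has_real_derivative (exp (- (c / t)) * (c * inverse t ^ 2))) (at t)"
      using 1 by (auto intro!: derivative_eq_intros simp: power2_eq_square field_simps)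
    ultimately have d: "((\<lambda>t. inverse t ^ k * exp (- (c / t))) has_real_derivative
      (inverse t ^ k * (exp (- (c / t)) * (c * inverse t ^ 2)) + (real k * inverse t ^ (k - 1) * (- (inverse t ^ 2))) * exp (- (c / t)))) (at t)"
      by (rule DERIV_mult')
    have "(flat_exp c k has_real_derivative
      (inverse t ^ k * (exp (- (c / t)) * (c * inverse t ^ 2)) + (real k * inverse t ^ (k - 1) * (- (inverse t ^ 2))) * exp (- (c / t)))) (at t)"
      by (rule has_field_derivative_transform_within_open[OF d, of "{0<..}"]) (use 1 in \<open>auto simp: flat_exp_def\<close>)
    moreover have "inverse t ^ k * (exp (- (c / t)) * (c * inverse t ^ 2)) + (real k * inverse t ^ (k - 1) * (- (inverse t ^ 2))) * exp (- (c / t)) = - real k * flat_exp c (k + 1) t + c * flat_exp c (k + 2) t"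
      using 1 by (cases k) (auto simp: flat_exp_def power2_eq_square algebra_simps)
    ultimately show ?thesis by (simp only:)
  next
    case 2
    have "((\<lambda>t. 0) has_real_derivative 0) (at t)" by simp
    then have "(flat_exp c k has_real_derivative 0) (at t)"
      by (rule has_field_derivative_transform_within_open[of _ _ _ "{..<0}"]) (use 2 in \<open>auto simp: flat_exp_def\<close>)
    then show ?thesis using 2 by (simp add: flat_exp_def)
  next
    case 3
    obtain K where K: "K > 0" "\<And>t. \<bar>flat_exp c k t\<bar> \<le> K * t\<^sup>2" using flat_exp_sq_bound[OF c] by blast
    have "(flat_exp c k has_real_derivative 0) (at 0)"
      unfolding DERIV_def
    proof (rule Lim_null_comparison)
      show "\<forall>\<^sub>F h in at 0. norm ((flat_exp c k (0 + h) - flat_exp c k 0) / h) \<le> K * \<bar>h\<bar>"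
      proof (rule eventually_at_topological[THEN iffD2], intro exI[of _ UNIV] conjI ballI impI)
        fix h :: real assume "h \<noteq> 0"
        then have "\<bar>flat_exp c k h\<bar> / \<bar>h\<bar> \<le> K * h\<^sup>2 / \<bar>h\<bar>" using K(2)[of h] by (intro divide_right_mono) auto
        also have "\<dots> = K * \<bar>h\<bar>" using \<open>h \<noteq> 0\<close> by (simp add: power2_eq_square abs_if)
        finally show "norm ((flat_exp c k (0 + h) - flat_exp c k 0) / h) \<le> K * \<bar>h\<bar>" by (simp add: flat_exp_def)
      qed auto
      have "((\<lambda>h. K * \<bar>h\<bar>) \<longlongrightarrow> K * \<bar>0\<bar>) (at 0)" by (intro tendsto_intros)
      then show "((\<lambda>h. K * \<bar>h\<bar>) \<longlongrightarrow> 0) (at 0)" by simp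
    qed
    then show ?thesis using 3 by (simp add: flat_exp_def)
  qed
qed

text \<open>The pair consists of a coordinate direction and a flag that selects the lower or the upper face of the box. The value is the
  signed distance to that face, positive inside.\<close>

definition face_dist :: "'a \<Rightarrow> 'a \<Rightarrow> 'a \<times> bool \<Rightarrow> 'a::euclidean_space \<Rightarrow> real" where
  "face_dist a b j x = (if snd j then x \<bullet> fst j - a \<bullet> fst j else b \<bullet> fst j - x \<bullet> fst j)"

definition faces :: "('a::euclidean_space \<times> bool) set" where
  "faces = Basis \<times> UNIV"

lemma finite_faces [simp]: "finite (faces :: ('a::euclidean_space \<times> bool) set)"
  by (simp add: faces_def)

text \<open>A separate exponent for every face, because a partial derivative changes the exponents of two opposite faces only.\<close>

definition box_bump :: "real \<Rightarrow> 'a \<Rightarrow> 'a \<Rightarrow> ('a \<times> bool \<Rightarrow> nat) \<Rightarrow> 'a::euclidean_space \<Rightarrow> real" where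
  "box_bump c a b \<kappa> x = (\<Prod>j\<in>faces. flat_exp c (\<kappa> j) (face_dist a b j x))"

lemma in_box_face: "x \<in> box a b \<longleftrightarrow> (\<forall>j\<in>faces. face_dist a b j x > 0)"
  by (auto simp: mem_box face_dist_def faces_def)

lemma box_bump_zero: "x \<notin> box a b \<Longrightarrow> box_bump c a b \<kappa> x = 0"
  unfolding in_box_face box_bump_def by (auto simp: flat_exp_def not_less[symmetric] intro!: prod_zero)

lemma face_dist_deriv: "(face_dist a b j has_derivative (\<lambda>h. (if snd j then 1 else - 1) * (h \<bullet> fst j))) (at x)"
  unfolding face_dist_def by (cases "snd j") (auto intro!: derivative_eq_intros)

lemma box_bump_deriv:
  assumes c: "c > 0"
  shows "(box_bump c a b \<kappa> has_derivative (\<lambda>h. \<Sum>j\<in>faces. (if snd j then 1 else - 1) * (h \<bullet> fst j) *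
     (- real (\<kappa> j) * box_bump c a b (\<kappa>(j := \<kappa> j + 1)) x + c * box_bump c a b (\<kappa>(j := \<kappa> j + 2)) x))) (at (x::'a::euclidean_space))"
proof -
  have d: "((\<lambda>x. flat_exp c (\<kappa> j) (face_dist a b j x)) has_derivative (\<lambda>h. (- real (\<kappa> j) * flat_exp c (\<kappa> j + 1) (face_dist a b j x) + c * flat_exp c (\<kappa> j + 2) (face_dist a b j x)) * ((if snd j then 1 else - 1) * (h \<bullet> fst j)))) (at x)" for j
    by (rule has_derivative_compose[OF face_dist_deriv flat_exp_deriv[OF c, unfolded has_field_derivative_def]])
  have e: "box_bump c a b (\<kappa>(j := m)) x = flat_exp c m (face_dist a b j x) * (\<Prod>i\<in>faces - {j}. flat_exp c (\<kappa> i) (face_dist a b i x))" if "j \<in> faces" for j m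
    unfolding box_bump_def using that by (subst prod.remove[of _ j]) auto
  show ?thesis
    unfolding box_bump_def[of c a b \<kappa>, abs_def]
  proof (rule has_derivative_eq_rhs[OF has_derivative_prod[OF d]], rule ext, rule sum.cong[OF refl])
    fix h j assume j: "j \<in> (faces :: ('a \<times> bool) set)"
    show "(- real (\<kappa> j) * flat_exp c (\<kappa> j + 1) (face_dist a b j x) + c * flat_exp c (\<kappa> j + 2) (face_dist a b j x)) * ((if snd j then 1 else - 1) * (h \<bullet> fst j)) *
        (\<Prod>i\<in>faces - {j}. flat_exp c (\<kappa> i) (face_dist a b i x)) =
      (if snd j then 1 else - 1) * (h \<bullet> fst j) * (- real (\<kappa> j) * box_bump c a b (\<kappa>(j := \<kappa> j + 1)) x + c * box_bump c a b (\<kappa>(j := \<kappa> j + 2)) x)"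
      unfolding e[OF j] by (simp add: algebra_simps)
  qed
qed

text \<open>Multiples of box bumps with all possible exponents are stable under derivatives up to sums, and they vanish outside a
  bounded box.\<close>

lemma box_bump_schwartz:
  fixes a b :: "'a::euclidean_space"
  assumes c: "c > 0"
  shows "(\<lambda>x. complex_of_real (box_bump c a b \<kappa> x)) \<in> schwartz"
proof -
  let ?A = "{\<lambda>x. complex_of_real (w * box_bump c a b \<kappa> x) | w \<kappa>. True}"
  have gen: "(\<lambda>x. complex_of_real (w * box_bump c a b \<kappa> x)) \<in> ?A" for w \<kappa>
    by (rule CollectI, rule exI[of _ w], rule exI[of _ \<kappa>]) simp
  have zero: "(\<lambda>_. 0) \<in> ?A" using gen[of 0] by simp
  have "(\<lambda>x. complex_of_real (1 * box_bump c a b \<kappa> x)) \<in> schwartz"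
  proof (rule schwartz_coinduct_span[OF fun_span.base[OF gen]], goal_cases)
    case (1 f)
    then obtain w \<kappa> where f: "f = (\<lambda>x. complex_of_real (w * box_bump c a b \<kappa> x))" by auto
    let ?t = "\<lambda>v j x. complex_of_real ((w * (if snd j then 1 else - 1) * (v \<bullet> fst j) * (- real (\<kappa> j))) * box_bump c a b (\<kappa>(j := \<kappa> j + 1)) x) +
        complex_of_real ((w * (if snd j then 1 else - 1) * (v \<bullet> fst j) * c) * box_bump c a b (\<kappa>(j := \<kappa> j + 2)) x)"
    let ?g = "\<lambda>v x. \<Sum>j\<in>faces. ?t v j x"
    have "?g v \<in> fun_span ?A" for v
      by (intro fun_span_sum[OF zero] finite_faces fun_span.add fun_span.base gen)
    moreover have "\<exists>D. (f has_derivative D) (at x) \<and> (\<forall>v\<in>Basis. D v = ?g v x)" for x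
      unfolding f
      by (rule exI, rule conjI, rule has_derivative_of_real[OF has_derivative_mult_right[OF box_bump_deriv[OF c]]])
         (simp add: sum_distrib_left algebra_simps)
    ultimately show ?case by (intro exI[of _ ?g] conjI ballI allI)
  next
    case (2 f k)
    then obtain w \<kappa> where f: "f = (\<lambda>x. complex_of_real (w * box_bump c a b \<kappa> x))" by auto
    have "continuous_on (cbox a b) (box_bump c a b \<kappa>)"
      by (meson box_bump_deriv[OF c] has_derivative_continuous continuous_at_imp_continuous_on)
    then have cf: "continuous_on (cbox a b) f" unfolding f by (intro continuous_intros)
    have "continuous_on (cbox a b) (\<lambda>x. (1 + norm x) ^ k * norm (f x))"
      by (intro continuous_intros cf)
    then have "bounded ((\<lambda>x. (1 + norm x) ^ k * norm (f x)) ` cbox a b)"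
      by (rule compact_imp_bounded[OF compact_continuous_image[OF _ compact_cbox]])
    then obtain B where "\<forall>y\<in>(\<lambda>x. (1 + norm x) ^ k * norm (f x)) ` cbox a b. norm y \<le> B"
      unfolding bounded_iff by (elim exE)
    then have B: "\<And>x. x \<in> cbox a b \<Longrightarrow> norm ((1 + norm x) ^ k * norm (f x)) \<le> B" by simp
    have "(1 + norm x) ^ k * norm (f x) \<le> max B 0" for x
    proof (cases "x \<in> box a b")
      case True
      then have "x \<in> cbox a b" using box_subset_cbox by blast
      then show ?thesis using B[of x] by (auto simp: abs_mult power_abs intro: max.coboundedI1)
    qed (simp add: f box_bump_zero)
    then show ?case by blast
  qed
  then show ?thesis by simp
qed

text \<open>The parameter \<open>k\<close> makes the transition at the faces steeper: \<open>exp (- (1 / (k * t)))\<close> tends to \<open>1\<close> for \<open>t > 0\<close>.\<close>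

definition bump :: "nat \<Rightarrow> 'a \<Rightarrow> 'a \<Rightarrow> 'a::euclidean_space \<Rightarrow> complex" where
  "bump k a b x = of_real (box_bump (1 / real (Suc k)) a b (\<lambda>_. 0) x)"

lemma bump_schwartz: "bump k a b \<in> schwartz"
  unfolding bump_def[abs_def] by (rule box_bump_schwartz) simp

lemma bump_outside: "x \<notin> box a b \<Longrightarrow> bump k a b x = 0"
  by (simp add: bump_def box_bump_zero)

lemma bump_support: "closure {x. bump k a b x \<noteq> 0} \<subseteq> cbox a b" "compact (closure {x. bump k a b x \<noteq> 0})"
proof -
  have "{x. bump k a b x \<noteq> 0} \<subseteq> cbox a b" using bump_outside box_subset_cbox by blast
  then show *: "closure {x. bump k a b x \<noteq> 0} \<subseteq> cbox a b" using closed_cbox by (rule closure_minimal)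
  show "compact (closure {x. bump k a b x \<noteq> 0})"
    using * bounded_subset[OF bounded_cbox] by (simp add: compact_eq_bounded_closed)
qed

lemma bump_le_1: "norm (bump k a b x) \<le> 1"
proof -
  have "0 \<le> flat_exp (1 / real (Suc k)) 0 t \<and> flat_exp (1 / real (Suc k)) 0 t \<le> 1" for t by (simp add: flat_exp_def)
  then have "box_bump (1 / real (Suc k)) a b (\<lambda>_. 0) x \<le> 1" "0 \<le> box_bump (1 / real (Suc k)) a b (\<lambda>_. 0) x"
    unfolding box_bump_def by (auto intro!: prod_le_1 prod_nonneg)
  then show ?thesis by (simp add: bump_def)
qed

lemma bump_pos: "x \<in> box a b \<Longrightarrow> bump k a b x \<noteq> 0"
  unfolding bump_def box_bump_def in_box_face by (auto simp: flat_exp_def)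

lemma bump_tendsto: "(\<lambda>k. bump k a b x) \<longlonglongrightarrow> indicator (box a b) x"
proof (cases "x \<in> box a b")
  case True
  have "(\<lambda>k. box_bump (1 / real (Suc k)) a b (\<lambda>_. 0) x) \<longlonglongrightarrow> (\<Prod>j\<in>(faces :: ('a \<times> bool) set). 1)"
    unfolding box_bump_def
  proof (rule tendsto_prod)
    fix j :: "'a \<times> bool" assume "j \<in> faces"
    then have f: "face_dist a b j x > 0" using True in_box_face by blast
    have "(\<lambda>k. exp (- (inverse (real (Suc k)) / face_dist a b j x))) \<longlonglongrightarrow> exp (- (0 / face_dist a b j x))"
      using f by (intro tendsto_intros LIMSEQ_inverse_real_of_nat) auto
    then show "(\<lambda>k. flat_exp (1 / real (Suc k)) 0 (face_dist a b j x)) \<longlonglongrightarrow> 1"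
      using f by (simp add: flat_exp_def inverse_eq_divide)
  qed
  then have "(\<lambda>k. bump k a b x) \<longlonglongrightarrow> of_real 1" unfolding bump_def by (intro tendsto_of_real) simp
  then show ?thesis using True by simp
next
  case False
  then show ?thesis by (simp add: bump_outside)
qed

section \<open>Functions with vanishing integrals against bumps\<close>

text \<open>Bumps converge to indicators of open boxes, so the integral over every box vanishes. Boxes are an intersection-stable
  generator of the Borel sets, hence the integral over every Borel set vanishes.\<close>

lemma AE_zero_on_cbox:
  fixes g :: "'a::euclidean_space \<Rightarrow> complex"
  assumes int: "set_integrable lborel (cbox a b) g"
    and test: "\<And>c d k. cbox c d \<subseteq> cbox a b \<Longrightarrow> (LINT x|lborel. g x * bump k c d x) = 0"
  shows "AE x in lborel. x \<in> cbox a b \<longrightarrow> g x = 0"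
proof -
  \<comment> \<open>Cutting off makes the function integrable on the whole space; the boundary of the box is a null set.\<close>
  define F where "F x = indicator (cbox a b) x *\<^sub>R g x" for x
  have F: "integrable lborel F" using int by (simp add: F_def[abs_def] set_integrable_def)
  have Fm: "F \<in> borel_measurable borel" using borel_measurable_integrable[OF F] by simp
  have box: "(LINT x:box c d|lborel. F x) = 0" if cd: "cbox c d \<subseteq> cbox a b" for c d
  proof -
    have sub: "box c d \<subseteq> cbox a b" using cd box_subset_cbox by blast
    have "(\<lambda>k. LINT x|lborel. F x * bump k c d x) \<longlonglongrightarrow> (LINT x|lborel. F x * indicator (box c d) x)"
    proof (rule integral_dominated_convergence[where w = "\<lambda>x. norm (F x)"])
      show "integrable lborel (\<lambda>x. norm (F x))" using F by simp
      show "AE x in lborel. (\<lambda>k. F x * bump k c d x) \<longlonglongrightarrow> F x * indicator (box c d) x"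
        by (intro AE_I2 tendsto_mult_left bump_tendsto)
      show "AE x in lborel. norm (F x * bump k c d x) \<le> norm (F x)" for k
        using bump_le_1[of k c d] by (intro AE_I2) (simp add: norm_mult mult_left_le)
      show "(\<lambda>x. F x * bump k c d x) \<in> borel_measurable lborel" for k
        using Fm schwartz_measurable[OF bump_schwartz[of k c d]] by simp
      show "(\<lambda>x. F x * indicator (box c d) x) \<in> borel_measurable lborel"
        using Fm by simp
    qed
    moreover have "F x * bump k c d x = g x * bump k c d x" for k x
      using sub bump_outside[of x c d k] by (auto simp: F_def indicator_def)
    ultimately have "(LINT x|lborel. F x * indicator (box c d) x) = 0"
      using test[OF cd] LIMSEQ_unique[OF _ tendsto_const] by simp
    moreover have "F x * indicator (box c d) x = indicator (box c d) x *\<^sub>R F x" for x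
      by (simp add: indicator_def)
    ultimately show ?thesis by (simp add: set_lebesgue_integral_def)
  qed
  have Fz: "(LINT x|lborel. F x) = 0"
  proof -
    have "AE x in lborel. F x = indicator (box a b) x *\<^sub>R F x"
    proof -
      have "cbox a b - box a b \<in> null_sets lborel"
        using negligible_frontier_interval[of a b] by (simp add: negligible_iff_null_sets null_sets_completion_iff)
      then have "AE x in lborel. x \<notin> cbox a b - box a b" by (rule AE_not_in)
      then show ?thesis by eventually_elim (auto simp: F_def indicator_def)
    qed
    then have "(LINT x|lborel. F x) = (LINT x:box a b|lborel. F x)"
      unfolding set_lebesgue_integral_def using F borel_measurable_integrable[OF F] by (intro integral_cong_AE) auto
    then show ?thesis using box[of a b] by simp
  qed
  have all: "(LINT x:A|lborel. F x) = 0" if A: "A \<in> sets borel" for A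
  proof -
    have "Int_stable (range (\<lambda>(a, b). box a b :: 'a set))" by (auto simp: Int_stable_def box_Int_box)
    moreover have "range (\<lambda>(a, b). box a b :: 'a set) \<subseteq> Pow UNIV" by auto
    moreover have "A \<in> sigma_sets UNIV (range (\<lambda>(a, b). box a b))" using A unfolding borel_eq_box by simp
    ultimately show ?thesis
    proof (induction rule: sigma_sets_induct_disjoint)
      case (basic A)
      then obtain c d where A: "A = box c d" by auto
      obtain c' d' where cd: "box c d \<inter> box a b = box c' d'" using box_Int_box by blast
      have "AE x in lborel. indicator A x *\<^sub>R F x = indicator (box c' d') x *\<^sub>R F x"
      proof -
        have "cbox a b - box a b \<in> null_sets lborel"
          using negligible_frontier_interval[of a b] by (simp add: negligible_iff_null_sets null_sets_completion_iff)
        then have "AE x in lborel. x \<notin> cbox a b - box a b" by (rule AE_not_in)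
        then show ?thesis unfolding A cd[symmetric] by eventually_elim (auto simp: F_def indicator_def)
      qed
      then have *: "(LINT x:A|lborel. F x) = (LINT x:box c' d'|lborel. F x)"
        unfolding set_lebesgue_integral_def A using F borel_measurable_integrable[OF F] by (intro integral_cong_AE) auto
      show ?case
      proof (cases "box c' d' = {}")
        case True
        then show ?thesis unfolding * by (simp add: set_lebesgue_integral_def)
      next
        case False
        have "cbox c' d' = closure (box c' d')" using False by simp
        also have "\<dots> \<subseteq> cbox a b" using cd box_subset_cbox[of a b] by (intro closure_minimal) auto
        finally show ?thesis unfolding * by (rule box)
      qed
    next
      case empty
      show ?case by (simp add: set_lebesgue_integral_def)
    next
      case (compl A)
      then have [measurable]: "A \<in> sets borel" by (simp add: borel_eq_box)
      have "(LINT x:UNIV - A|lborel. F x) = (LINT x|lborel. F x - indicator A x *\<^sub>R F x)"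
        unfolding set_lebesgue_integral_def by (intro Bochner_Integration.integral_cong) (auto simp: indicator_def)
      also have "\<dots> = (LINT x|lborel. F x) - (LINT x:A|lborel. F x)"
        unfolding set_lebesgue_integral_def
        by (intro Bochner_Integration.integral_diff F integrable_mult_indicator) auto
      finally show ?case using compl Fz by simp
    next
      case (union B)
      then have [measurable]: "B i \<in> sets borel" for i by (auto simp: borel_eq_box)
      have "(LINT x:(\<Union>i. B i)|lborel. F x) = (\<Sum>i. (LINT x:(B i)|lborel. F x))"
      proof (rule lebesgue_integral_countable_add)
        show "B i \<inter> B j = {}" if "i \<noteq> j" for i j using union(1) that by (auto simp: disjoint_family_on_def)
        show "set_integrable lborel (\<Union>i. B i) F" unfolding set_integrable_def by (intro integrable_mult_indicator F) auto
      qed auto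
      then show ?case using union by simp
    qed
  qed
  have "AE x in lborel. F x = 0"
    by (rule sigma_finite_measure.density_unique_banach[OF sigma_finite_lborel F integrable_zero]) (use all in \<open>auto simp: set_lebesgue_integral_def\<close>)
  then show ?thesis by eventually_elim (auto simp: F_def)
qed

lemma AE_zero_on_open:
  fixes g :: "'a::euclidean_space \<Rightarrow> complex"
  assumes \<Omega>: "open \<Omega>"
    and int: "\<And>a b. cbox a b \<subseteq> \<Omega> \<Longrightarrow> set_integrable lborel (cbox a b) g"
    and test: "\<And>c d k. cbox c d \<subseteq> \<Omega> \<Longrightarrow> (LINT x|lborel. g x * bump k c d x) = 0"
  shows "AE x in lborel. x \<in> \<Omega> \<longrightarrow> g x = 0"
proof -
  obtain \<D> where D: "countable \<D>" "\<D> \<subseteq> Pow \<Omega>" "\<And>X. X \<in> \<D> \<Longrightarrow> \<exists>a b. X = cbox a b" "\<Union>\<D> = \<Omega>"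
    using open_countable_Union_open_cbox[OF \<Omega>] by blast
  have "AE x in lborel. \<forall>X\<in>\<D>. x \<in> X \<longrightarrow> g x = 0"
  proof (rule AE_ball_countable[THEN iffD2, OF D(1)], rule ballI)
    fix X assume X: "X \<in> \<D>"
    then obtain a b where "X = cbox a b" using D(3) by blast
    moreover have "X \<subseteq> \<Omega>" using X D(2) by blast
    ultimately show "AE x in lborel. x \<in> X \<longrightarrow> g x = 0"
      using AE_zero_on_cbox[of a b g] int test by (metis order_trans)
  qed
  then show ?thesis by eventually_elim (use D(4) in blast)
qed

section \<open>Potentials and Lebesgue norms\<close>

text \<open>One integral over the product of times and points, so that Fubini applies to it directly.\<close>

definition potential :: "real \<Rightarrow> real \<Rightarrow> ('a::euclidean_space \<Rightarrow> complex) \<Rightarrow> 'a \<Rightarrow> complex" where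
  "potential lam s f x = (LINT z|(heat_mixture lam s \<Otimes>\<^sub>M lborel). of_real (heat (fst z) (x - snd z)) * f (snd z))"

lemma Lq_space_finite_iff: "p > 0 \<Longrightarrow> f \<in> Lq_space (ennreal p) M \<longleftrightarrow> f \<in> borel_measurable M \<and> integrable M (\<lambda>x. norm (f x) powr p)"
  by (simp add: Lq_space_def)

lemma Lq_norm_finite: "p > 0 \<Longrightarrow> Lq_norm (ennreal p) M f = (LINT x|M. norm (f x) powr p) powr (1 / p)"
  by (simp add: Lq_norm_def)

lemma Lq_norm_nonneg_finite: "p > 0 \<Longrightarrow> Lq_norm (ennreal p) M f \<ge> 0"
  by (simp add: Lq_norm_finite)

lemma Lp_bound_norm:
  assumes "p > 0" "f \<in> Lq_space (ennreal p) lborel"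
  shows "Lp_bound p (\<lambda>y. norm (f y)) (Lq_norm (ennreal p) lborel f)"
proof -
  have [measurable]: "f \<in> borel_measurable borel" and i: "integrable lborel (\<lambda>x. norm (f x) powr p)"
    using assms by (auto simp: Lq_space_finite_iff)
  have "(\<integral>\<^sup>+y. ennreal (norm (f y) powr p) \<partial>lborel) = ennreal (LINT x|lborel. norm (f x) powr p)"
    by (rule nn_integral_eq_integral[OF i]) simp
  moreover have "(LINT x|lborel. norm (f x) powr p) \<ge> 0" by simp
  ultimately show ?thesis using assms(1) by (simp add: Lp_bound_def Lq_norm_finite powr_powr)
qed

lemma Lq_norm_AE_cong:
  assumes [measurable]: "f \<in> borel_measurable M" "g \<in> borel_measurable M" and ae: "AE x in M. f x = g x"
  shows "Lq_norm q M f = Lq_norm q M g"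
proof (cases "q = \<infinity>")
  case True
  have "esssup M (\<lambda>x. ereal (norm (f x))) = esssup M (\<lambda>x. ereal (norm (g x)))"
    by (rule esssup_AE_cong) (use ae in auto)
  then show ?thesis using True by (simp add: Lq_norm_def)
next
  case False
  have "(LINT x|M. norm (f x) powr enn2real q) = (LINT x|M. norm (g x) powr enn2real q)"
    by (rule integral_cong_AE) (use ae in auto)
  then show ?thesis using False by (simp add: Lq_norm_def)
qed

lemma Lq_norm_infinity_bounds:
  assumes [measurable]: "w \<in> borel_measurable M" and ae: "AE x in M. norm (w x) \<le> e" and e: "e \<ge> 0"
  shows "0 \<le> Lq_norm \<infinity> M w" "Lq_norm \<infinity> M w \<le> e"
proof -
  let ?E = "esssup M (\<lambda>x. ereal (norm (w x)))"
  have le: "?E \<le> ereal e" by (rule esssup_I) (use ae in auto)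
  then show "Lq_norm \<infinity> M w \<le> e"
    using e by (cases ?E) (auto simp: Lq_norm_def)
  show "0 \<le> Lq_norm \<infinity> M w"
  proof (cases "emeasure M (space M) = 0")
    case True
    then show ?thesis by (simp add: Lq_norm_def esssup_zero_space)
  next
    case False
    have "esssup M (\<lambda>x. ereal 0) \<le> ?E" by (rule esssup_mono) auto
    then show ?thesis unfolding esssup_const[OF False] by (simp add: Lq_norm_def real_of_ereal_pos zero_ereal_def)
  qed
qed

lemma Lq_finite_measure_sup:
  assumes fin: "finite_measure M" and q: "1 \<le> (q :: ennreal)"
  obtains A where "A \<ge> 0" "\<And>w e. w \<in> borel_measurable M \<Longrightarrow> AE x in M. norm (w x) \<le> e \<Longrightarrow> e \<ge> 0 \<Longrightarrow>
     w \<in> Lq_space q M \<and> 0 \<le> Lq_norm q M w \<and> Lq_norm q M w \<le> A * e"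
proof (cases "q = \<infinity>")
  case True
  show ?thesis
  proof (rule that[of 1])
    fix w :: "'a \<Rightarrow> complex" and e assume w: "w \<in> borel_measurable M" "AE x in M. norm (w x) \<le> e" "e \<ge> 0"
    then have "w \<in> Lq_space q M" using True by (auto simp: Lq_space_def)
    then show "w \<in> Lq_space q M \<and> 0 \<le> Lq_norm q M w \<and> Lq_norm q M w \<le> 1 * e"
      using Lq_norm_infinity_bounds[OF w] True by simp
  qed simp
next
  case False
  interpret finite_measure M by fact
  define r where "r = enn2real q"
  have qr: "q = ennreal r" using False by (simp add: r_def less_top)
  have r: "r \<ge> 1" using q unfolding qr by simp
  define A where "A = measure M (space M) powr (1 / r)"
  show ?thesis
  proof (rule that[of A])
    show "A \<ge> 0" by (simp add: A_def)
    fix w :: "'a \<Rightarrow> complex" and e assume w[measurable]: "w \<in> borel_measurable M" and ae: "AE x in M. norm (w x) \<le> e" and e: "e \<ge> 0"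
    have ae': "AE x in M. norm (w x) powr r \<le> e powr r"
      using ae by eventually_elim (use r in \<open>auto intro!: powr_mono2\<close>)
    have i: "integrable M (\<lambda>x. norm (w x) powr r)"
      by (rule integrable_const_bound[of _ "e powr r"]) (use ae' in auto)
    have "(LINT x|M. norm (w x) powr r) \<le> (LINT x|M. e powr r)"
      by (rule integral_mono_AE[OF i _ ae']) simp
    also have "\<dots> = measure M (space M) * e powr r" by simp
    finally have "(LINT x|M. norm (w x) powr r) powr (1 / r) \<le> (measure M (space M) * e powr r) powr (1 / r)"
      using r by (intro powr_mono2) auto
    also have "\<dots> = A * e" using r e by (simp add: A_def powr_mult powr_powr)
    finally have "Lq_norm q M w \<le> A * e" unfolding qr using r by (simp add: Lq_norm_finite)
    moreover have "0 \<le> Lq_norm q M w" unfolding qr using r by (simp add: Lq_norm_finite)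
    moreover have "w \<in> Lq_space q M" unfolding qr using r i by (simp add: Lq_space_finite_iff)
    ultimately show "w \<in> Lq_space q M \<and> 0 \<le> Lq_norm q M w \<and> Lq_norm q M w \<le> A * e" by simp
  qed
qed

text \<open>Pointwise, the \<open>q\<close>-th power is at most \<open>e powr (q - p)\<close> times the \<open>p\<close>-th power.\<close>

lemma Lq_interpolation:
  assumes p: "p > 1" and q: "ennreal p < q"
    and w[measurable]: "w \<in> borel_measurable M" and e: "\<And>x. norm (w x) \<le> e" "e \<ge> 0"
    and B: "(\<integral>\<^sup>+x. ennreal (norm (w x) powr p) \<partial>M) \<le> ennreal B" "B \<ge> 0"
  shows "w \<in> Lq_space q M" "0 \<le> Lq_norm q M w"
    "Lq_norm q M w \<le> (if q = \<infinity> then e else e powr ((enn2real q - p) / enn2real q) * B powr (1 / enn2real q))"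
proof -
  have "w \<in> Lq_space q M \<and> 0 \<le> Lq_norm q M w \<and>
    Lq_norm q M w \<le> (if q = \<infinity> then e else e powr ((enn2real q - p) / enn2real q) * B powr (1 / enn2real q))"
  proof (cases "q = \<infinity>")
    case True
    then have "w \<in> Lq_space q M" using e(1) by (auto simp: Lq_space_def)
    then show ?thesis using Lq_norm_infinity_bounds[OF w _ e(2)] e(1) True by simp
  next
    case False
    define r where "r = enn2real q"
    have qr: "q = ennreal r" using False by (simp add: r_def less_top)
    have r: "r > p" using q p unfolding qr by (auto simp: ennreal_less_iff)
    have le: "norm (w x) powr r \<le> e powr (r - p) * norm (w x) powr p" for x
    proof -
      have "norm (w x) powr r = norm (w x) powr (r - p) * norm (w x) powr p" by (simp add: powr_add[symmetric])
      also have "\<dots> \<le> e powr (r - p) * norm (w x) powr p" using e r by (intro mult_right_mono powr_mono2) auto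
      finally show ?thesis .
    qed
    have "(\<integral>\<^sup>+x. ennreal (norm (w x) powr r) \<partial>M) \<le> (\<integral>\<^sup>+x. ennreal (e powr (r - p)) * ennreal (norm (w x) powr p) \<partial>M)"
      using le by (intro nn_integral_mono) (simp add: ennreal_mult[symmetric] ennreal_leI)
    also have "\<dots> = ennreal (e powr (r - p)) * (\<integral>\<^sup>+x. ennreal (norm (w x) powr p) \<partial>M)" by (rule nn_integral_cmult) simp
    also have "\<dots> \<le> ennreal (e powr (r - p)) * ennreal B" by (intro mult_left_mono B) simp
    also have "\<dots> = ennreal (e powr (r - p) * B)" using B by (simp add: ennreal_mult)
    finally have nn: "(\<integral>\<^sup>+x. ennreal (norm (w x) powr r) \<partial>M) \<le> ennreal (e powr (r - p) * B)" .
    have i: "integrable M (\<lambda>x. norm (w x) powr r)"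
      using nn by (intro integrableI_bounded) (auto intro: le_less_trans)
    have "ennreal (LINT x|M. norm (w x) powr r) \<le> ennreal (e powr (r - p) * B)"
      using nn nn_integral_eq_integral[OF i] by simp
    then have "(LINT x|M. norm (w x) powr r) \<le> e powr (r - p) * B"
      using B by (subst (asm) ennreal_le_iff) auto
    then have "(LINT x|M. norm (w x) powr r) powr (1 / r) \<le> (e powr (r - p) * B) powr (1 / r)"
      using r p by (intro powr_mono2) auto
    also have "\<dots> = e powr ((r - p) / r) * B powr (1 / r)" by (simp add: powr_mult powr_powr)
    finally have "Lq_norm q M w \<le> e powr ((r - p) / r) * B powr (1 / r)" unfolding qr using r p by (simp add: Lq_norm_finite)
    moreover have "0 \<le> Lq_norm q M w" unfolding qr using r p by (simp add: Lq_norm_finite)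
    moreover have "w \<in> Lq_space q M" unfolding qr using r p i by (simp add: Lq_space_finite_iff)
    ultimately show ?thesis using False by (simp add: r_def)
  qed
  then show "w \<in> Lq_space q M" "0 \<le> Lq_norm q M w"
    "Lq_norm q M w \<le> (if q = \<infinity> then e else e powr ((enn2real q - p) / enn2real q) * B powr (1 / enn2real q))" by auto
qed

lemma sup_norm_bounds:
  assumes "K \<noteq> {}" "\<And>x. x \<in> K \<Longrightarrow> norm (w x) \<le> e"
  shows "0 \<le> sup_norm K w" "sup_norm K w \<le> e"
proof -
  show "sup_norm K w \<le> e" unfolding sup_norm_def using assms by (intro cSUP_least) auto
  obtain x where x: "x \<in> K" using assms by blast
  have "0 \<le> norm (w x)" by simp
  also have "\<dots> \<le> sup_norm K w" unfolding sup_norm_def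
    using assms by (intro cSUP_upper[OF x]) (auto intro!: bdd_aboveI2)
  finally show "0 \<le> sup_norm K w" .
qed

section \<open>Uniqueness of representing functions\<close>

lemma locally_integrable_powr:
  fixes f :: "'a::euclidean_space \<Rightarrow> complex"
  assumes f[measurable]: "f \<in> borel_measurable lborel" and p: "p \<ge> 1" and i: "integrable lborel (\<lambda>x. norm (f x) powr p)"
  shows "set_integrable lborel (cbox a b) f"
  unfolding set_integrable_def
proof (rule Bochner_Integration.integrable_bound)
  show "integrable lborel (\<lambda>x. indicator (cbox a b) x + norm (f x) powr p)"
    by (intro Bochner_Integration.integrable_add i) (use emeasure_bounded_finite[OF bounded_cbox, of a b] in \<open>simp add: integrable_indicator_iff\<close>)
  show "AE x in lborel. norm (indicator (cbox a b) x *\<^sub>R f x) \<le> norm (indicator (cbox a b) x + norm (f x) powr p)"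
  proof (rule AE_I2)
    fix x
    show "norm (indicator (cbox a b) x *\<^sub>R f x) \<le> norm (indicator (cbox a b) x + norm (f x) powr p)"
    proof (cases "norm (f x) \<le> 1")
      case True
      then show ?thesis by (auto simp: indicator_def add_increasing2)
    next
      case False
      then have "norm (f x) powr 1 \<le> norm (f x) powr p" using p by (intro powr_mono) auto
      then show ?thesis using False by (auto simp: indicator_def)
    qed
  qed
qed measurable

lemma integrable_times_bump:
  fixes g :: "'a::euclidean_space \<Rightarrow> complex"
  assumes "set_integrable lborel (cbox c d) g"
  shows "integrable lborel (\<lambda>x. g x * bump k c d x)"
proof -
  have "integrable lborel (\<lambda>x. (indicator (cbox c d) x *\<^sub>R g x) * bump k c d x)"
    using assms unfolding set_integrable_def
    by (rule integrable_times_bounded) (use schwartz_measurable[OF bump_schwartz] bump_le_1 in auto)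
  moreover have "(indicator (cbox c d) x *\<^sub>R g x) * bump k c d x = g x * bump k c d x" for x
    using bump_outside[of x c d k] box_subset_cbox[of c d] by (auto simp: indicator_def)
  ultimately show ?thesis by simp
qed

lemma AE_eq_on_open:
  fixes g v :: "'a::euclidean_space \<Rightarrow> complex"
  assumes \<Omega>: "open \<Omega>"
    and g: "\<And>a b. cbox a b \<subseteq> \<Omega> \<Longrightarrow> set_integrable lborel (cbox a b) g"
    and v: "\<And>a b. cbox a b \<subseteq> \<Omega> \<Longrightarrow> set_integrable lborel (cbox a b) v"
    and test: "\<And>c d k. cbox c d \<subseteq> \<Omega> \<Longrightarrow> (LINT x|lborel. g x * bump k c d x) = (LINT x|lborel. v x * bump k c d x)"
  shows "AE x in lborel. x \<in> \<Omega> \<longrightarrow> g x = v x"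
proof -
  have "AE x in lborel. x \<in> \<Omega> \<longrightarrow> g x - v x = 0"
  proof (rule AE_zero_on_open[OF \<Omega>])
    show "set_integrable lborel (cbox a b) (\<lambda>x. g x - v x)" if "cbox a b \<subseteq> \<Omega>" for a b
      using g[OF that] v[OF that] by (rule set_integral_diff)
    show "(LINT x|lborel. (g x - v x) * bump k c d x) = 0" if "cbox c d \<subseteq> \<Omega>" for c d k
    proof -
      have "(LINT x|lborel. (g x - v x) * bump k c d x) = (LINT x|lborel. g x * bump k c d x - v x * bump k c d x)"
        by (simp add: left_diff_distrib)
      also have "\<dots> = (LINT x|lborel. g x * bump k c d x) - (LINT x|lborel. v x * bump k c d x)"
        by (intro Bochner_Integration.integral_diff integrable_times_bump g v that)
      finally show ?thesis using test[OF that] by simp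
    qed
  qed
  then show ?thesis by eventually_elim auto
qed

lemma regular_dist_unique:
  fixes g v :: "'a::euclidean_space \<Rightarrow> complex"
  assumes "\<And>a b. set_integrable lborel (cbox a b) g" "\<And>a b. set_integrable lborel (cbox a b) v"
    and "regular_dist g = regular_dist v"
  shows "AE x in lborel. g x = v x"
proof -
  have "(LINT x|lborel. g x * bump k c d x) = (LINT x|lborel. v x * bump k c d x)" for k c d
    using fun_cong[OF assms(3), of "bump k c d"] bump_schwartz[of k c d] by (simp add: regular_dist_def)
  then have "AE x in lborel. x \<in> UNIV \<longrightarrow> g x = v x"
    using assms(1,2) by (intro AE_eq_on_open) auto
  then show ?thesis by simp
qed

lemma continuous_locally_integrable:
  fixes v :: "'a::euclidean_space \<Rightarrow> complex"
  assumes "continuous_on (cbox a b) v" shows "set_integrable lborel (cbox a b) v"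
  unfolding set_integrable_def by (rule borel_integrable_compact[OF compact_cbox assms])

text \<open>The set where two continuous functions differ is open, and a nonempty open set is not negligible.\<close>

lemma continuous_AE_eq:
  fixes g v :: "'a::euclidean_space \<Rightarrow> 'b::real_normed_vector"
  assumes \<Omega>: "open \<Omega>" and g: "continuous_on \<Omega> g" "continuous_on \<Omega> v" and ae: "AE x in lborel. x \<in> \<Omega> \<longrightarrow> g x = v x"
    and x: "x \<in> \<Omega>"
  shows "g x = v x"
proof (rule ccontr)
  assume ne: "g x \<noteq> v x"
  define U where "U = {y \<in> \<Omega>. g y - v y \<noteq> 0}"
  have "open U"
  proof -
    have "continuous_on \<Omega> (\<lambda>y. g y - v y)" using g by (intro continuous_intros)
    then have "open (\<Omega> \<inter> (\<lambda>y. g y - v y) -` (- {0}))" using \<Omega> by (rule continuous_open_preimage) auto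
    moreover have "\<Omega> \<inter> (\<lambda>y. g y - v y) -` (- {0}) = U" by (auto simp: U_def)
    ultimately show ?thesis by simp
  qed
  moreover have "U \<noteq> {}" using x ne by (auto simp: U_def)
  ultimately have "\<not> negligible U" by (rule open_not_negligible)
  moreover have "negligible U"
  proof -
    have "U \<in> sets lborel" using \<open>open U\<close> by simp
    moreover have "AE y in lborel. y \<notin> U" using ae by eventually_elim (auto simp: U_def)
    ultimately have "U \<in> null_sets lborel" by (simp add: AE_iff_null_sets)
    then show ?thesis by (simp add: negligible_iff_null_sets null_sets_completionI)
  qed
  ultimately show False by simp
qed

lemma Lq_restrict_locally_integrable:
  fixes g :: "'a::euclidean_space \<Rightarrow> complex"
  assumes \<Omega>: "open \<Omega>" and q: "1 \<le> q" and g: "g \<in> Lq_space q (restrict_space lborel \<Omega>)" and ab: "cbox a b \<subseteq> \<Omega>"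
  shows "set_integrable lborel (cbox a b) g"
proof -
  have O[simp]: "\<Omega> \<inter> space lborel \<in> sets lborel" using \<Omega> by simp
  define G where "G x = indicator \<Omega> x *\<^sub>R g x" for x
  have Gm[measurable]: "G \<in> borel_measurable lborel"
  proof -
    have "g \<in> borel_measurable (restrict_space lborel \<Omega>)" using g by (simp add: Lq_space_def)
    then show ?thesis unfolding G_def using borel_measurable_restrict_space_iff[OF O, of g] by simp
  qed
  have "set_integrable lborel (cbox a b) G"
  proof (cases "q = \<infinity>")
    case True
    then obtain C where "AE x in restrict_space lborel \<Omega>. norm (g x) \<le> C" using g by (auto simp: Lq_space_def)
    then have C: "AE x in lborel. x \<in> \<Omega> \<longrightarrow> norm (g x) \<le> C" by (subst (asm) AE_restrict_space_iff[OF O])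
    show ?thesis unfolding set_integrable_def
    proof (rule Bochner_Integration.integrable_bound)
      show "integrable lborel (\<lambda>x. C * indicator (cbox a b) x)" by (intro integrable_mult_right) (use emeasure_bounded_finite[OF bounded_cbox, of a b] in \<open>simp add: integrable_indicator_iff\<close>)
      show "AE x in lborel. norm (indicator (cbox a b) x *\<^sub>R G x) \<le> norm (C * indicator (cbox a b) x)"
        using C by eventually_elim (use ab in \<open>auto simp: G_def indicator_def\<close>)
    qed measurable
  next
    case False
    define r where "r = enn2real q"
    have qr: "q = ennreal r" using False by (simp add: r_def less_top)
    have r: "r \<ge> 1" using q unfolding qr by simp
    have "integrable (restrict_space lborel \<Omega>) (\<lambda>x. norm (g x) powr r)"
      using g r unfolding qr by (simp add: Lq_space_finite_iff)
    then have "integrable lborel (\<lambda>x. indicator \<Omega> x *\<^sub>R norm (g x) powr r)" by (subst (asm) integrable_restrict_space[OF O])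
    moreover have "indicator \<Omega> x *\<^sub>R norm (g x) powr r = norm (G x) powr r" for x by (simp add: G_def indicator_def)
    ultimately have "integrable lborel (\<lambda>x. norm (G x) powr r)" by simp
    then show ?thesis by (intro locally_integrable_powr[OF Gm r])
  qed
  moreover have "indicator (cbox a b) x *\<^sub>R G x = indicator (cbox a b) x *\<^sub>R g x" for x
    using ab by (auto simp: G_def indicator_def)
  ultimately show ?thesis by (simp add: set_integrable_def)
qed

lemma Lq_locally_integrable:
  fixes g :: "'a::euclidean_space \<Rightarrow> complex"
  assumes q: "1 \<le> q" and g: "g \<in> Lq_space q lborel"
  shows "set_integrable lborel (cbox a b) g"
proof -
  have "restrict_space lborel UNIV = (lborel :: 'a measure)"
    by (rule measure_eqI) (auto simp: sets_restrict_space emeasure_restrict_space)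
  then show ?thesis using Lq_restrict_locally_integrable[of UNIV q g a b] q g by simp
qed

section \<open>The potential as the continuous representative\<close>

text \<open>Any density will do: it is unique up to null sets by \<open>regular_dist_unique\<close>.\<close>

definition bessel_density :: "real \<Rightarrow> real \<Rightarrow> real \<Rightarrow> (('a::euclidean_space \<Rightarrow> complex) \<Rightarrow> complex) \<Rightarrow> 'a \<Rightarrow> complex" where
  "bessel_density p lam s u = (SOME f. f \<in> Lq_space (ennreal p) lborel \<and> log_bessel_op lam s u = regular_dist f)"

text \<open>The continuous function that represents \<open>u\<close> in the critical case.\<close>

definition bessel_rep :: "real \<Rightarrow> real \<Rightarrow> real \<Rightarrow> (('a::euclidean_space \<Rightarrow> complex) \<Rightarrow> complex) \<Rightarrow> 'a \<Rightarrow> complex" where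
  "bessel_rep p lam s u = potential lam s (bessel_density p lam s u)"

lemma bessel_density:
  assumes "u \<in> log_bessel_space p lam s"
  shows "bessel_density p lam s u \<in> Lq_space (ennreal p) lborel" "log_bessel_op lam s u = regular_dist (bessel_density p lam s u)"
proof -
  have "\<exists>f. f \<in> Lq_space (ennreal p) lborel \<and> log_bessel_op lam s u = regular_dist f"
    using assms by (auto simp: log_bessel_space_def)
  from someI_ex[OF this] show "bessel_density p lam s u \<in> Lq_space (ennreal p) lborel" "log_bessel_op lam s u = regular_dist (bessel_density p lam s u)"
    unfolding bessel_density_def by auto
qed

lemma log_bessel_norm_eq:
  assumes p: "p > 1" and u: "u \<in> log_bessel_space p lam s"
  shows "log_bessel_norm p lam s u = Lq_norm (ennreal p) lborel (bessel_density p lam s u)"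
  unfolding log_bessel_norm_def
proof (rule the_equality)
  show "\<exists>f\<in>Lq_space (ennreal p) lborel. log_bessel_op lam s u = regular_dist f \<and> Lq_norm (ennreal p) lborel (bessel_density p lam s u) = Lq_norm (ennreal p) lborel f"
    using bessel_density[OF u] by blast
  fix r assume "\<exists>f\<in>Lq_space (ennreal p) lborel. log_bessel_op lam s u = regular_dist f \<and> r = Lq_norm (ennreal p) lborel f"
  then obtain f where f: "f \<in> Lq_space (ennreal p) lborel" "log_bessel_op lam s u = regular_dist f" "r = Lq_norm (ennreal p) lborel f" by blast
  have p1: "1 \<le> ennreal p" using p by simp
  have "AE x in lborel. f x = bessel_density p lam s u x"
    using f(2) bessel_density(2)[OF u] by (intro regular_dist_unique Lq_locally_integrable[OF p1] f(1) bessel_density(1)[OF u]) simp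
  then show "r = Lq_norm (ennreal p) lborel (bessel_density p lam s u)"
    unfolding f(3) using f(1) bessel_density(1)[OF u] by (intro Lq_norm_AE_cong) (auto simp: Lq_space_def)
qed

text \<open>Both norms are at most their maximum, so their sum is at most twice it.\<close>

lemma norm_diff_powr_le:
  fixes a b :: complex
  assumes p: "p > 1"
  shows "norm (a - b) powr p \<le> 2 powr p * (norm a powr p + norm b powr p)"
proof -
  have "norm (a - b) \<le> 2 * max (norm a) (norm b)" using norm_triangle_ineq4[of a b] by linarith
  then have "norm (a - b) powr p \<le> (2 * max (norm a) (norm b)) powr p" using p by (intro powr_mono2) auto
  also have "\<dots> = 2 powr p * max (norm a) (norm b) powr p" by (simp add: powr_mult)
  also have "max (norm a) (norm b) powr p \<le> norm a powr p + norm b powr p" by (simp add: max_def)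
  finally show ?thesis by simp
qed

text \<open>The shape in which the norms of the differences are estimated: nonnegative, and eventually at most a fixed multiple of
  every \<open>e > 0\<close>.\<close>

lemma LIMSEQ_zero_from_bounds:
  assumes "A \<ge> (0::real)" "\<And>e. e > 0 \<Longrightarrow> \<exists>N. \<forall>k\<ge>N. 0 \<le> a k \<and> a k \<le> A * e"
  shows "a \<longlonglongrightarrow> 0"
proof (rule LIMSEQ_I)
  fix e :: real assume e: "e > 0"
  then obtain N where N: "\<forall>k\<ge>N. 0 \<le> a k \<and> a k \<le> A * (e / (A + 1))"
    using assms(2)[of "e / (A + 1)"] assms(1) by auto
  have "A * (e / (A + 1)) < e" using assms(1) e by (simp add: field_simps)
  then show "\<exists>N. \<forall>k\<ge>N. norm (a k - 0) < e" using N by (intro exI[of _ N]) fastforce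
qed

lemma bounded_range_nonneg:
  fixes a :: "nat \<Rightarrow> real"
  assumes "bounded (range a)"
  obtains B where "B > 0" "\<And>k. a k \<le> B"
proof -
  obtain B where B: "\<And>k. norm (a k) \<le> B" using assms by (auto simp: bounded_iff)
  show ?thesis
  proof (rule that[of "max B 1"])
    show "a k \<le> max B 1" for k using B[of k] by auto
  qed simp
qed

type_synonym 'a distr = "('a \<Rightarrow> complex) \<Rightarrow> complex"

context
  fixes lam s p :: real
  assumes lam: "lam > 1" and s: "s > 0" and p: "p > 1"
begin

interpretation finite_measure "heat_mixture lam s" by (rule finite_measure_heat_mixture[OF lam s])
interpretation PM: pair_sigma_finite "heat_mixture lam s" "lborel :: 'a::euclidean_space measure" ..

abbreviation (input) "X \<equiv> log_bessel_space p lam s"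
abbreviation (input) "Xr \<equiv> log_bessel_space_rad p lam s"
abbreviation (input) "nrm \<equiv> log_bessel_norm p lam s"
abbreviation (input) "V \<equiv> bessel_rep p lam s"

lemma nn_integral_norm_abs_potential:
  fixes f :: "'a::euclidean_space \<Rightarrow> complex"
  assumes [measurable]: "f \<in> borel_measurable borel"
  shows "(\<integral>\<^sup>+z. ennreal (norm (of_real (heat (fst z) (x - snd z)) * f (snd z))) \<partial>(heat_mixture lam s \<Otimes>\<^sub>M lborel)) = abs_potential lam s (\<lambda>y. norm (f y)) x"
  unfolding abs_potential_def by (subst lborel.nn_integral_fst[symmetric]) (auto simp: norm_mult)

text \<open>The absolute value \<open>\<bar>r\<bar>\<close> agrees with \<open>r\<close> almost everywhere for the mixture and keeps the Gaussian bounded by \<open>1\<close>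
  everywhere.\<close>

lemma symbol_inverse_mixture:
  "of_real (inverse (log_bessel_symbol lam s y)) = (LINT r|heat_mixture lam s. complex_of_real (exp (- (4 * pi\<^sup>2 * \<bar>r\<bar>) * (norm (y::'a::euclidean_space))\<^sup>2)))"
proof -
  let ?q = "4 * pi\<^sup>2 * (norm y)\<^sup>2"
  have "(\<integral>\<^sup>+r. ennreal (exp (- (4 * pi\<^sup>2 * \<bar>r\<bar>) * (norm y)\<^sup>2)) \<partial>heat_mixture lam s) = (\<integral>\<^sup>+r. ennreal (exp (- (?q * r))) \<partial>heat_mixture lam s)"
    by (intro nn_integral_cong_AE eventually_mono[OF AE_heat_mixture_pos[of lam s]]) (simp add: mult_ac)
  also have "\<dots> = ennreal (inverse (log_bessel_symbol lam s y))"
    unfolding log_bessel_symbol_def by (rule heat_mixture_laplace[OF lam s]) simp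
  finally have "(LINT r|heat_mixture lam s. exp (- (4 * pi\<^sup>2 * \<bar>r\<bar>) * (norm y)\<^sup>2)) = inverse (log_bessel_symbol lam s y)"
    using log_bessel_symbol_pos[OF lam, of s y] by (subst integral_eq_nn_integral) auto
  then show ?thesis by (simp only: integral_complex_of_real)
qed

lemma fourier_symbol_inverse:
  assumes \<phi>: "\<phi> \<in> schwartz"
  shows "fourier (\<lambda>\<xi>. of_real (inverse (log_bessel_symbol lam s \<xi>)) * inv_fourier \<phi> \<xi>) (y::'a::euclidean_space) =
    (LINT r|heat_mixture lam s. (LINT x|lborel. \<phi> x * of_real (heat r (x - y))))"
proof -
  let ?E = "\<lambda>r \<xi>. complex_of_real (exp (- (4 * pi\<^sup>2 * \<bar>r\<bar>) * (norm (\<xi>::'a))\<^sup>2))"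
  have [measurable]: "inv_fourier \<phi> \<in> borel_measurable borel"
    using schwartz_measurable \<phi> inv_fourier_schwartz by auto
  have "fourier (\<lambda>\<xi>. of_real (inverse (log_bessel_symbol lam s \<xi>)) * inv_fourier \<phi> \<xi>) y =
    (LINT \<xi>|lborel. (LINT r|heat_mixture lam s. 1 * inv_fourier \<phi> \<xi> * (?E r \<xi> * echar (- y) \<xi>)))"
    unfolding fourier_reflect inv_fourier_echar[of _ "- y"] symbol_inverse_mixture
    by (simp add: integral_mult_left_zero[symmetric] integral_mult_right_zero[symmetric] mult_ac)
  also have "\<dots> = (LINT r|heat_mixture lam s. (LINT \<xi>|lborel. 1 * inv_fourier \<phi> \<xi> * (?E r \<xi> * echar (- y) \<xi>)))"
  proof (rule PM.Fubini_integral)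
    have "integrable (heat_mixture lam s \<Otimes>\<^sub>M lborel) (\<lambda>(r, \<xi>). 1 * inv_fourier \<phi> \<xi> * (?E r \<xi> * echar (- y) \<xi>))"
      by (rule integrable_product_kernel)
         (use schwartz_integrable[OF inv_fourier_schwartz[OF \<phi>]] sigma_finite_measure_axioms sigma_finite_lborel in \<open>auto simp: norm_mult\<close>)
    then show "integrable (heat_mixture lam s \<Otimes>\<^sub>M lborel) (\<lambda>(r, \<xi>). 1 * inv_fourier \<phi> \<xi> * (?E r \<xi> * echar (- y) \<xi>))" .
  qed
  also have "\<dots> = (LINT r|heat_mixture lam s. (LINT x|lborel. \<phi> x * of_real (heat r (x - y))))"
  proof (rule integral_cong_AE)
    show "AE r in heat_mixture lam s. (LINT \<xi>|lborel. 1 * inv_fourier \<phi> \<xi> * (?E r \<xi> * echar (- y) \<xi>)) = (LINT x|lborel. \<phi> x * of_real (heat r (x - y)))"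
      using AE_heat_mixture_pos
    proof eventually_elim
      fix r :: real assume "0 < r"
      then show "(LINT \<xi>|lborel. 1 * inv_fourier \<phi> \<xi> * (?E r \<xi> * echar (- y) \<xi>)) = (LINT x|lborel. \<phi> x * of_real (heat r (x - y)))"
        using fourier_heat_conv[OF \<phi>, of r y]
        unfolding fourier_reflect inv_fourier_echar[of _ "- y"] by (simp add: mult_ac)
    qed
    have [measurable]: "\<phi> \<in> borel_measurable borel" using schwartz_measurable[OF \<phi>] .
    show "(\<lambda>r. LINT \<xi>|lborel. 1 * inv_fourier \<phi> \<xi> * (?E r \<xi> * echar (- y) \<xi>)) \<in> borel_measurable (heat_mixture lam s)"
      "(\<lambda>r. LINT x|lborel. \<phi> x * of_real (heat r (x - y))) \<in> borel_measurable (heat_mixture lam s)"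
      by measurable
  qed
  finally show ?thesis .
qed

lemma nrm_nonneg: "u \<in> X \<Longrightarrow> nrm u \<ge> 0"
  using log_bessel_norm_eq[OF p, of u lam s] Lq_norm_nonneg_finite[of p lborel "bessel_density p lam s u"] p by simp

context
  assumes n: "real DIM('a::euclidean_space) = 2 * s * p"
begin

lemma potential_integrable:
  fixes f :: "'a::euclidean_space \<Rightarrow> complex"
  assumes F: "Lp_bound p (\<lambda>y. norm (f y)) N" and [measurable]: "f \<in> borel_measurable borel"
  shows "integrable (heat_mixture lam s \<Otimes>\<^sub>M lborel) (\<lambda>z. of_real (heat (fst z) (x - snd z)) * f (snd z))"
proof (rule integrableI_bounded)
  obtain C where "abs_potential lam s (\<lambda>y. norm (f y)) x \<le> ennreal (C * N)" using abs_potential_sup_bound[OF p n s lam] F by metis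
  then show "(\<integral>\<^sup>+z. ennreal (norm (of_real (heat (fst z) (x - snd z)) * f (snd z))) \<partial>(heat_mixture lam s \<Otimes>\<^sub>M lborel)) < \<infinity>"
    unfolding nn_integral_norm_abs_potential[OF assms(2)] by (auto intro: le_less_trans)
qed measurable

lemma norm_potential_le_abs_potential:
  fixes f :: "'a::euclidean_space \<Rightarrow> complex"
  assumes F: "Lp_bound p (\<lambda>y. norm (f y)) N" and f: "f \<in> borel_measurable borel"
  shows "ennreal (norm (potential lam s f x)) \<le> abs_potential lam s (\<lambda>y. norm (f y)) x"
  unfolding potential_def nn_integral_norm_abs_potential[OF f, symmetric]
  by (rule integral_norm_bound_ennreal[OF potential_integrable[OF F f]])

lemma potential_bound:
  obtains C where "C > 0" "\<And>f :: 'a \<Rightarrow> complex. \<And>x. f \<in> Lq_space (ennreal p) lborel \<Longrightarrow>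
    norm (potential lam s f x) \<le> C * Lq_norm (ennreal p) lborel f"
proof -
  obtain C where C: "C > 0" "\<And>F N x. Lp_bound p (F :: 'a \<Rightarrow> real) N \<Longrightarrow> abs_potential lam s F x \<le> ennreal (C * N)"
    using abs_potential_sup_bound[OF p n s lam] by blast
  show ?thesis
  proof (rule that[OF C(1)])
    fix f :: "'a \<Rightarrow> complex" and x assume f: "f \<in> Lq_space (ennreal p) lborel"
    have F: "Lp_bound p (\<lambda>y. norm (f y)) (Lq_norm (ennreal p) lborel f)" using Lp_bound_norm[OF _ f] p by simp
    have fm: "f \<in> borel_measurable borel" using f p by (simp add: Lq_space_finite_iff)
    have N: "Lq_norm (ennreal p) lborel f \<ge> 0" by (rule Lq_norm_nonneg_finite) (use p in simp)
    have "ennreal (norm (potential lam s f x)) \<le> ennreal (C * Lq_norm (ennreal p) lborel f)"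
      using norm_potential_le_abs_potential[OF F fm] C(2)[OF F] order_trans by blast
    then show "norm (potential lam s f x) \<le> C * Lq_norm (ennreal p) lborel f"
      using C(1) N by (subst (asm) ennreal_le_iff) auto
  qed
qed

lemma potential_equicontinuous:
  assumes e: "\<epsilon> > 0"
  obtains d where "d > 0" "\<And>f :: 'a \<Rightarrow> complex. \<And>x x'. f \<in> Lq_space (ennreal p) lborel \<Longrightarrow> norm (x - x') \<le> d \<Longrightarrow>
    norm (potential lam s f x - potential lam s f x') \<le> \<epsilon> * Lq_norm (ennreal p) lborel f"
proof -
  obtain d where d: "d > 0" "\<And>F N x x'. Lp_bound p (F :: 'a \<Rightarrow> real) N \<Longrightarrow> norm (x - x') \<le> d \<Longrightarrow>
    (\<integral>\<^sup>+r. (\<integral>\<^sup>+y. ennreal (\<bar>heat r (x - y) - heat r (x' - y)\<bar> * F y) \<partial>lborel) \<partial>heat_mixture lam s) \<le> ennreal (\<epsilon> * N)"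
    using abs_potential_equicontinuous[OF p n s lam e] by blast
  show ?thesis
  proof (rule that[OF d(1)])
    fix f :: "'a \<Rightarrow> complex" and x x' :: 'a assume f: "f \<in> Lq_space (ennreal p) lborel" and x: "norm (x - x') \<le> d"
    have F: "Lp_bound p (\<lambda>y. norm (f y)) (Lq_norm (ennreal p) lborel f)" using Lp_bound_norm[OF _ f] p by simp
    have fm[measurable]: "f \<in> borel_measurable borel" using f p by (simp add: Lq_space_finite_iff)
    have N: "Lq_norm (ennreal p) lborel f \<ge> 0" by (rule Lq_norm_nonneg_finite) (use p in simp)
    let ?g = "\<lambda>z. of_real (heat (fst z) (x - snd z)) * f (snd z) - of_real (heat (fst z) (x' - snd z)) * f (snd z)"
    have i: "integrable (heat_mixture lam s \<Otimes>\<^sub>M lborel) ?g"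
      by (intro Bochner_Integration.integrable_diff potential_integrable[OF F fm])
    have "potential lam s f x - potential lam s f x' = (LINT z|(heat_mixture lam s \<Otimes>\<^sub>M lborel). ?g z)"
      unfolding potential_def by (intro Bochner_Integration.integral_diff[symmetric] potential_integrable[OF F fm])
    then have "ennreal (norm (potential lam s f x - potential lam s f x')) \<le> (\<integral>\<^sup>+z. ennreal (norm (?g z)) \<partial>(heat_mixture lam s \<Otimes>\<^sub>M lborel))"
      using integral_norm_bound_ennreal[OF i] by simp
    also have "\<dots> = (\<integral>\<^sup>+r. (\<integral>\<^sup>+y. ennreal (\<bar>heat r (x - y) - heat r (x' - y)\<bar> * norm (f y)) \<partial>lborel) \<partial>heat_mixture lam s)"
      by (subst lborel.nn_integral_fst[symmetric])
         (auto simp: left_diff_distrib[symmetric] norm_mult of_real_diff[symmetric] simp del: of_real_diff)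
    also have "\<dots> \<le> ennreal (\<epsilon> * Lq_norm (ennreal p) lborel f)" by (rule d(2)[OF F x])
    finally show "norm (potential lam s f x - potential lam s f x') \<le> \<epsilon> * Lq_norm (ennreal p) lborel f"
      using e N by (subst (asm) ennreal_le_iff) auto
  qed
qed

lemma potential_continuous:
  fixes f :: "'a::euclidean_space \<Rightarrow> complex"
  assumes f: "f \<in> Lq_space (ennreal p) lborel"
  shows "continuous_on A (potential lam s f)"
proof -
  have "continuous_on UNIV (potential lam s f)"
    unfolding continuous_on_iff
  proof (intro ballI allI impI)
    fix x :: 'a and e :: real assume e: "e > 0"
    let ?N = "Lq_norm (ennreal p) lborel f"
    have N: "?N \<ge> 0" by (rule Lq_norm_nonneg_finite) (use p in simp)
    have e': "e / (?N + 1) > 0" using e N by simp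
    obtain d where d: "d > 0" "\<And>f :: 'a \<Rightarrow> complex. \<And>x x'. f \<in> Lq_space (ennreal p) lborel \<Longrightarrow> norm (x - x') \<le> d \<Longrightarrow>
    norm (potential lam s f x - potential lam s f x') \<le> e / (?N + 1) * Lq_norm (ennreal p) lborel f"
      using potential_equicontinuous[OF e'] by blast
    have "e / (?N + 1) * ?N < e" using e N by (simp add: field_simps)
    then show "\<exists>d>0. \<forall>x'\<in>UNIV. dist x' x < d \<longrightarrow> dist (potential lam s f x') (potential lam s f x) < e"
    proof (intro exI[of _ d] conjI ballI impI d(1))
      fix x' assume "dist x' x < d"
      then have "norm (potential lam s f x' - potential lam s f x) \<le> e / (?N + 1) * ?N"
        by (intro d(2)[OF f]) (simp add: dist_norm)
      also have "\<dots> < e" by fact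
      finally show "dist (potential lam s f x') (potential lam s f x) < e" by (simp add: dist_norm)
    qed
  qed
  then show ?thesis using continuous_on_subset by blast
qed

lemma potential_Lp:
  fixes f :: "'a::euclidean_space \<Rightarrow> complex"
  assumes f: "f \<in> Lq_space (ennreal p) lborel"
  shows "(\<integral>\<^sup>+x. ennreal (norm (potential lam s f x) powr p) \<partial>lborel) \<le> ennreal ((mixture_mass lam s * Lq_norm (ennreal p) lborel f) powr p)"
proof -
  have F: "Lp_bound p (\<lambda>y. norm (f y)) (Lq_norm (ennreal p) lborel f)" using Lp_bound_norm[OF _ f] p by simp
  have fm[measurable]: "f \<in> borel_measurable borel" using f p by (simp add: Lq_space_finite_iff)
  show ?thesis by (rule abs_potential_Lp_bound[OF p s lam F _ norm_potential_le_abs_potential[OF F fm]]) simp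
qed

text \<open>The potential operator is symmetric, since the heat kernel is even. The bound on \<open>abs_potential\<close> makes the triple integral
  absolutely convergent.\<close>

lemma potential_pairing:
  fixes f :: "'a::euclidean_space \<Rightarrow> complex"
  assumes f: "f \<in> Lq_space (ennreal p) lborel" and \<phi>: "\<phi> \<in> schwartz"
  shows "(LINT y|lborel. f y * fourier (\<lambda>\<xi>. of_real (inverse (log_bessel_symbol lam s \<xi>)) * inv_fourier \<phi> \<xi>) y) =
    (LINT x|lborel. potential lam s f x * \<phi> x)" (is "?L = ?R")
    and "integrable lborel (\<lambda>x. potential lam s f x * \<phi> x)"
proof -
  have F: "Lp_bound p (\<lambda>y. norm (f y)) (Lq_norm (ennreal p) lborel f)" using Lp_bound_norm[OF _ f] p by simp
  have fm[measurable]: "f \<in> borel_measurable borel" using f p by (simp add: Lq_space_finite_iff)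
  have \<phi>m[measurable]: "\<phi> \<in> borel_measurable borel" using schwartz_measurable[OF \<phi>] .
  obtain C where C: "C > 0" "\<And>F N x. Lp_bound p (F :: 'a \<Rightarrow> real) N \<Longrightarrow> abs_potential lam s F x \<le> ennreal (C * N)"
    using abs_potential_sup_bound[OF p n s lam] by blast
  let ?M = "heat_mixture lam s \<Otimes>\<^sub>M (lborel :: 'a measure)"
  have sf: "sigma_finite_measure ?M"
    by (intro sigma_finite_pair_measure sigma_finite_lborel sigma_finite_measure_axioms)
  interpret T: pair_sigma_finite "lborel :: 'a measure" ?M
    by (intro pair_sigma_finite.intro sigma_finite_lborel sigma_finite_pair_measure sigma_finite_measure_axioms)
  define A where "A x z = \<phi> x * (of_real (heat (fst z) (x - snd z)) * f (snd z))" for x and z :: "real \<times> 'a"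
  have [measurable]: "case_prod A \<in> borel_measurable (lborel \<Otimes>\<^sub>M ?M)" unfolding A_def case_prod_unfold by measurable
  have iA: "integrable (lborel \<Otimes>\<^sub>M ?M) (case_prod A)"
  proof (rule integrableI_bounded)
    have "(\<integral>\<^sup>+w. ennreal (norm (case_prod A w)) \<partial>(lborel \<Otimes>\<^sub>M ?M)) = (\<integral>\<^sup>+x. (\<integral>\<^sup>+z. ennreal (norm (A x z)) \<partial>?M) \<partial>lborel)"
      by (subst sigma_finite_measure.nn_integral_fst[OF sf, symmetric]) (auto simp: case_prod_unfold)
    also have "\<dots> = (\<integral>\<^sup>+x. ennreal (norm (\<phi> x)) * abs_potential lam s (\<lambda>y. norm (f y)) x \<partial>lborel)"
      unfolding A_def norm_mult[of "\<phi> _"] nn_integral_norm_abs_potential[OF fm, symmetric]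
      by (intro nn_integral_cong) (simp add: ennreal_mult nn_integral_cmult)
    also have "\<dots> \<le> (\<integral>\<^sup>+x. ennreal (norm (\<phi> x)) * ennreal (C * Lq_norm (ennreal p) lborel f) \<partial>lborel)"
      by (intro nn_integral_mono mult_left_mono C(2)[OF F]) auto
    also have "\<dots> = (\<integral>\<^sup>+x. ennreal (norm (\<phi> x)) \<partial>lborel) * ennreal (C * Lq_norm (ennreal p) lborel f)"
      by (rule nn_integral_multc) simp
    also have "\<dots> < \<infinity>" using schwartz_integrable[OF \<phi>] by (simp add: integrable_iff_bounded ennreal_mult_less_top)
    finally show "(\<integral>\<^sup>+w. ennreal (norm (case_prod A w)) \<partial>(lborel \<Otimes>\<^sub>M ?M)) < \<infinity>" .
  qed measurable
  have pA: "(LINT z|?M. A x z) = potential lam s f x * \<phi> x" for x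
    unfolding A_def potential_def by (simp add: mult.commute)
  show "integrable lborel (\<lambda>x. potential lam s f x * \<phi> x)"
    using T.integrable_fst[OF iA] unfolding pA .
  have iB: "integrable ?M (\<lambda>z. LINT x|lborel. A x z)" using T.integrable_snd[OF iA] .
  have qA: "(LINT x|lborel. A x (r, y)) = f y * (LINT x|lborel. \<phi> x * of_real (heat r (x - y)))" for r y
    unfolding A_def by (simp add: integral_mult_right_zero[symmetric] mult_ac)
  have "?R = (LINT x|lborel. (LINT z|?M. A x z))" unfolding pA ..
  also have "\<dots> = (LINT z|?M. (LINT x|lborel. A x z))" by (rule T.Fubini_integral[OF iA, symmetric])
  also have "\<dots> = (LINT y|lborel. (LINT r|heat_mixture lam s. (LINT x|lborel. A x (r, y))))"
    using PM.integral_snd[of "\<lambda>r y. LINT x|lborel. A x (r, y)"] iB by (simp add: case_prod_unfold)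
  also have "\<dots> = ?L" unfolding qA fourier_symbol_inverse[OF \<phi>] by simp
  finally show "?L = ?R" ..
qed

text \<open>Test the equation for \<open>u\<close> on \<open>\<psi> = fourier (inv_fourier \<phi> / symbol)\<close>. The operator applied to \<open>\<psi>\<close> under the transposition
  gives back \<open>\<phi>\<close>, while the density paired with \<open>\<psi>\<close> is the potential paired with \<open>\<phi>\<close>.\<close>

lemma representation:
  fixes f :: "'a::euclidean_space \<Rightarrow> complex"
  assumes f: "f \<in> Lq_space (ennreal p) lborel"
    and u: "u \<in> tempered_distributions" "log_bessel_op lam s u = regular_dist f"
  shows "u = regular_dist (potential lam s f)"
proof (rule extensionalityI[of _ schwartz])
  show "u \<in> extensional schwartz" using u(1) by (simp add: tempered_distributions_def)
  show "regular_dist (potential lam s f) \<in> extensional schwartz" by (simp add: regular_dist_def)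
  fix \<phi> :: "'a \<Rightarrow> complex" assume \<phi>: "\<phi> \<in> schwartz"
  define m where "m \<xi> = complex_of_real (log_bessel_symbol lam s \<xi>)" for \<xi> :: 'a
  define h where "h \<xi> = of_real (inverse (log_bessel_symbol lam s \<xi>)) * inv_fourier \<phi> \<xi>" for \<xi>
  define \<psi> where "\<psi> = fourier h"
  have g: "inv_fourier \<phi> \<in> schwartz" by (rule inv_fourier_schwartz[OF \<phi>])
  have h: "h \<in> schwartz" unfolding h_def by (rule schwartz_divide_symbol[OF lam s g])
  have \<psi>: "\<psi> \<in> schwartz" unfolding \<psi>_def by (rule fourier_schwartz[OF h])
  have i\<psi>: "inv_fourier \<psi> = h" unfolding \<psi>_def using inv_fourier_fourier[OF h] by auto
  have mh: "(\<lambda>\<xi>. m \<xi> * h \<xi>) = inv_fourier \<phi>"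
  proof
    fix \<xi> show "m \<xi> * h \<xi> = inv_fourier \<phi> \<xi>"
      using log_bessel_symbol_pos[OF lam, of s \<xi>] by (simp add: m_def h_def)
  qed
  have "log_bessel_op lam s u \<psi> = u (fourier (\<lambda>\<xi>. m \<xi> * h \<xi>))"
    unfolding log_bessel_op_def fourier_multiplier_def inv_fourier_dist_def mult_dist_def fourier_dist_def
    using \<psi> h g mh by (simp add: i\<psi> m_def)
  also have "\<dots> = u \<phi>"
  proof -
    have "fourier (inv_fourier \<phi>) = \<phi>" using fourier_inv_fourier[OF \<phi>] by auto
    then show ?thesis unfolding mh by simp
  qed
  finally have "u \<phi> = regular_dist f \<psi>" using u(2) by simp
  also have "\<dots> = (LINT y|lborel. f y * \<psi> y)" using \<psi> by (simp add: regular_dist_def)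
  also have "\<dots> = (LINT x|lborel. potential lam s f x * \<phi> x)"
    unfolding \<psi>_def h_def by (rule potential_pairing(1)[OF f \<phi>])
  also have "\<dots> = regular_dist (potential lam s f) \<phi>" using \<phi> by (simp add: regular_dist_def)
  finally show "u \<phi> = regular_dist (potential lam s f) \<phi>" .
qed

lemma rep_dist:
  assumes u: "(u :: 'a distr) \<in> X"
  shows "u = regular_dist (V u)"
proof -
  have "u \<in> tempered_distributions" using u by (simp add: log_bessel_space_def)
  then show ?thesis
    unfolding bessel_rep_def using bessel_density[OF u] by (intro representation)
qed

lemma rep_continuous:
  assumes u: "(u :: 'a distr) \<in> X"
  shows "continuous_on A (V u)"
  unfolding bessel_rep_def by (rule potential_continuous[OF bessel_density(1)[OF u]])

lemma rep_measurable: "u \<in> X \<Longrightarrow> V (u :: 'a distr) \<in> borel_measurable borel"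
  using rep_continuous by (rule borel_measurable_continuous_onI)

lemma rep_bound:
  obtains C where "C > 0" "\<And>u x. u \<in> X \<Longrightarrow> norm (V (u :: 'a distr) x) \<le> C * nrm u"
proof -
  obtain C where C: "C > 0" "\<And>f :: 'a \<Rightarrow> complex. \<And>x. f \<in> Lq_space (ennreal p) lborel \<Longrightarrow>
    norm (potential lam s f x) \<le> C * Lq_norm (ennreal p) lborel f" using potential_bound by blast
  show ?thesis
  proof (rule that[OF C(1)])
    fix u :: "'a distr" and x assume u: "u \<in> X"
    show "norm (V u x) \<le> C * nrm u"
      using C(2)[OF bessel_density(1)[OF u], of x] log_bessel_norm_eq[OF p u] by (simp add: bessel_rep_def)
  qed
qed

lemma rep_equicontinuous:
  assumes "\<epsilon> > 0"
  obtains d where "d > 0" "\<And>u x x'. u \<in> X \<Longrightarrow> norm (x - x') \<le> d \<Longrightarrow> norm (V (u :: 'a distr) x - V u x') \<le> \<epsilon> * nrm u"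
proof -
  obtain d where d: "d > 0" "\<And>f :: 'a \<Rightarrow> complex. \<And>x x'. f \<in> Lq_space (ennreal p) lborel \<Longrightarrow> norm (x - x') \<le> d \<Longrightarrow>
    norm (potential lam s f x - potential lam s f x') \<le> \<epsilon> * Lq_norm (ennreal p) lborel f"
    using potential_equicontinuous[OF assms] by blast
  show ?thesis
  proof (rule that[OF d(1)])
    fix u :: "'a distr" and x x' :: 'a assume u: "u \<in> X" and x: "norm (x - x') \<le> d"
    show "norm (V u x - V u x') \<le> \<epsilon> * nrm u"
      using d(2)[OF bessel_density(1)[OF u] x] log_bessel_norm_eq[OF p u] by (simp add: bessel_rep_def)
  qed
qed

lemma rep_Lp: "u \<in> X \<Longrightarrow> (\<integral>\<^sup>+x. ennreal (norm (V (u :: 'a distr) x) powr p) \<partial>lborel) \<le> ennreal ((mixture_mass lam s * nrm u) powr p)"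
  using potential_Lp[OF bessel_density(1), of u] log_bessel_norm_eq[OF p, of u lam s] by (simp add: bessel_rep_def)

lemma rep_locally_integrable: "u \<in> X \<Longrightarrow> set_integrable lborel (cbox a b) (V (u :: 'a distr))"
  by (intro continuous_locally_integrable rep_continuous)

lemma restricts_to_rep:
  assumes u: "(u :: 'a distr) \<in> X"
  shows "restricts_to \<Omega> u (V u)"
  unfolding restricts_to_def
proof (intro ballI impI)
  fix \<phi> :: "'a \<Rightarrow> complex" assume \<phi>: "\<phi> \<in> schwartz" "compact (closure {x. \<phi> x \<noteq> 0}) \<and> closure {x. \<phi> x \<noteq> 0} \<subseteq> \<Omega>"
  have "u \<phi> = (LINT x|lborel. V u x * \<phi> x)"
    using fun_cong[OF rep_dist[OF u], of \<phi>] \<phi>(1) by (simp add: regular_dist_def)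
  also have "\<dots> = (LINT x:\<Omega>|lborel. V u x * \<phi> x)"
  proof -
    have "indicator \<Omega> x *\<^sub>R (V u x * \<phi> x) = V u x * \<phi> x" for x
      using \<phi>(2) closure_subset[of "{x. \<phi> x \<noteq> 0}"] by (auto simp: indicator_def)
    then show ?thesis by (simp add: set_lebesgue_integral_def)
  qed
  finally show "u \<phi> = (LINT x:\<Omega>|lborel. V u x * \<phi> x)" .
qed

text \<open>The bumps supported in \<open>\<Omega>\<close> are admissible test functions for the restriction.\<close>

lemma restricts_to_AE:
  assumes \<Omega>: "open \<Omega>" and u: "(u :: 'a distr) \<in> X" and r: "restricts_to \<Omega> u g"
    and g: "\<And>a b. cbox a b \<subseteq> \<Omega> \<Longrightarrow> set_integrable lborel (cbox a b) g"
  shows "AE x in lborel. x \<in> \<Omega> \<longrightarrow> g x = V u x"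
proof (rule AE_eq_on_open[OF \<Omega> g rep_locally_integrable[OF u]])
  fix c d k assume cd: "cbox c d \<subseteq> \<Omega>"
  have "u (bump k c d) = (LINT x:\<Omega>|lborel. g x * bump k c d x)"
    using r[unfolded restricts_to_def, rule_format, OF bump_schwartz[of k c d]] bump_support[of k c d] cd by simp
  also have "\<dots> = (LINT x|lborel. g x * bump k c d x)"
  proof -
    have "indicator \<Omega> x *\<^sub>R (g x * bump k c d x) = g x * bump k c d x" for x
      using cd bump_outside[of x c d k] box_subset_cbox[of c d] by (auto simp: indicator_def)
    then show ?thesis by (simp add: set_lebesgue_integral_def)
  qed
  finally have "(LINT x|lborel. g x * bump k c d x) = u (bump k c d)" ..
  also have "\<dots> = (LINT x|lborel. V u x * bump k c d x)"
    using fun_cong[OF rep_dist[OF u], of "bump k c d"] bump_schwartz[of k c d] by (simp add: regular_dist_def)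
  finally show "(LINT x|lborel. g x * bump k c d x) = (LINT x|lborel. V u x * bump k c d x)" .
qed

text \<open>On \<open>\<Omega>\<close> the two continuous functions agree because they agree almost everywhere, and the closure follows by continuity.\<close>

lemma restricts_to_continuous:
  assumes \<Omega>: "open \<Omega>" and u: "(u :: 'a distr) \<in> X" and r: "restricts_to \<Omega> u g"
    and g: "g \<in> C_space (closure \<Omega>)" and x: "x \<in> closure \<Omega>"
  shows "g x = V u x"
proof -
  have c: "continuous_on (closure \<Omega>) g" using g by (simp add: C_space_def)
  have c': "continuous_on \<Omega> g" by (rule continuous_on_subset[OF c closure_subset])
  have ae: "AE x in lborel. x \<in> \<Omega> \<longrightarrow> g x = V u x"
    by (rule restricts_to_AE[OF \<Omega> u r]) (rule continuous_locally_integrable, rule continuous_on_subset[OF c'])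
  have "g x - V u x = 0"
  proof (rule continuous_constant_on_closure[of \<Omega> "\<lambda>x. g x - V u x"])
    show "continuous_on (closure \<Omega>) (\<lambda>x. g x - V u x)" by (intro continuous_on_diff c rep_continuous u)
    show "g x - V u x = 0" if "x \<in> \<Omega>" for x
      unfolding continuous_AE_eq[OF \<Omega> c' rep_continuous[OF u] ae that] by (rule diff_self)
  qed (rule x)
  then show ?thesis by simp
qed

lemma is_function_AE:
  assumes u: "(u :: 'a distr) \<in> X" and r: "is_function u g"
    and g: "\<And>a b. set_integrable lborel (cbox a b) g"
  shows "AE x in lborel. g x = V u x"
  using r rep_dist[OF u] by (intro regular_dist_unique g rep_locally_integrable u) (simp add: is_function_def)

lemma is_function_continuous:
  assumes u: "(u :: 'a distr) \<in> X" and r: "is_function u g" and g: "continuous_on UNIV g"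
  shows "g = V u"
proof
  fix x
  have "AE x in lborel. g x = V u x"
    by (rule is_function_AE[OF u r]) (rule continuous_locally_integrable, rule continuous_on_subset[OF g], simp)
  then have "AE x in lborel. x \<in> UNIV \<longrightarrow> g x = V u x" by simp
  from continuous_AE_eq[OF open_UNIV g rep_continuous[OF u] this UNIV_I] show "g x = V u x" .
qed

section \<open>Local compactness\<close>

text \<open>Arzela-Ascoli for the representatives. The equicontinuity modulus depends on the distributions only through the bound
  on their norms.\<close>

lemma local_subsequence:
  fixes u :: "nat \<Rightarrow> 'a distr"
  assumes K: "compact K" and u: "\<And>k. u k \<in> X" and B: "bounded (range (\<lambda>k. nrm (u k)))"
  obtains h r where "continuous_on K h" "strict_mono (r :: nat \<Rightarrow> nat)"
    "\<And>e. e > 0 \<Longrightarrow> \<exists>N. \<forall>k\<ge>N. \<forall>x\<in>K. norm (V (u (r k)) x - h x) \<le> e"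
proof -
  obtain B where B: "B > 0" "\<And>k. nrm (u k) \<le> B" using bounded_range_nonneg[OF B] by blast
  obtain C where C: "C > 0" "\<And>u x. u \<in> X \<Longrightarrow> norm (V (u :: 'a distr) x) \<le> C * nrm u"
    using rep_bound by blast
  obtain h r where hr: "continuous_on K h" "strict_mono (r :: nat \<Rightarrow> nat)"
    "\<And>e. 0 < e \<Longrightarrow> \<exists>N. \<forall>k x. k \<ge> N \<and> x \<in> K \<longrightarrow> norm (V (u (r k)) x - h x) < e"
  proof (rule Arzela_Ascoli[OF K, of "\<lambda>k. V (u k)" "C * B"])
    show "norm (V (u k) x) \<le> C * B" for k x
      using C(2)[OF u, of k x] mult_left_mono[OF B(2)[of k], of C] C(1) by linarith
    show "\<exists>d>0. \<forall>k y. y \<in> K \<and> norm (x - y) < d \<longrightarrow> norm (V (u k) x - V (u k) y) < e" if "0 < e" for x e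
    proof -
      have e: "e / (2 * B) > 0" using that B by simp
      obtain d where d: "d > 0" "\<And>u x x'. u \<in> X \<Longrightarrow> norm (x - x') \<le> d \<Longrightarrow> norm (V (u :: 'a distr) x - V u x') \<le> e / (2 * B) * nrm u"
        using rep_equicontinuous[OF e] by blast
      have "norm (V (u k) x - V (u k) y) < e" if "norm (x - y) < d" for k y
      proof -
        have "norm (V (u k) x - V (u k) y) \<le> e / (2 * B) * nrm (u k)" using d(2)[OF u] that by simp
        also have "\<dots> \<le> e / (2 * B) * B" using e B(2)[of k] by (intro mult_left_mono) auto
        also have "\<dots> < e" using B(1) \<open>0 < e\<close> by simp
        finally show ?thesis .
      qed
      then show ?thesis using d(1) by blast
    qed
  qed blast
  show ?thesis
  proof (rule that[OF hr(1,2)])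
    fix e :: real assume "e > 0"
    then show "\<exists>N. \<forall>k\<ge>N. \<forall>x\<in>K. norm (V (u (r k)) x - h x) \<le> e" using hr(3) by (meson less_imp_le)
  qed
qed

lemma local_compact_C:
  fixes \<Omega> :: "'a set"
  assumes \<Omega>: "open \<Omega>" "bounded \<Omega>" "\<Omega> \<noteq> {}"
  shows "compact_embedding (X) (nrm) (restricts_to \<Omega>) (C_space (closure \<Omega>)) (sup_norm (closure \<Omega>))"
  unfolding compact_embedding_def
proof (intro conjI ballI allI impI)
  have K: "compact (closure \<Omega>)" "closure \<Omega> \<noteq> {}" using \<Omega> by (auto simp: compact_closure)
  show "\<exists>g\<in>C_space (closure \<Omega>). restricts_to \<Omega> u g" if u: "u \<in> X" for u :: "'a distr"
    using restricts_to_rep[OF u, of \<Omega>] rep_continuous[OF u] by (intro bexI[of _ "V u"]) (auto simp: C_space_def)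
  obtain C where C: "C > 0" "\<And>u x. u \<in> X \<Longrightarrow> norm (V (u :: 'a distr) x) \<le> C * nrm u"
    using rep_bound by blast
  show "\<exists>C. \<forall>u\<in>X. \<forall>g\<in>C_space (closure \<Omega>). restricts_to \<Omega> u g \<longrightarrow> sup_norm (closure \<Omega>) g \<le> C * nrm u"
  proof (intro exI[of _ C] ballI impI)
    fix u g assume u: "u \<in> X" and g: "g \<in> C_space (closure \<Omega>)" "restricts_to \<Omega> u g"
    show "sup_norm (closure \<Omega>) g \<le> C * nrm u"
    proof (rule sup_norm_bounds(2)[OF K(2)])
      fix x assume "x \<in> closure \<Omega>"
      then have "g x = V u x" by (rule restricts_to_continuous[OF \<Omega>(1) u g(2,1)])
      then show "norm (g x) \<le> C * nrm u" using C(2)[OF u, of x] by simp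
    qed
  qed
  fix u :: "nat \<Rightarrow> 'a distr" and g
  assume ug: "(\<forall>k. u k \<in> X \<and> g k \<in> C_space (closure \<Omega>) \<and> restricts_to \<Omega> (u k) (g k)) \<and> bounded (range (\<lambda>k. nrm (u k)))"
  obtain h r where hr: "continuous_on (closure \<Omega>) h" "strict_mono (r :: nat \<Rightarrow> nat)"
    "\<And>e. e > 0 \<Longrightarrow> \<exists>N. \<forall>k\<ge>N. \<forall>x\<in>closure \<Omega>. norm (V (u (r k)) x - h x) \<le> e"
    using local_subsequence[OF K(1), of u] ug by blast
  have eq: "g k x = V (u k) x" if "x \<in> closure \<Omega>" for k x
    by (rule restricts_to_continuous[OF \<Omega>(1) _ _ _ that]) (use ug in auto)
  have "(\<lambda>k. sup_norm (closure \<Omega>) (\<lambda>x. g (r k) x - h x)) \<longlonglongrightarrow> 0"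
  proof (rule LIMSEQ_zero_from_bounds[of 1])
    fix e :: real assume "e > 0"
    then obtain N where N: "\<forall>k\<ge>N. \<forall>x\<in>closure \<Omega>. norm (V (u (r k)) x - h x) \<le> e" using hr(3) by blast
    show "\<exists>N. \<forall>k\<ge>N. 0 \<le> sup_norm (closure \<Omega>) (\<lambda>x. g (r k) x - h x) \<and> sup_norm (closure \<Omega>) (\<lambda>x. g (r k) x - h x) \<le> 1 * e"
    proof (intro exI[of _ N] allI impI conjI)
      fix k assume "N \<le> k"
      then have "norm (g (r k) x - h x) \<le> e" if "x \<in> closure \<Omega>" for x using N that eq[OF that] by simp
      from sup_norm_bounds[OF K(2) this]
      show "0 \<le> sup_norm (closure \<Omega>) (\<lambda>x. g (r k) x - h x)" "sup_norm (closure \<Omega>) (\<lambda>x. g (r k) x - h x) \<le> 1 * e" by simp_all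
    qed
  qed simp
  then show "\<exists>h\<in>C_space (closure \<Omega>). \<exists>r. strict_mono r \<and> (\<lambda>k. sup_norm (closure \<Omega>) (\<lambda>x. g (r k) x - h x)) \<longlonglongrightarrow> 0"
    using hr(1,2) by (intro bexI[of _ h] exI[of _ r]) (auto simp: C_space_def)
qed

text \<open>On a set of finite measure all \<open>L\<^sup>q\<close> norms are dominated by the supremum norm, so the subsequence and the limit of the
  continuous case can be used.\<close>

lemma local_compact_Lq:
  fixes \<Omega> :: "'a set"
  assumes \<Omega>: "open \<Omega>" "bounded \<Omega>" and q: "1 \<le> q"
  shows "compact_embedding (X) (nrm) (restricts_to \<Omega>) (Lq_space q (restrict_space lborel \<Omega>)) (Lq_norm q (restrict_space lborel \<Omega>))"
  unfolding compact_embedding_def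
proof (intro conjI ballI allI impI)
  let ?M = "restrict_space lborel \<Omega>"
  have O: "\<Omega> \<inter> space lborel \<in> sets lborel" using \<Omega> by simp
  have fin: "finite_measure ?M"
  proof
    show "emeasure ?M (space ?M) \<noteq> \<infinity>"
      using emeasure_bounded_finite[OF \<Omega>(2)] \<Omega>(1) by (simp add: emeasure_restrict_space space_restrict_space)
  qed
  obtain A where A: "A \<ge> 0" "\<And>w e. w \<in> borel_measurable ?M \<Longrightarrow> AE x in ?M. norm (w x) \<le> e \<Longrightarrow> e \<ge> 0 \<Longrightarrow>
     w \<in> Lq_space q ?M \<and> 0 \<le> Lq_norm q ?M w \<and> Lq_norm q ?M w \<le> A * e"
    using Lq_finite_measure_sup[OF fin q] by blast
  obtain C where C: "C > 0" "\<And>u x. u \<in> X \<Longrightarrow> norm (V (u :: 'a distr) x) \<le> C * nrm u"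
    using rep_bound by blast
  have Vm: "V u \<in> borel_measurable ?M" if "u \<in> X" for u :: "'a distr"
    using rep_measurable[OF that] by (intro measurable_restrict_space1) simp
  have gm: "g \<in> borel_measurable ?M" if "g \<in> Lq_space q ?M" for g
    using that by (simp add: Lq_space_def)
  have ae: "AE x in ?M. g x = V u x" if "u \<in> X" "g \<in> Lq_space q ?M" "restricts_to \<Omega> u g" for u g
    unfolding AE_restrict_space_iff[OF O]
    by (rule restricts_to_AE[OF \<Omega>(1) that(1,3)]) (rule Lq_restrict_locally_integrable[OF \<Omega>(1) q that(2)])
  have CN: "C * nrm u \<ge> 0" if "u \<in> X" for u :: "'a distr"
    using C(1) nrm_nonneg[OF that] by simp
  have VL: "V u \<in> Lq_space q ?M \<and> 0 \<le> Lq_norm q ?M (V u) \<and> Lq_norm q ?M (V u) \<le> A * (C * nrm u)" if "u \<in> X" for u :: "'a distr"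
    using A(2)[OF Vm[OF that] _ CN[OF that]] C(2)[OF that] by simp
  show "\<exists>g\<in>Lq_space q ?M. restricts_to \<Omega> u g" if u: "u \<in> X" for u :: "'a distr"
    using restricts_to_rep[OF u, of \<Omega>] VL[OF u] by (intro bexI[of _ "V u"]) auto
  show "\<exists>C. \<forall>u\<in>X. \<forall>g\<in>Lq_space q ?M. restricts_to \<Omega> u g \<longrightarrow> Lq_norm q ?M g \<le> C * nrm u"
  proof (intro exI[of _ "A * C"] ballI impI)
    fix u g assume u: "u \<in> X" and g: "g \<in> Lq_space q ?M" "restricts_to \<Omega> u g"
    have "Lq_norm q ?M g = Lq_norm q ?M (V u)"
      by (rule Lq_norm_AE_cong[OF gm[OF g(1)] Vm[OF u] ae[OF u g]])
    then show "Lq_norm q ?M g \<le> A * C * nrm u" using VL[OF u] by (simp add: mult.assoc)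
  qed
  fix u :: "nat \<Rightarrow> 'a distr" and g
  assume ug: "(\<forall>k. u k \<in> X \<and> g k \<in> Lq_space q ?M \<and> restricts_to \<Omega> (u k) (g k)) \<and> bounded (range (\<lambda>k. nrm (u k)))"
  have K: "compact (closure \<Omega>)" using \<Omega> by (simp add: compact_closure)
  obtain h r where hr: "continuous_on (closure \<Omega>) h" "strict_mono (r :: nat \<Rightarrow> nat)"
    "\<And>e. e > 0 \<Longrightarrow> \<exists>N. \<forall>k\<ge>N. \<forall>x\<in>closure \<Omega>. norm (V (u (r k)) x - h x) \<le> e"
    using local_subsequence[OF K, of u] ug by blast
  have hm: "h \<in> borel_measurable ?M"
  proof -
    have "h \<in> borel_measurable (restrict_space borel \<Omega>)"
      by (rule borel_measurable_continuous_on_restrict) (rule continuous_on_subset[OF hr(1) closure_subset])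
    then show ?thesis by (simp cong: measurable_cong_sets add: sets_restrict_space)
  qed
  have sub: "x \<in> closure \<Omega>" if "x \<in> \<Omega>" for x using that closure_subset by blast
  have hL: "h \<in> Lq_space q ?M"
  proof -
    have "bounded (h ` closure \<Omega>)" by (rule compact_imp_bounded[OF compact_continuous_image[OF hr(1) K]])
    then obtain b where b: "\<forall>y\<in>h ` closure \<Omega>. norm y \<le> b" unfolding bounded_iff by (elim exE)
    have "AE x in ?M. norm (h x) \<le> max b 0"
      unfolding AE_restrict_space_iff[OF O] using b sub by (intro AE_I2) (auto intro: max.coboundedI1)
    then show ?thesis using A(2)[OF hm] by simp
  qed
  have "(\<lambda>k. Lq_norm q ?M (\<lambda>x. g (r k) x - h x)) \<longlonglongrightarrow> 0"
  proof (rule LIMSEQ_zero_from_bounds[OF A(1)])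
    fix e :: real assume e: "e > 0"
    then obtain N where N: "\<forall>k\<ge>N. \<forall>x\<in>closure \<Omega>. norm (V (u (r k)) x - h x) \<le> e" using hr(3) by blast
    show "\<exists>N. \<forall>k\<ge>N. 0 \<le> Lq_norm q ?M (\<lambda>x. g (r k) x - h x) \<and> Lq_norm q ?M (\<lambda>x. g (r k) x - h x) \<le> A * e"
    proof (intro exI[of _ N] allI impI)
      fix k assume k: "N \<le> k"
      have 1: "u (r k) \<in> X" "g (r k) \<in> Lq_space q ?M" "restricts_to \<Omega> (u (r k)) (g (r k))" using ug by auto
      have "AE x in ?M. x \<in> \<Omega>" unfolding AE_restrict_space_iff[OF O] by simp
      then have "AE x in ?M. norm (g (r k) x - h x) \<le> e"
        using ae[OF 1] by eventually_elim (use N k sub in auto)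
      then show "0 \<le> Lq_norm q ?M (\<lambda>x. g (r k) x - h x) \<and> Lq_norm q ?M (\<lambda>x. g (r k) x - h x) \<le> A * e"
        using A(2)[of "\<lambda>x. g (r k) x - h x" e] gm[OF 1(2)] hm e by simp
    qed
  qed
  then show "\<exists>h\<in>Lq_space q ?M. \<exists>r. strict_mono r \<and> (\<lambda>k. Lq_norm q ?M (\<lambda>x. g (r k) x - h x)) \<longlonglongrightarrow> 0"
    using hL hr(2) by (intro bexI[of _ h] exI[of _ r]) auto
qed

section \<open>Radial distributions\<close>

lemma rad_subset: "u \<in> Xr \<Longrightarrow> u \<in> X"
  by (simp add: log_bessel_space_rad_def)

text \<open>A bump function of a larger box is bounded below by a positive constant on the given box.\<close>

lemma test_integrable_imp_locally_integrable:
  fixes f :: "'a \<Rightarrow> complex"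
  assumes f[measurable]: "f \<in> borel_measurable lborel" and int: "\<And>\<phi>. \<phi> \<in> schwartz \<Longrightarrow> integrable lborel (\<lambda>x. f x * \<phi> x)"
  shows "set_integrable lborel (cbox a b) f"
proof (cases "cbox a b = {}")
  case True
  then show ?thesis by (simp add: set_integrable_def)
next
  case False
  let ?\<phi> = "bump 0 (a - One) (b + One)"
  have sub: "cbox a b \<subseteq> box (a - One) (b + One)"
    by (auto simp: mem_box inner_diff_left inner_add_left) force+
  have "continuous_on (cbox a b) (\<lambda>x. norm (?\<phi> x))"
    by (intro continuous_intros schwartz_continuous bump_schwartz)
  then obtain x0 where x0: "x0 \<in> cbox a b" "\<forall>y\<in>cbox a b. norm (?\<phi> x0) \<le> norm (?\<phi> y)"
    using continuous_attains_inf[OF compact_cbox False] by blast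
  define c where "c = norm (?\<phi> x0)"
  have c: "c > 0" using bump_pos[of x0] sub x0 by (auto simp: c_def)
  show ?thesis unfolding set_integrable_def
  proof (rule Bochner_Integration.integrable_bound)
    show "integrable lborel (\<lambda>x. of_real (1 / c) * (f x * ?\<phi> x))"
      by (intro integrable_mult_right int bump_schwartz)
    show "AE x in lborel. norm (indicator (cbox a b) x *\<^sub>R f x) \<le> norm (of_real (1 / c) * (f x * ?\<phi> x))"
    proof (rule AE_I2)
      fix x
      show "norm (indicator (cbox a b) x *\<^sub>R f x) \<le> norm (of_real (1 / c) * (f x * ?\<phi> x))"
      proof (cases "x \<in> cbox a b")
        case True
        then have "c * norm (f x) \<le> norm (?\<phi> x) * norm (f x)" using x0(2) by (intro mult_right_mono) (auto simp: c_def)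
        then show ?thesis using c True by (simp add: norm_mult norm_divide field_simps)
      qed simp
    qed
  qed measurable
qed

text \<open>Reflection in the hyperplane orthogonal to \<open>x - y\<close> exchanges \<open>x\<close> and \<open>y\<close>. The representative agrees almost everywhere with
  a radial function, hence is invariant under the reflection almost everywhere, and by continuity everywhere.\<close>

lemma rep_radial:
  assumes u: "(u :: 'a distr) \<in> Xr" and xy: "norm x = norm y"
  shows "V u x = V u y"
proof (rule ccontr)
  assume ne: "V u x \<noteq> V u y"
  have uX: "u \<in> X" using rad_subset[OF u] .
  have "radial_dist u" using u by (simp add: log_bessel_space_rad_def)
  then obtain f where f: "f \<in> borel_measurable lborel" "\<forall>\<phi>\<in>schwartz. integrable lborel (\<lambda>x. f x * \<phi> x)"
    "u = regular_dist f" "\<forall>x y. norm x = norm y \<longrightarrow> f x = f y"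
    unfolding radial_dist_def by (elim bexE conjE)
  have "AE z in lborel. f z = V u z"
    by (rule is_function_AE[OF uX f(3)[folded is_function_def]])
       (rule test_integrable_imp_locally_integrable[OF f(1) f(2)[rule_format]])
  then obtain N where N: "{z \<in> space lborel. \<not> f z = V u z} \<subseteq> N" "emeasure lborel N = 0" "N \<in> sets lborel"
    by (rule AE_E)
  have negN: "negligible N" using N(2,3) by (simp add: negligible_iff_null_sets null_sets_completionI null_setsI)
  define w where "w = x - y"
  have w: "w \<bullet> w > 0" using ne by (auto simp: w_def)
  \<comment> \<open>Reflection in the hyperplane orthogonal to \<open>w\<close>.\<close>
  define R where "R z = z - (2 * (z \<bullet> w) / (w \<bullet> w)) *\<^sub>R w" for z
  have lin: "linear R"
    unfolding R_def by (intro linearI) (auto simp: inner_add_left algebra_simps add_divide_distrib)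
  have Rw: "R z \<bullet> w = - (z \<bullet> w)" for z
    using w by (simp add: R_def inner_diff_left)
  have nR: "norm (R z) = norm z" for z
  proof -
    have "R z \<bullet> R z = R z \<bullet> z - (2 * (z \<bullet> w) / (w \<bullet> w)) * (R z \<bullet> w)"
      by (subst (2) R_def) (simp only: inner_diff_right inner_scaleR_right)
    also have "\<dots> = R z \<bullet> z + 2 * (z \<bullet> w) * (z \<bullet> w) / (w \<bullet> w)" by (simp add: Rw)
    also have "R z \<bullet> z = z \<bullet> z - 2 * (z \<bullet> w) * (z \<bullet> w) / (w \<bullet> w)"
      by (simp add: R_def inner_diff_left inner_diff_right inner_commute)
    finally show ?thesis by (simp add: norm_eq_sqrt_inner)
  qed
  have RR: "R (R z) = z" for z
    by (subst R_def) (simp add: Rw, simp add: R_def)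
  have Rx: "R x = y"
  proof -
    have "x \<bullet> x = y \<bullet> y" using xy by (simp add: norm_eq_sqrt_inner)
    then have "2 * (x \<bullet> w) = w \<bullet> w" by (simp add: w_def inner_diff_left inner_diff_right inner_commute)
    then show ?thesis using w by (simp add: R_def w_def)
  qed
  define U where "U = {z. V u (R z) - V u z \<noteq> 0}"
  have "open U"
  proof -
    have "continuous_on UNIV (\<lambda>z. V u (R z) - V u z)"
      by (intro continuous_on_diff continuous_on_compose2[OF rep_continuous[OF uX, of UNIV]] linear_continuous_on
          rep_continuous[OF uX]) (auto simp: linear_conv_bounded_linear[symmetric] lin)
    then have "open (UNIV \<inter> (\<lambda>z. V u (R z) - V u z) -` (- {0}))" using open_UNIV by (rule continuous_open_preimage) auto
    moreover have "UNIV \<inter> (\<lambda>z. V u (R z) - V u z) -` (- {0}) = U" by (auto simp: U_def)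
    ultimately show ?thesis by simp
  qed
  moreover have "x \<in> U" using ne Rx by (simp add: U_def)
  ultimately have "\<not> negligible U" by (intro open_not_negligible) auto
  moreover have "negligible U"
  proof (rule negligible_subset)
    show "negligible (N \<union> R ` N)"
    proof (intro negligible_Un negN negligible_locally_Lipschitz_image order_refl)
      fix z :: 'a
      have "norm (R y - R z) = norm (y - z)" for y by (metis lin linear_diff nR)
      then show "\<exists>T B. open T \<and> z \<in> T \<and> (\<forall>y\<in>N \<inter> T. norm (R y - R z) \<le> B * norm (y - z))"
        by (intro exI[of _ UNIV] exI[of _ 1]) simp
    qed
    show "U \<subseteq> N \<union> R ` N"
    proof
      fix z assume z: "z \<in> U"
      show "z \<in> N \<union> R ` N"
      proof (rule ccontr)
        assume "z \<notin> N \<union> R ` N"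
        then have 1: "z \<notin> N" and 2: "R z \<notin> N" using RR[of z] by (auto, metis imageI)
        have fN: "f z' = V u z'" if "z' \<notin> N" for z' using that N(1) by auto
        have "V u z = f z" using fN[OF 1] by simp
        moreover have "V u (R z) = f (R z)" using fN[OF 2] by simp
        moreover have "f (R z) = f z" by (rule f(4)[rule_format, OF nR])
        ultimately show False using z by (simp add: U_def)
      qed
    qed
  qed
  ultimately show False by simp
qed

text \<open>A value above \<open>\<epsilon> * nrm u\<close> at a point of norm \<open>r\<close> persists, up to the factor \<open>1 / 2\<close>, on the annulus between the radii \<open>r - d\<close> and
  \<open>r\<close>: a point of the annulus can be rotated onto the segment from \<open>0\<close> to \<open>x\<close>. The volume of the annulus is at least a
  multiple of \<open>d * r\<close> in dimension at least two, and this contradicts the \<open>L\<^sup>p\<close> bound once \<open>r\<close> is large.\<close>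

lemma rep_decay:
  assumes dim: "DIM('a) \<ge> 2" and e: "\<epsilon> > 0"
  obtains R where "R > 0" "\<And>u x. (u :: 'a distr) \<in> Xr \<Longrightarrow> norm x \<ge> R \<Longrightarrow> norm (V u x) \<le> \<epsilon> * nrm u"
proof -
  have e2: "\<epsilon> / 2 > 0" using e by simp
  obtain d where d: "d > 0" "\<And>u x x'. u \<in> X \<Longrightarrow> norm (x - x') \<le> d \<Longrightarrow> norm (V (u :: 'a distr) x - V u x') \<le> \<epsilon> / 2 * nrm u"
    using rep_equicontinuous[OF e2] by blast
  obtain C where C: "C > 0" "\<And>u x. u \<in> X \<Longrightarrow> norm (V (u :: 'a distr) x) \<le> C * nrm u"
    using rep_bound by blast
  define v0 where "v0 = unit_ball_vol (real DIM('a))"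
  have v0: "v0 > 0" by (simp add: v0_def)
  define M where "M = mixture_mass lam s"
  have M: "M > 0" using mixture_mass_pos[OF lam] by (simp add: M_def)
  \<comment> \<open>The radius at which the lower bound on the \<open>p\<close>-th power over the annulus reaches the \<open>L\<^sup>p\<close> bound.\<close>
  define Q where "Q = M powr p / ((\<epsilon> / 2) powr p * v0 * d)"
  have Q: "Q \<ge> 0" using v0 d by (simp add: Q_def)
  show ?thesis
  proof (rule that[of "1 + d + Q"])
    show "1 + d + Q > 0" using d Q by simp
    fix u :: "'a distr" and x :: 'a assume u: "u \<in> Xr" and x: "norm x \<ge> 1 + d + Q"
    have uX: "u \<in> X" using rad_subset[OF u] .
    define N where "N = nrm u"
    have N0: "N \<ge> 0" using nrm_nonneg[OF uX] by (simp add: N_def)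
    show "norm (V u x) \<le> \<epsilon> * nrm u"
    proof (rule ccontr)
      assume "\<not> norm (V u x) \<le> \<epsilon> * nrm u"
      then have big: "norm (V u x) > \<epsilon> * N" by (simp add: N_def)
      have N: "N > 0"
      proof (rule ccontr)
        assume "\<not> N > 0"
        then have "N = 0" using N0 by simp
        then show False using C(2)[OF uX, of x] big by (simp add: N_def)
      qed
      define r where "r = norm x"
      have r: "r \<ge> 1 + d + Q" "r > 0" "r \<ge> 1" "r > d" using x d Q by (auto simp: r_def)
      define A where "A = cball (0::'a) r - ball 0 (r - d)"
      have low: "norm (V u y) \<ge> \<epsilon> / 2 * N" if y: "y \<in> A" for y
      proof -
        have ny: "norm y \<le> r" "norm y \<ge> r - d" using y by (auto simp: A_def)
        define y' where "y' = (norm y / r) *\<^sub>R x"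
        have "norm y' = norm y" using r by (simp add: y'_def r_def)
        then have eq: "V u y = V u y'" by (intro rep_radial[OF u]) simp
        have "x - y' = (1 - norm y / r) *\<^sub>R x" by (simp add: y'_def scaleR_diff_left)
        then have "norm (x - y') = \<bar>1 - norm y / r\<bar> * r" by (simp add: r_def)
        also have "\<dots> = \<bar>(1 - norm y / r) * r\<bar>" using r by (simp add: abs_mult)
        also have "(1 - norm y / r) * r = r - norm y" using r by (simp add: field_simps)
        finally have "norm (x - y') \<le> d" using ny by simp
        then have "norm (V u x - V u y') \<le> \<epsilon> / 2 * N" using d(2)[OF uX] by (simp add: N_def)
        then have "norm (V u x) - norm (V u y') \<le> \<epsilon> / 2 * N" using norm_triangle_ineq2[of "V u x" "V u y'"] by linarith
        then show ?thesis using big eq by (simp add: field_simps)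
      qed
      have Am[measurable]: "A \<in> sets lborel" by (simp add: A_def)
      have emA: "emeasure lborel A = ennreal (v0 * (r ^ DIM('a) - (r - d) ^ DIM('a)))"
      proof -
        have "emeasure lborel A = emeasure lborel (cball (0::'a) r) - emeasure lborel (ball (0::'a) (r - d))"
          unfolding A_def using r d by (intro emeasure_Diff) (auto simp: emeasure_ball)
        also have "\<dots> = ennreal (v0 * r ^ DIM('a)) - ennreal (v0 * (r - d) ^ DIM('a))"
          using r by (simp add: emeasure_cball emeasure_ball v0_def)
        also have "\<dots> = ennreal (v0 * (r ^ DIM('a) - (r - d) ^ DIM('a)))"
          using v0 r by (simp add: ennreal_minus right_diff_distrib)
        finally show ?thesis .
      qed
      have "d * r \<le> r ^ DIM('a) - (r - d) ^ DIM('a)"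
      proof -
        obtain m where m: "DIM('a) = Suc (Suc m)" using dim by (metis Suc_le_D numeral_2_eq_2 Suc_le_mono)
        have "(r - d) ^ Suc m \<le> r ^ Suc m" using r d by (intro power_mono) auto
        then have "(r - d) * (r - d) ^ Suc m \<le> (r - d) * r ^ Suc m" using r by (intro mult_left_mono) auto
        moreover have "r * 1 \<le> r * r ^ m" using r by (intro mult_left_mono one_le_power) auto
        then have "d * r \<le> d * r ^ Suc m" using d by simp
        ultimately show ?thesis unfolding m power_Suc[of _ "Suc m"] by (simp add: left_diff_distrib)
      qed
      then have vol: "v0 * (d * r) \<le> v0 * (r ^ DIM('a) - (r - d) ^ DIM('a))" using v0 by (intro mult_left_mono) auto
      have "ennreal ((\<epsilon> / 2 * N) powr p * (v0 * (d * r))) \<le> ennreal ((\<epsilon> / 2 * N) powr p) * emeasure lborel A"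
        unfolding emA using vol v0 r d by (subst ennreal_mult[symmetric]) (auto intro!: ennreal_leI mult_left_mono order_trans[OF _ vol])
      also have "\<dots> = (\<integral>\<^sup>+y. ennreal ((\<epsilon> / 2 * N) powr p) * indicator A y \<partial>lborel)"
        by (rule nn_integral_cmult_indicator[OF Am, symmetric])
      also have "\<dots> \<le> (\<integral>\<^sup>+y. ennreal (norm (V u y) powr p) \<partial>lborel)"
      proof (rule nn_integral_mono)
        fix y
        show "ennreal ((\<epsilon> / 2 * N) powr p) * indicator A y \<le> ennreal (norm (V u y) powr p)"
          using low[of y] p e N by (auto simp: indicator_def intro!: ennreal_leI powr_mono2)
      qed
      also have "\<dots> \<le> ennreal ((M * N) powr p)" using rep_Lp[OF uX] by (simp add: M_def N_def)
      finally have "(\<epsilon> / 2 * N) powr p * (v0 * (d * r)) \<le> (M * N) powr p"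
        by (subst (asm) ennreal_le_iff) auto
      then have "N powr p * ((\<epsilon> / 2) powr p * v0 * d * r) \<le> N powr p * M powr p"
        by (simp add: powr_mult powr_divide mult_ac)
      then have "(\<epsilon> / 2) powr p * v0 * d * r \<le> M powr p" using N by (simp add: mult_le_cancel_left_pos)
      then have "r \<le> Q" unfolding Q_def using e v0 d by (simp add: pos_le_divide_eq mult_ac)
      then show False using r d by simp
    qed
  qed
qed

lemma rep_C0:
  assumes dim: "DIM('a) \<ge> 2" and u: "(u :: 'a distr) \<in> Xr"
  shows "V u \<in> C0_space"
proof -
  have uX: "u \<in> X" using rad_subset[OF u] .
  have N: "nrm u \<ge> 0" using nrm_nonneg[OF uX] .
  have "(V u \<longlongrightarrow> 0) at_infinity"
    unfolding Lim_at_infinity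
  proof (intro allI impI)
    fix e :: real assume e: "e > 0"
    have e': "e / (nrm u + 1) > 0" using e N by simp
    obtain R where R: "R > 0" "\<And>v x. (v :: 'a distr) \<in> Xr \<Longrightarrow> norm x \<ge> R \<Longrightarrow>
        norm (V v x) \<le> e / (nrm u + 1) * nrm v"
      using rep_decay[OF dim e'] by blast
    have "e / (nrm u + 1) * nrm u < e" using e N by (simp add: field_simps)
    then show "\<exists>b. \<forall>x. b \<le> norm x \<longrightarrow> dist (V u x) 0 < e"
      using R(2)[OF u] by (intro exI[of _ R]) (auto intro: le_less_trans)
  qed
  then show ?thesis using rep_continuous[OF uX] by (simp add: C0_space_def)
qed

text \<open>The profile of a radial function is a function of \<open>norm x\<close>. The substitution \<open>t = norm x / (1 + norm x)\<close> compactifies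
  the half-line, the value \<open>0\<close> at \<open>t = 1\<close> being the limit at infinity. Uniform decay is exactly equicontinuity
  at \<open>t = 1\<close>, so Arzela-Ascoli on \<open>{0..1}\<close> yields uniform convergence on the whole space.\<close>

lemma global_subsequence:
  fixes u :: "nat \<Rightarrow> 'a distr"
  assumes dim: "DIM('a) \<ge> 2" and u: "\<And>k. u k \<in> Xr" and B: "bounded (range (\<lambda>k. nrm (u k)))"
  obtains h r where "h \<in> C0_space" "strict_mono (r :: nat \<Rightarrow> nat)"
    "\<And>e. e > 0 \<Longrightarrow> \<exists>N. \<forall>k\<ge>N. \<forall>x. norm (V (u (r k)) x - h x) \<le> e"
proof -
  have uX: "u k \<in> X" for k using rad_subset[OF u] .
  obtain B where B: "B > 0" "\<And>k. nrm (u k) \<le> B" using bounded_range_nonneg[OF B] by blast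
  obtain C where C: "C > 0" "\<And>u x. u \<in> X \<Longrightarrow> norm (V (u :: 'a distr) x) \<le> C * nrm u"
    using rep_bound by blast
  have scale: "t * nrm (u k) \<le> t * B" if "t \<ge> 0" for t k using B(2)[of k] that by (intro mult_left_mono)
  obtain b :: 'a where b: "b \<in> Basis" using nonempty_Basis by blast
  define \<rho> where "\<rho> t = t / (1 - t)" for t :: real
  define W where "W k t = (if t < 1 then V (u k) (\<rho> t *\<^sub>R b) else 0)" for k t
  obtain h1 r where hr: "continuous_on {0..1::real} h1" "strict_mono (r :: nat \<Rightarrow> nat)"
    "\<And>e. 0 < e \<Longrightarrow> \<exists>N. \<forall>k t. k \<ge> N \<and> t \<in> {0..1} \<longrightarrow> norm (W (r k) t - h1 t) < e"
  proof (rule Arzela_Ascoli[of "{0..1::real}" W "C * B"])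
    show "norm (W k t) \<le> C * B" for k t
    proof -
      have "norm (V (u k) (\<rho> t *\<^sub>R b)) \<le> C * B"
        by (rule order_trans[OF C(2)[OF uX] scale]) (use C(1) in simp)
      then show ?thesis using C(1) B(1) by (simp add: W_def)
    qed
    show "\<exists>d>0. \<forall>k t'. t' \<in> {0..1} \<and> norm (t - t') < d \<longrightarrow> norm (W k t - W k t') < e" if t: "t \<in> {0..1}" and e: "0 < e" for t e
    proof (cases "t < 1")
      case True
      have e': "e / (2 * B) > 0" using e B by simp
      obtain d where d: "d > 0" "\<And>u x x'. u \<in> X \<Longrightarrow> norm (x - x') \<le> d \<Longrightarrow> norm (V (u :: 'a distr) x - V u x') \<le> e / (2 * B) * nrm u"
        using rep_equicontinuous[OF e'] by blast
      have "isCont \<rho> t" unfolding \<rho>_def using True by (intro continuous_intros) auto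
      then obtain d' where d': "d' > 0" "\<And>t'. \<bar>t' - t\<bar> < d' \<Longrightarrow> \<bar>\<rho> t' - \<rho> t\<bar> < d"
        unfolding isCont_def LIM_eq using d(1) by (metis diff_self abs_zero real_norm_def)
      show ?thesis
      proof (intro exI[of _ "min d' (1 - t)"] conjI allI impI)
        show "min d' (1 - t) > 0" using d' True by simp
        fix k t' assume t': "t' \<in> {0..1} \<and> norm (t - t') < min d' (1 - t)"
        then have "t' < 1" "\<bar>t' - t\<bar> < d'" by auto
        then have "\<bar>\<rho> t - \<rho> t'\<bar> \<le> d" using d'(2)[of t'] by linarith
        moreover have "norm (\<rho> t *\<^sub>R b - \<rho> t' *\<^sub>R b) = \<bar>\<rho> t - \<rho> t'\<bar>" using b by (simp add: scaleR_diff_left[symmetric])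
        ultimately have "norm (V (u k) (\<rho> t *\<^sub>R b) - V (u k) (\<rho> t' *\<^sub>R b)) \<le> e / (2 * B) * nrm (u k)" by (intro d(2) uX) simp
        also have "\<dots> \<le> e / (2 * B) * B" using e' by (intro scale) simp
        also have "\<dots> < e" using e B by simp
        finally show "norm (W k t - W k t') < e" using True \<open>t' < 1\<close> by (simp add: W_def)
      qed
    next
      case False
      then have t1: "t = 1" using t by simp
      have e': "e / (2 * B) > 0" using e B by simp
      obtain R where R: "R > 0" "\<And>u x. (u :: 'a distr) \<in> Xr \<Longrightarrow> norm x \<ge> R \<Longrightarrow> norm (V u x) \<le> e / (2 * B) * nrm u"
        using rep_decay[OF dim e'] by blast
      show ?thesis
      proof (intro exI[of _ "1 / (1 + R)"] conjI allI impI)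
        \<comment> \<open>If \<open>1 - t' < 1 / (1 + R)\<close>, then \<open>\<rho> t'\<close> is at least \<open>R\<close>.\<close>
        show "1 / (1 + R) > 0" using R by simp
        fix k t' assume t': "t' \<in> {0..1} \<and> norm (t - t') < 1 / (1 + R)"
        show "norm (W k t - W k t') < e"
        proof (cases "t' < 1")
          case True
          have "1 - t' < 1 / (1 + R)" using t' t1 by auto
          then have "(1 - t') * (1 + R) < 1" using R by (simp add: pos_less_divide_eq)
          then have "R * (1 - t') \<le> t'" by (simp add: algebra_simps)
          then have "R \<le> \<rho> t'" unfolding \<rho>_def using True by (simp add: pos_le_divide_eq)
          then have "norm (\<rho> t' *\<^sub>R b) \<ge> R" using b R(1) by simp
          then have "norm (V (u k) (\<rho> t' *\<^sub>R b)) \<le> e / (2 * B) * nrm (u k)" by (intro R(2) u)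
          also have "\<dots> \<le> e / (2 * B) * B" using e' by (intro scale) simp
          also have "\<dots> < e" using e B by simp
          finally show ?thesis using True t1 by (simp add: W_def)
        next
          case False
          then show ?thesis using t1 e by (simp add: W_def)
        qed
      qed
    qed
  qed auto
  define \<theta> where "\<theta> x = norm x / (1 + norm x)" for x :: 'a
  have \<theta>: "\<theta> x \<in> {0..1}" "\<theta> x < 1" for x
  proof -
    have "1 + norm x > 0" by (simp add: add_pos_nonneg)
    then show "\<theta> x \<in> {0..1}" "\<theta> x < 1" by (auto simp: \<theta>_def pos_divide_le_eq pos_divide_less_eq)
  qed
  have \<rho>\<theta>: "\<rho> (\<theta> x) = norm x" for x
  proof -
    have "1 + norm x > 0" by (simp add: add_pos_nonneg)
    then have "1 - \<theta> x = 1 / (1 + norm x)" by (simp add: \<theta>_def field_simps)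
    then show ?thesis using \<open>1 + norm x > 0\<close> by (simp add: \<rho>_def \<theta>_def)
  qed
  define h where "h x = h1 (\<theta> x)" for x
  have VW: "V (u k) x = W k (\<theta> x)" for k x
    unfolding W_def using \<theta>(2)[of x] rep_radial[OF u, of x "\<rho> (\<theta> x) *\<^sub>R b" k] b by (simp add: \<rho>\<theta>)
  have conv: "\<exists>N. \<forall>k\<ge>N. \<forall>x. norm (V (u (r k)) x - h x) \<le> e" if e: "e > 0" for e
  proof -
    obtain N where "\<forall>k t. k \<ge> N \<and> t \<in> {0..1} \<longrightarrow> norm (W (r k) t - h1 t) < e" using hr(3)[OF e] by blast
    then show ?thesis unfolding VW h_def using \<theta>(1) by (intro exI[of _ N]) (auto intro: less_imp_le)
  qed
  have "continuous_on UNIV h"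
    unfolding h_def
  proof (rule continuous_on_compose2[OF hr(1)])
    have "1 + norm x \<noteq> 0" for x :: 'a using norm_ge_zero[of x] by linarith
    then show "continuous_on UNIV \<theta>" unfolding \<theta>_def by (intro continuous_intros) auto
    show "\<theta> ` UNIV \<subseteq> {0..1}" using \<theta>(1) by blast
  qed
  moreover have "(h \<longlongrightarrow> 0) at_infinity"
    unfolding Lim_at_infinity
  proof (intro allI impI)
    fix e :: real assume e: "e > 0"
    then obtain N where N: "\<forall>k\<ge>N. \<forall>x. norm (V (u (r k)) x - h x) \<le> e / 2" using conv[of "e / 2"] by auto
    have "V (u (r N)) \<in> C0_space" by (rule rep_C0[OF dim u])
    then have "(V (u (r N)) \<longlongrightarrow> 0) at_infinity" by (simp add: C0_space_def)
    then obtain c where c: "\<forall>x. c \<le> norm x \<longrightarrow> dist (V (u (r N)) x) 0 < e / 2"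
      unfolding Lim_at_infinity using half_gt_zero[OF e] by (elim allE[of _ "e / 2"] impE exE)
    show "\<exists>c. \<forall>x. c \<le> norm x \<longrightarrow> dist (h x) 0 < e"
    proof (intro exI[of _ c] allI impI)
      fix x :: 'a assume "c \<le> norm x"
      then have "norm (V (u (r N)) x) < e / 2" using c by simp
      moreover have "norm (V (u (r N)) x - h x) \<le> e / 2" using N by blast
      ultimately show "dist (h x) 0 < e" using norm_triangle_ineq2[of "h x" "V (u (r N)) x"] by (simp add: norm_minus_commute)
    qed
  qed
  ultimately have "h \<in> C0_space" by (simp add: C0_space_def)
  then show ?thesis using hr(2) conv by (rule that)
qed

lemma global_compact_C0:
  assumes dim: "DIM('a) \<ge> 2"
  shows "compact_embedding (Xr) (nrm) is_function (C0_space :: ('a \<Rightarrow> complex) set) (sup_norm UNIV)"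
  unfolding compact_embedding_def
proof (intro conjI ballI allI impI)
  show "\<exists>g\<in>C0_space. is_function u g" if u: "u \<in> Xr" for u :: "'a distr"
    using rep_C0[OF dim u] rep_dist[OF rad_subset[OF u]] by (intro bexI[of _ "V u"]) (auto simp: is_function_def)
  obtain C where C: "C > 0" "\<And>u x. u \<in> X \<Longrightarrow> norm (V (u :: 'a distr) x) \<le> C * nrm u"
    using rep_bound by blast
  have eq: "g = V u" if "u \<in> Xr" "g \<in> C0_space" "is_function u g" for u and g :: "'a \<Rightarrow> complex"
    using that by (intro is_function_continuous[OF rad_subset]) (auto simp: C0_space_def)
  show "\<exists>C. \<forall>u\<in>Xr. \<forall>g\<in>C0_space. is_function u g \<longrightarrow> sup_norm UNIV (g :: 'a \<Rightarrow> complex) \<le> C * nrm u"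
  proof (intro exI[of _ C] ballI impI)
    fix u and g :: "'a \<Rightarrow> complex" assume u: "u \<in> Xr" and g: "g \<in> C0_space" "is_function u g"
    show "sup_norm UNIV g \<le> C * nrm u"
      unfolding eq[OF u g] using C(2)[OF rad_subset[OF u]] by (intro sup_norm_bounds(2)) auto
  qed
  fix u :: "nat \<Rightarrow> 'a distr" and g
  assume ug: "(\<forall>k. u k \<in> Xr \<and> g k \<in> C0_space \<and> is_function (u k) (g k)) \<and> bounded (range (\<lambda>k. nrm (u k)))"
  obtain h r where hr: "h \<in> C0_space" "strict_mono (r :: nat \<Rightarrow> nat)"
    "\<And>e. e > 0 \<Longrightarrow> \<exists>N. \<forall>k\<ge>N. \<forall>x. norm (V (u (r k)) x - h x) \<le> e"
    using global_subsequence[OF dim, of u] ug by blast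
  have gV: "g k = V (u k)" for k using eq ug by blast
  have "(\<lambda>k. sup_norm UNIV (\<lambda>x. g (r k) x - h x)) \<longlonglongrightarrow> 0"
  proof (rule LIMSEQ_zero_from_bounds[of 1])
    fix e :: real assume "e > 0"
    then obtain N where N: "\<forall>k\<ge>N. \<forall>x. norm (V (u (r k)) x - h x) \<le> e" using hr(3) by blast
    show "\<exists>N. \<forall>k\<ge>N. 0 \<le> sup_norm UNIV (\<lambda>x. g (r k) x - h x) \<and> sup_norm UNIV (\<lambda>x. g (r k) x - h x) \<le> 1 * e"
    proof (intro exI[of _ N] allI impI conjI)
      fix k assume "N \<le> k"
      then have "norm (g (r k) x - h x) \<le> e" for x using N gV by simp
      from sup_norm_bounds[OF UNIV_not_empty this]
      show "0 \<le> sup_norm UNIV (\<lambda>x. g (r k) x - h x)" "sup_norm UNIV (\<lambda>x. g (r k) x - h x) \<le> 1 * e" by simp_all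
    qed
  qed simp
  then show "\<exists>h\<in>C0_space. \<exists>r. strict_mono r \<and> (\<lambda>k. sup_norm UNIV (\<lambda>x. g (r k) x - h x)) \<longlonglongrightarrow> 0"
    using hr(1,2) by (intro bexI[of _ h] exI[of _ r]) auto
qed

text \<open>The limit lies in \<open>L\<^sup>p\<close> by Fatou's lemma. The differences are then bounded in \<open>L\<^sup>p\<close> and tend to \<open>0\<close> uniformly, so they
  tend to \<open>0\<close> in \<open>L\<^sup>q\<close> by interpolation.\<close>

lemma global_compact_Lq:
  assumes dim: "DIM('a) \<ge> 2" and q: "ennreal p < q"
  shows "compact_embedding (Xr) (nrm) is_function (Lq_space q (lborel :: 'a measure)) (Lq_norm q lborel)"
  unfolding compact_embedding_def
proof (intro conjI ballI allI impI)
  let ?r = "enn2real q"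
  have q1: "1 \<le> q"
  proof -
    have "1 \<le> ennreal p" using p by simp
    then show ?thesis using q by (meson less_imp_le order_trans)
  qed
  have rp: "?r > p" if "q \<noteq> \<infinity>"
    using q p that by (metis ennreal_enn2real_if ennreal_less_iff infinity_ennreal_def less_eq_real_def less_trans zero_less_one)
  define M where "M = mixture_mass lam s"
  have M: "M > 0" using mixture_mass_pos[OF lam] by (simp add: M_def)
  obtain C where C: "C > 0" "\<And>u x. u \<in> X \<Longrightarrow> norm (V (u :: 'a distr) x) \<le> C * nrm u"
    using rep_bound by blast
  have Vm: "V u \<in> borel_measurable lborel" if "u \<in> Xr" for u :: "'a distr"
    using rep_measurable[OF rad_subset[OF that]] by simp
  have gm: "g \<in> borel_measurable lborel" if "g \<in> Lq_space q lborel" for g :: "'a \<Rightarrow> complex"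
    using that by (simp add: Lq_space_def)
  have ae: "AE x in lborel. g x = V u x" if "u \<in> Xr" "g \<in> Lq_space q lborel" "is_function u g" for u and g :: "'a \<Rightarrow> complex"
    by (rule is_function_AE[OF rad_subset[OF that(1)] that(3)]) (rule Lq_locally_integrable[OF q1 that(2)])
  have Np: "nrm u \<ge> 0" if "u \<in> Xr" for u :: "'a distr" using nrm_nonneg[OF rad_subset[OF that]] .
  have VL: "V u \<in> Lq_space q lborel"
     "Lq_norm q lborel (V u) \<le> (if q = \<infinity> then C * nrm u else (C * nrm u) powr ((?r - p) / ?r) * ((M * nrm u) powr p) powr (1 / ?r))" if u: "u \<in> Xr" for u :: "'a distr"
    using Lq_interpolation[OF p q Vm[OF u] C(2)[OF rad_subset[OF u]] _ rep_Lp[OF rad_subset[OF u]]] C(1) Np[OF u] by (auto simp: M_def)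
  show "\<exists>g\<in>Lq_space q lborel. is_function u g" if u: "u \<in> Xr" for u :: "'a distr"
    using VL(1)[OF u] rep_dist[OF rad_subset[OF u]] by (intro bexI[of _ "V u"]) (auto simp: is_function_def)
  define D where "D = (if q = \<infinity> then C else C powr ((?r - p) / ?r) * M powr (p / ?r))"
  show "\<exists>C. \<forall>u\<in>Xr. \<forall>g\<in>Lq_space q lborel. is_function u (g :: 'a \<Rightarrow> complex) \<longrightarrow> Lq_norm q lborel g \<le> C * nrm u"
  proof (intro exI[of _ D] ballI impI)
    fix u and g :: "'a \<Rightarrow> complex" assume u: "u \<in> Xr" and g: "g \<in> Lq_space q lborel" "is_function u g"
    have "Lq_norm q lborel g = Lq_norm q lborel (V u)"
      by (rule Lq_norm_AE_cong[OF gm[OF g(1)] Vm[OF u] ae[OF u g]])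
    also have "\<dots> \<le> D * nrm u"
    proof (cases "q = \<infinity>")
      case True
      then show ?thesis using VL(2)[OF u] by (simp add: D_def)
    next
      case False
      have r: "?r > 0" using rp[OF False] p by simp
      have e: "(?r - p) / ?r + p / ?r = 1" using r by (simp add: diff_divide_distrib)
      have "(C * nrm u) powr ((?r - p) / ?r) * ((M * nrm u) powr p) powr (1 / ?r) =
         (C powr ((?r - p) / ?r) * M powr (p / ?r)) * (nrm u powr ((?r - p) / ?r) * nrm u powr (p / ?r))"
        by (simp add: powr_mult powr_powr)
      also have "nrm u powr ((?r - p) / ?r) * nrm u powr (p / ?r) = nrm u"
        unfolding powr_add[symmetric] e using Np[OF u] by simp
      finally show ?thesis using VL(2)[OF u] False by (simp add: D_def)
    qed
    finally show "Lq_norm q lborel g \<le> D * nrm u" .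
  qed
  fix u :: "nat \<Rightarrow> 'a distr" and g
  assume ug: "(\<forall>k. u k \<in> Xr \<and> g k \<in> Lq_space q lborel \<and> is_function (u k) (g k)) \<and> bounded (range (\<lambda>k. nrm (u k)))"
  then have u: "u k \<in> Xr" for k by blast
  obtain h r where hr: "h \<in> C0_space" "strict_mono (r :: nat \<Rightarrow> nat)"
    "\<And>e. e > 0 \<Longrightarrow> \<exists>N. \<forall>k\<ge>N. \<forall>x. norm (V (u (r k)) x - h x) \<le> e"
    using global_subsequence[OF dim, of u] ug by blast
  obtain B where B: "B > 0" "\<And>k. nrm (u k) \<le> B" using bounded_range_nonneg[of "\<lambda>k. nrm (u k)"] ug by blast
  define L where "L = (M * B) powr p"
  have VB: "(\<integral>\<^sup>+x. ennreal (norm (V (u k) x) powr p) \<partial>lborel) \<le> ennreal L" for k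
  proof -
    have "(M * nrm (u k)) powr p \<le> L"
      unfolding L_def using M B Np[OF u, of k] p by (intro powr_mono2) auto
    then show ?thesis by (intro order_trans[OF rep_Lp[OF rad_subset[OF u], of k] ennreal_leI]) (simp add: M_def)
  qed
  have hc: "continuous_on UNIV h" using hr(1) by (simp add: C0_space_def)
  have hm[measurable]: "h \<in> borel_measurable lborel" using borel_measurable_continuous_onI[OF hc] by simp
  have Vm'[measurable]: "V (u k) \<in> borel_measurable lborel" for k by (rule Vm[OF u])
  have lim: "(\<lambda>k. V (u (r k)) x) \<longlonglongrightarrow> h x" for x
  proof (rule LIMSEQ_I)
    fix e :: real assume "e > 0"
    then obtain N where "\<forall>k\<ge>N. \<forall>x. norm (V (u (r k)) x - h x) \<le> e / 2" using hr(3)[of "e / 2"] by auto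
    then show "\<exists>N. \<forall>k\<ge>N. norm (V (u (r k)) x - h x) < e" using \<open>e > 0\<close>
      by (intro exI[of _ N]) (auto intro: le_less_trans[of _ "e / 2"])
  qed
  have hB: "(\<integral>\<^sup>+x. ennreal (norm (h x) powr p) \<partial>lborel) \<le> ennreal L"
  proof -
    have "(\<lambda>k. ennreal (norm (V (u (r k)) x) powr p)) \<longlonglongrightarrow> ennreal (norm (h x) powr p)" for x
      using lim[of x] p by (intro tendsto_ennrealI tendsto_powr' tendsto_norm tendsto_const) auto
    then have "liminf (\<lambda>k. ennreal (norm (V (u (r k)) x) powr p)) = ennreal (norm (h x) powr p)" for x
      by (intro lim_imp_Liminf) auto
    then have "(\<integral>\<^sup>+x. ennreal (norm (h x) powr p) \<partial>lborel) = (\<integral>\<^sup>+x. liminf (\<lambda>k. ennreal (norm (V (u (r k)) x) powr p)) \<partial>lborel)"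
      by simp
    also have "\<dots> \<le> liminf (\<lambda>k. (\<integral>\<^sup>+x. ennreal (norm (V (u (r k)) x) powr p) \<partial>lborel))"
      by (rule nn_integral_liminf) measurable
    also have "\<dots> \<le> liminf (\<lambda>k::nat. ennreal L)"
      by (intro Liminf_mono always_eventually allI VB)
    also have "\<dots> = ennreal L" by (simp add: Liminf_const)
    finally show ?thesis .
  qed
  obtain c where c: "\<And>x. norm (h x) \<le> c" "c \<ge> 0"
  proof -
    obtain N where N: "\<forall>k\<ge>N. \<forall>x. norm (V (u (r k)) x - h x) \<le> 1" using hr(3)[of 1] by auto
    show ?thesis
    proof (rule that[of "C * B + 1"])
      fix x
      have "norm (V (u (r N)) x) \<le> C * nrm (u (r N))" by (rule C(2)[OF rad_subset[OF u]])
      also have "\<dots> \<le> C * B" using C(1) B(2) by (intro mult_left_mono) auto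
      finally have "norm (V (u (r N)) x) \<le> C * B" .
      moreover have "norm (V (u (r N)) x - h x) \<le> 1" using N by blast
      ultimately show "norm (h x) \<le> C * B + 1"
        using norm_triangle_ineq2[of "h x" "V (u (r N)) x"] by (simp add: norm_minus_commute)
    qed (use C B in simp)
  qed
  have hL: "h \<in> Lq_space q lborel" by (rule Lq_interpolation(1)[OF p q hm c hB]) (simp add: L_def)
  define T where "T = 2 powr p * (L + L)"
  have T: "T \<ge> 0" by (simp add: T_def L_def)
  have dB: "(\<integral>\<^sup>+x. ennreal (norm (V (u k) x - h x) powr p) \<partial>lborel) \<le> ennreal T" for k
  proof -
    have "(\<integral>\<^sup>+x. ennreal (norm (V (u k) x - h x) powr p) \<partial>lborel) \<le>
      (\<integral>\<^sup>+x. ennreal (2 powr p) * (ennreal (norm (V (u k) x) powr p) + ennreal (norm (h x) powr p)) \<partial>lborel)"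
    proof (rule nn_integral_mono)
      fix x
      show "ennreal (norm (V (u k) x - h x) powr p) \<le> ennreal (2 powr p) * (ennreal (norm (V (u k) x) powr p) + ennreal (norm (h x) powr p))"
        using norm_diff_powr_le[OF p, of "V (u k) x" "h x"] by (simp add: ennreal_plus[symmetric] ennreal_mult[symmetric] ennreal_leI del: ennreal_plus)
    qed
    also have "\<dots> = ennreal (2 powr p) * ((\<integral>\<^sup>+x. ennreal (norm (V (u k) x) powr p) \<partial>lborel) + (\<integral>\<^sup>+x. ennreal (norm (h x) powr p) \<partial>lborel))"
      by (subst nn_integral_cmult, measurable, subst nn_integral_add) auto
    also have "\<dots> \<le> ennreal (2 powr p) * (ennreal L + ennreal L)" by (intro mult_left_mono add_mono VB hB) simp
    also have "\<dots> = ennreal T" by (simp add: T_def L_def ennreal_plus[symmetric] ennreal_mult[symmetric] del: ennreal_plus)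
    finally show ?thesis .
  qed
  have gV: "Lq_norm q lborel (\<lambda>x. g k x - h x) = Lq_norm q lborel (\<lambda>x. V (u k) x - h x)" for k
  proof (rule Lq_norm_AE_cong)
    have gk: "g k \<in> Lq_space q lborel" "is_function (u k) (g k)" using ug by auto
    show "(\<lambda>x. g k x - h x) \<in> borel_measurable lborel" using gm[OF gk(1)] hm by simp
    show "(\<lambda>x. V (u k) x - h x) \<in> borel_measurable lborel" by simp
    show "AE x in lborel. g k x - h x = V (u k) x - h x" using ae[OF u gk] by eventually_elim simp
  qed
  have "(\<lambda>k. Lq_norm q lborel (\<lambda>x. g (r k) x - h x)) \<longlonglongrightarrow> 0"
  proof (rule LIMSEQ_zero_from_bounds[of "if q = \<infinity> then 1 else T powr (1 / ?r)"])
    show "0 \<le> (if q = \<infinity> then 1 else T powr (1 / ?r))" by simp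
    fix e :: real assume e: "e > 0"
    define a where "a = (?r - p) / ?r"
    \<comment> \<open>The power undoes the exponent \<open>(q - p) / q\<close> that interpolation puts on the uniform distance.\<close>
    define e' where "e' = (if q = \<infinity> then e else e powr (1 / a))"
    have e': "e' > 0" using e by (simp add: e'_def)
    obtain N where N: "\<forall>k\<ge>N. \<forall>x. norm (V (u (r k)) x - h x) \<le> e'" using hr(3)[OF e'] by blast
    show "\<exists>N. \<forall>k\<ge>N. 0 \<le> Lq_norm q lborel (\<lambda>x. g (r k) x - h x) \<and> Lq_norm q lborel (\<lambda>x. g (r k) x - h x) \<le> (if q = \<infinity> then 1 else T powr (1 / ?r)) * e"
    proof (intro exI[of _ N] allI impI)
      fix k assume "N \<le> k"
      then have b: "\<And>x. norm (V (u (r k)) x - h x) \<le> e'" using N by blast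
      have wm: "(\<lambda>x. V (u (r k)) x - h x) \<in> borel_measurable lborel" by simp
      note I = Lq_interpolation[OF p q wm b less_imp_le[OF e'] dB[of "r k"] T]
      have "(if q = \<infinity> then e' else e' powr ((?r - p) / ?r) * T powr (1 / ?r)) = (if q = \<infinity> then 1 else T powr (1 / ?r)) * e"
      proof (cases "q = \<infinity>")
        case False
        have "a > 0" using rp[OF False] p by (simp add: a_def)
        then have "e' powr a = e" using e False by (simp add: e'_def powr_powr)
        then show ?thesis using False by (simp add: a_def mult.commute)
      qed (simp add: e'_def)
      then show "0 \<le> Lq_norm q lborel (\<lambda>x. g (r k) x - h x) \<and> Lq_norm q lborel (\<lambda>x. g (r k) x - h x) \<le> (if q = \<infinity> then 1 else T powr (1 / ?r)) * e"
        unfolding gV using I(2,3) by simp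
    qed
  qed
  then show "\<exists>h\<in>Lq_space q lborel. \<exists>r. strict_mono r \<and> (\<lambda>k. Lq_norm q lborel (\<lambda>x. g (r k) x - h x)) \<longlonglongrightarrow> 0"
    using hL hr(2) by (intro bexI[of _ h] exI[of _ r]) auto
qed

end

end

theorem theorem1p15:
  fixes s p lam :: real
  assumes "s > 0" and "p > 1" and "lam > 1"
  shows
    "(\<forall>\<Omega> :: 'a::euclidean_space set.
        bounded_lipschitz_domain \<Omega> \<and> real DIM('a) = 2 * s * p \<longrightarrow>
          compact_embedding (log_bessel_space p lam s) (log_bessel_norm p lam s)
            (restricts_to \<Omega>) (C_space (closure \<Omega>)) (sup_norm (closure \<Omega>)) \<and>
          (\<forall>q :: ennreal. 1 \<le> q \<longrightarrow>
             compact_embedding (log_bessel_space p lam s) (log_bessel_norm p lam s)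
               (restricts_to \<Omega>)
               (Lq_space q (restrict_space lborel \<Omega>)) (Lq_norm q (restrict_space lborel \<Omega>)))) \<and>
     (DIM('a) \<ge> 2 \<and> real DIM('a) = 2 * s * p \<longrightarrow>
        compact_embedding (log_bessel_space_rad p lam s) (log_bessel_norm p lam s)
          is_function (C0_space :: ('a \<Rightarrow> complex) set) (sup_norm UNIV) \<and>
        (\<forall>q :: ennreal. ennreal p < q \<longrightarrow>
           compact_embedding (log_bessel_space_rad p lam s) (log_bessel_norm p lam s)
             is_function (Lq_space q (lborel :: 'a measure)) (Lq_norm q lborel)))"
proof (intro conjI allI impI)
  fix \<Omega> :: "'a set" assume *: "bounded_lipschitz_domain \<Omega> \<and> real DIM('a) = 2 * s * p"
  then have \<Omega>: "open \<Omega>" "bounded \<Omega>" "\<Omega> \<noteq> {}" and n: "real DIM('a) = 2 * s * p"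
    by (auto simp: bounded_lipschitz_domain_def)
  show "compact_embedding (log_bessel_space p lam s) (log_bessel_norm p lam s)
            (restricts_to \<Omega>) (C_space (closure \<Omega>)) (sup_norm (closure \<Omega>))"
    by (rule local_compact_C[OF assms(3,1,2) n \<Omega>])
  show "compact_embedding (log_bessel_space p lam s) (log_bessel_norm p lam s)
               (restricts_to \<Omega>)
               (Lq_space q (restrict_space lborel \<Omega>)) (Lq_norm q (restrict_space lborel \<Omega>))" if "1 \<le> q" for q
    by (rule local_compact_Lq[OF assms(3,1,2) n \<Omega>(1,2) that])
next
  assume *: "DIM('a) \<ge> 2 \<and> real DIM('a) = 2 * s * p"
  then have dim: "DIM('a) \<ge> 2" and n: "real DIM('a) = 2 * s * p" by auto
  show "compact_embedding (log_bessel_space_rad p lam s) (log_bessel_norm p lam s)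
          is_function (C0_space :: ('a \<Rightarrow> complex) set) (sup_norm UNIV)"
    by (rule global_compact_C0[OF assms(3,1,2) n dim])
  show "compact_embedding (log_bessel_space_rad p lam s) (log_bessel_norm p lam s)
             is_function (Lq_space q (lborel :: 'a measure)) (Lq_norm q lborel)" if "ennreal p < q" for q
    by (rule global_compact_Lq[OF assms(3,1,2) n dim that])
qed

end
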